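(* For integers $a\ge b\ge c\ge0$ put $d=a+b+c$ and $R_{a,b,c}=\Bbbk[x,y,z]/(x^d,y^d,z^d,x^ay^bz^c)$. Suppose that $R_{a,b,c}$ has the WLP for all integers $a,b,c$ such that $d=a+b+c=6k+3$ for some integer $k$ and $4k+2>a>b>c>0$. Then for all integers $a\ge b\ge c\ge 0$, the algebra $R_{a,b,c}$ fails the WLP if and only if the following two conditions hold: (1) $d=6k+3$ for an integer $k$ such that $a<4k+2$; (2) among the numbers $a,b,c$, at least two are equal.
   Context: $\Bbbk$ is a field of characteristic zero, and $\Bbbk[x,y,z]$ has the standard grading. A standard graded Artinian algebra $A$ has the weak Lefschetz property (WLP) if there is a linear form $\ell$ such that for all $i$ the multiplication map $\cdot\ell:A_i\to A_{i+1}$ has maximal rank (i.e. is injective or surjective); it fails the WLP otherwise. *)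

theory Defs
  imports
    "HOL-Library.Poly_Mapping"
    "HOL-Algebra.QuotRing"
    "HOL-Algebra.Algebraic_Closure_Type"
begin

datatype var = VX | VY | VZ

text \<open>
  The polynomial ring in three variables over \<open>'k\<close>: finitely supported functions from exponent
  vectors to coefficients, with the convolution product. Its structure as an object of HOL-Algebra
  is \<^const>\<open>ring_of_type_algebra\<close>.
\<close>

type_synonym monomial = "var \<Rightarrow>\<^sub>0 nat"
type_synonym 'k poly3 = "monomial \<Rightarrow>\<^sub>0 'k"

definition var_poly :: "var \<Rightarrow> 'k::comm_ring_1 poly3" where
  "var_poly v = Poly_Mapping.single (Poly_Mapping.single v 1) 1"

definition monomial_degree :: "monomial \<Rightarrow> nat" where
  "monomial_degree m = (\<Sum>v\<in>{VX, VY, VZ}. Poly_Mapping.lookup m v)"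

text \<open>The graded piece of degree \<open>i\<close>, which includes the zero polynomial.\<close>

definition forms :: "nat \<Rightarrow> 'k::comm_ring_1 poly3 set" where
  "forms i = {f. \<forall>m\<in>Poly_Mapping.keys f. monomial_degree m = i}"

text \<open>
  A graded algebra is given by a ring \<open>A\<close> together with the family \<open>C\<close> of its graded pieces.
\<close>

definition has_WLP :: "('a, 'm) ring_scheme \<Rightarrow> (nat \<Rightarrow> 'a set) \<Rightarrow> bool" where
  "has_WLP A C \<longleftrightarrow>
    (\<exists>l \<in> C 1. \<forall>i. inj_on (\<lambda>u. l \<otimes>\<^bsub>A\<^esub> u) (C i) \<or> (\<lambda>u. l \<otimes>\<^bsub>A\<^esub> u) ` C i = C (i + 1))"

definition R_ideal :: "nat \<Rightarrow> nat \<Rightarrow> nat \<Rightarrow> 'k::comm_ring_1 poly3 set" where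
  "R_ideal a b c =
    (let x = var_poly VX; y = var_poly VY; z = var_poly VZ; d = a + b + c
     in Idl\<^bsub>ring_of_type_algebra\<^esub> {x ^ d, y ^ d, z ^ d, x ^ a * y ^ b * z ^ c})"

text \<open>The first argument of the following two constants only fixes the coefficient field.\<close>

definition R_algebra :: "'k::comm_ring_1 itself \<Rightarrow> nat \<Rightarrow> nat \<Rightarrow> nat \<Rightarrow> 'k poly3 set ring" where
  "R_algebra K a b c = ring_of_type_algebra Quot R_ideal a b c"

definition R_piece ::
    "'k::comm_ring_1 itself \<Rightarrow> nat \<Rightarrow> nat \<Rightarrow> nat \<Rightarrow> nat \<Rightarrow> 'k poly3 set set" where
  "R_piece K a b c i = (\<lambda>f. R_ideal a b c +>\<^bsub>ring_of_type_algebra\<^esub> f) ` forms i"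

lemma ideal_R_ideal: "ideal (R_ideal a b c :: 'k::comm_ring_1 poly3 set) ring_of_type_algebra"
  unfolding R_ideal_def Let_def
  by (rule ring.genideal_ideal[OF ring_from_type_algebra])
     (simp add: ring_of_type_algebra_def)

lemma cring_R_algebra: "cring (R_algebra (K :: 'k::comm_ring_1 itself) a b c)"
  unfolding R_algebra_def
  by (rule ideal.quotient_is_cring[OF ideal_R_ideal cring_from_type_algebra])

end

theory Submission
  imports Defs "Jordan_Normal_Form.Determinant"
begin

text \<open>
  Modulo a linear form with nonzero coefficients the ring becomes \<open>k[t]\<close>, with generators
  \<open>t\<^sup>d, 1, (1 + t)\<^sup>d, t\<^sup>a (1 + t)\<^sup>c\<close>, and the WLP says that in each degree the multiples of these four
  polynomials are independent or spanning. Omitting the rows covered by \<open>t\<^sup>d\<close> and \<open>1\<close> leaves a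
  matrix that is built from consecutive unit columns by repeated multiplication by \<open>1 + t\<close>. This
  multiplication preserves nonnegativity of minors; inserting \<open>h\<close> consecutive unit columns changes the
  sign of a minor by \<open>(-1)\<close> to the power \<open>h\<close> times the number of rows above. Hence the determinant is
  nonzero if \<open>h\<close> is even, if no rows lie above, or if \<open>c = 0\<close>. A suitable choice of columns settles
  all cases but \<open>d = 3 n + 1\<close> with \<open>n\<close> odd, where differentiating a relation excludes it, and
  \<open>d = 6 k + 3\<close>, \<open>a < 4 k + 2\<close>. If two exponents agree in this last case, then exchanging the two
  variables acts on the square system of size \<open>4 n\<close>, where \<open>n = 2 k + 1\<close>, and its symmetric part with
  \<open>2 n + 1\<close> unknowns and \<open>2 n\<close> equations forces a relation.
\<close>

section \<open>Minors of binomial matrices\<close>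

text \<open>Coefficients of degree below \<open>E\<close> give \<open>4 * E\<close> unknowns against
  \<open>d + E\<close> equations, so the system is square exactly for \<open>d = 3 * E\<close>. For
  \<open>d = 3 * n + 1\<close> and \<open>d = 3 * n + 2\<close> independence is asked for
  \<open>E = n\<close> and spanning for \<open>E = n + 1\<close>, and this slack leaves room for an
  even number \<open>h\<close> of columns from the mixed generator. For \<open>d = 3 * n\<close> one
  determinant decides both questions and \<open>h = n\<close> is forced, so the odd
  \<open>n = 2 * k + 1\<close> are critical; this is the origin of \<open>6 * k + 3\<close>. The
  bound \<open>a < 4 * k + 2\<close> is \<open>a < 2 * n\<close>, equivalently
  \<open>a < 2 * (b + c)\<close>; beyond it \<open>b + c\<close> columns of the mixed generator
  suffice, all others being multiples of \<open>t ^ d\<close>. The surplus of one symmetric unknown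
  is again due to \<open>n\<close> being odd: palindromes with \<open>n\<close> coefficients form a
  space of dimension \<open>(n + 1) / 2\<close>, and
  \<open>n + 2 * ((n + 1) / 2) = 2 * n + 1\<close>. Failure requires excluding every linear form.
  Those with a zero coefficient do not reduce to the four generators in \<open>t\<close> and are
  refuted by explicit elements.\<close>

definition minor :: "nat \<Rightarrow> (nat \<Rightarrow> int \<Rightarrow> 'a::comm_ring_1) \<Rightarrow> (nat \<Rightarrow> int) \<Rightarrow> 'a" where
  "minor m F I = det (mat m m (\<lambda>(i, j). F j (I i)))"

text \<open>Multiplication by \<open>1 + t\<close> on coefficient sequences. Integer indices avoid a
  boundary case at row 0.\<close>

definition shift_add :: "(int \<Rightarrow> 'a::comm_ring_1) \<Rightarrow> int \<Rightarrow> 'a" where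
  "shift_add f i = f i + f (i - 1)"

definition unit_at :: "int \<Rightarrow> int \<Rightarrow> 'a::comm_ring_1" where
  "unit_at v i = (if i = v then 1 else 0)"

lemma minor_cong:
  assumes "\<And>i j. i < m \<Longrightarrow> j < m \<Longrightarrow> F j (I i) = G j (J i)"
  shows "minor m F I = minor m G J"
  unfolding minor_def using assms by (intro arg_cong[of _ _ det] cong_mat) auto

lemma det_add_row:
  fixes A B C :: "nat \<Rightarrow> nat \<Rightarrow> 'a::comm_ring_1"
  assumes "k < m" and "\<And>j. A k j = B k j + C k j"
    and "\<And>i j. i \<noteq> k \<Longrightarrow> A i j = B i j" and "\<And>i j. i \<noteq> k \<Longrightarrow> A i j = C i j"
  shows "det (mat m m (\<lambda>(i, j). A i j)) = det (mat m m (\<lambda>(i, j). B i j)) + det (mat m m (\<lambda>(i, j). C i j))"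
proof -
  have fact: "(\<Prod>i = 0..<m. A i (p i)) = (\<Prod>i = 0..<m. B i (p i)) + (\<Prod>i = 0..<m. C i (p i))" for p
  proof -
    have expd: "(\<Prod>i = 0..<m. Y i) = Y k * (\<Prod>i\<in>{0..<m} - {k}. Y i)" for Y :: "nat \<Rightarrow> 'a"
      using assms(1) by (intro prod.remove) auto
    have "(\<Prod>i\<in>{0..<m} - {k}. A i (p i)) = (\<Prod>i\<in>{0..<m} - {k}. B i (p i))"
      "(\<Prod>i\<in>{0..<m} - {k}. A i (p i)) = (\<Prod>i\<in>{0..<m} - {k}. C i (p i))"
      using assms(3,4) by (auto intro!: prod.cong)
    then show ?thesis
      by (simp add: expd assms(2) algebra_simps)
  qed
  have expand: "det (mat m m (\<lambda>(i, j). Y i j)) =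
      (\<Sum>p | p permutes {0..<m}. signof p * (\<Prod>i = 0..<m. Y i (p i)))" for Y :: "nat \<Rightarrow> nat \<Rightarrow> 'a"
    by (subst det_def'[of _ m]) (auto intro!: sum.cong prod.cong simp: permutes_in_image)
  show ?thesis
    by (simp add: expand fact algebra_simps sum.distrib)
qed

lemma minor_eq_rows:
  assumes "i < m" "j < m" "i \<noteq> j" "I i = I j"
  shows "minor m F I = 0"
  unfolding minor_def using assms
  by (intro det_identical_rows[of _ m i j]) (auto simp: row_def)

text \<open>The bound \<open>U\<close> on the rows allows truncation of all columns at degree \<open>U\<close>.\<close>

definition totally_nonneg :: "int \<Rightarrow> nat \<Rightarrow> (nat \<Rightarrow> int \<Rightarrow> int) \<Rightarrow> bool" where
  "totally_nonneg U m F \<longleftrightarrow>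
    (\<forall>I. strict_mono_on {..<m} I \<and> (\<forall>k<m. I k < U) \<longrightarrow> 0 \<le> minor m F I)"

lemma totally_nonneg_mono:
  assumes "totally_nonneg U m F" "mono_on {..<m} I" "\<And>k. k < m \<Longrightarrow> I k < U"
  shows "0 \<le> minor m F I"
proof (cases "inj_on I {..<m}")
  case True
  then have "strict_mono_on {..<m} I"
    using assms(2) by (simp add: mono_imp_strict_mono)
  with assms(1,3) show ?thesis
    by (simp add: totally_nonneg_def)
next
  case False
  then obtain i j where "i < m" "j < m" "i \<noteq> j" "I i = I j"
    by (auto simp: inj_on_def)
  then show ?thesis
    using minor_eq_rows[of i m j I F] by simp
qed

text \<open>Expanding the rows one after the other, the lowest row first, keeps the row indices of all
  summands weakly increasing.\<close>

lemma hybrid_minor: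
  fixes F :: "nat \<Rightarrow> int \<Rightarrow> int"
  assumes tn: "totally_nonneg U m F" and I: "strict_mono_on {..<m} I" "\<And>k. k < m \<Longrightarrow> I k < U"
    and "j \<le> m" and \<epsilon>: "\<And>k. k < j \<Longrightarrow> \<epsilon> k \<in> {0, 1::int}" "\<And>k. k < m \<Longrightarrow> \<delta> k \<in> {0, 1::int}"
  defines "D \<equiv> \<lambda>j \<epsilon>. det (mat m m (\<lambda>(i, l). if i < j then F l (I i - \<epsilon> i) else shift_add (F l) (I i)))"
  shows "0 \<le> D j \<epsilon> \<and> minor m F (\<lambda>k. I k - (if k < j then \<epsilon> k else \<delta> k)) \<le> D j \<epsilon>"
  using \<open>j \<le> m\<close> \<epsilon>(1)
proof (induction "m - j" arbitrary: j \<epsilon>)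
  case 0
  then have "j = m" by simp
  have eq: "D j \<epsilon> = minor m F (\<lambda>k. I k - \<epsilon> k)"
    unfolding D_def minor_def \<open>j = m\<close> by (intro arg_cong[of _ _ det] cong_mat) auto
  have eq': "minor m F (\<lambda>k. I k - (if k < j then \<epsilon> k else \<delta> k)) = minor m F (\<lambda>k. I k - \<epsilon> k)"
    by (rule minor_cong) (simp add: \<open>j = m\<close>)
  have "mono_on {..<m} (\<lambda>k. I k - \<epsilon> k)"
  proof (rule mono_onI)
    fix r s assume rs: "r \<in> {..<m}" "s \<in> {..<m}" "r \<le> s"
    show "I r - \<epsilon> r \<le> I s - \<epsilon> s"
    proof (cases "r = s")
      case False
      then have "I r < I s"
        using rs I(1) by (auto simp: strict_mono_on_def)
      moreover have "\<epsilon> r \<ge> 0" "\<epsilon> s \<le> 1"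
        using 0(3)[of r] 0(3)[of s] rs \<open>j = m\<close> by auto
      ultimately show ?thesis by linarith
    qed simp
  qed
  moreover have "I k - \<epsilon> k < U" if "k < m" for k
    using I(2)[OF that] 0(3)[of k] that \<open>j = m\<close> by auto
  ultimately have "0 \<le> minor m F (\<lambda>k. I k - \<epsilon> k)"
    by (intro totally_nonneg_mono[OF tn]) auto
  then show ?case
    unfolding eq eq' by simp
next
  case (Suc x)
  then have j: "j < m" by simp
  have expd: "D j \<epsilon> = D (Suc j) (\<epsilon>(j := 0)) + D (Suc j) (\<epsilon>(j := 1))"
    unfolding D_def by (rule det_add_row[of j]) (use j in \<open>auto simp: shift_add_def less_Suc_eq\<close>)
  have step: "0 \<le> D (Suc j) (\<epsilon>(j := e)) \<and>
      minor m F (\<lambda>k. I k - (if k < Suc j then (\<epsilon>(j := e)) k else \<delta> k)) \<le> D (Suc j) (\<epsilon>(j := e))"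
    if "e \<in> {0, 1}" for e
    by (rule Suc.hyps(1)) (use Suc.hyps(2) Suc.prems that in \<open>auto simp: less_Suc_eq\<close>)
  \<comment> \<open>Of the two halves of row \<open>j\<close>, the one selected by
    \<open>\<delta> j\<close> dominates the minor in question, and the other is nonnegative.\<close>
  have "(\<lambda>k. I k - (if k < Suc j then (\<epsilon>(j := \<delta> j)) k else \<delta> k)) =
      (\<lambda>k. I k - (if k < j then \<epsilon> k else \<delta> k))"
    by (auto simp: fun_eq_iff less_Suc_eq)
  moreover have "\<delta> j \<in> {0, 1}"
    using \<epsilon>(2) j by auto
  ultimately show ?case
    using step[of 0] step[of 1] step[of "\<delta> j"] expd by auto
qed

lemma totally_nonneg_shift_add:
  assumes "totally_nonneg U m F"
  shows "totally_nonneg U m (\<lambda>j. shift_add (F j))"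
  unfolding totally_nonneg_def
proof (intro allI impI)
  fix I assume "strict_mono_on {..<m} I \<and> (\<forall>k<m. I k < U)"
  then show "0 \<le> minor m (\<lambda>j. shift_add (F j)) I"
    using hybrid_minor[OF assms, of I 0 "\<lambda>_. 0" "\<lambda>_. 0"] by (simp add: minor_def)
qed

lemma minor_le_shift_add:
  assumes "totally_nonneg U m F" "strict_mono_on {..<m} I" "\<And>k. k < m \<Longrightarrow> I k < U"
    and "\<And>k. k < m \<Longrightarrow> \<delta> k \<in> {0, 1}"
  shows "minor m F (\<lambda>k. I k - \<delta> k) \<le> minor m (\<lambda>j. shift_add (F j)) I"
  using hybrid_minor[OF assms(1-3), of 0 "\<lambda>_. 0" \<delta>] assms(4) by (simp add: minor_def)

section \<open>Unit columns and their signs\<close>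

lemma minor_unit_column_missing:
  assumes "j < m" "\<And>i. i < m \<Longrightarrow> I i \<noteq> v" "F j = unit_at v"
  shows "minor m F I = 0"
  unfolding minor_def
  by (subst laplace_expansion_column[of _ m j]) (use assms in \<open>auto simp: unit_at_def\<close>)

lemma minor_last_unit_column:
  assumes "q \<le> m" "inj_on I {..m}" "F m = unit_at (I q)"
  shows "minor (Suc m) F I = (-1) ^ (q + m) * minor m F (\<lambda>k. if k < q then I k else I (Suc k))"
proof -
  let ?A = "mat (Suc m) (Suc m) (\<lambda>(i, j). F j (I i))"
  have "minor (Suc m) F I = (\<Sum>i<Suc m. ?A $$ (i, m) * cofactor ?A i m)"
    unfolding minor_def by (rule laplace_expansion_column) auto
  also have "\<dots> = (\<Sum>i<Suc m. if i = q then cofactor ?A q m else 0)"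
    using assms by (intro sum.cong) (auto simp: unit_at_def inj_on_def)
  also have "\<dots> = cofactor ?A q m"
    using assms(1) by simp
  also have "mat_delete ?A q m = mat m m (\<lambda>(i, j). F j (if i < q then I i else I (Suc i)))"
    unfolding mat_delete_def using assms(1) by (intro eq_matI) auto
  then have "cofactor ?A q m = (-1) ^ (q + m) * minor m F (\<lambda>k. if k < q then I k else I (Suc k))"
    by (simp add: cofactor_def minor_def)
  finally show ?thesis .
qed

definition append_units :: "nat \<Rightarrow> (nat \<Rightarrow> int \<Rightarrow> 'a::comm_ring_1) \<Rightarrow> int \<Rightarrow> nat \<Rightarrow> int \<Rightarrow> 'a" where
  "append_units g F a j = (if j < g then F j else unit_at (a + int (j - g)))"

text \<open>Expand along the last column, \<open>h\<close> times. The column and row removed differ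
  by \<open>g - q\<close> each time, so every expansion contributes the same sign
  \<open>(-1) ^ (g - q)\<close>.\<close>

lemma minor_append_units:
  assumes "strict_mono_on {..<g + h} I" "q \<le> g" "\<And>j. j < h \<Longrightarrow> I (q + j) = a + int j"
  shows "minor (g + h) (append_units g F a) I =
    (-1) ^ (h * (g - q)) * minor g F (\<lambda>k. if k < q then I k else I (k + h))"
  using assms
proof (induction h arbitrary: I)
  case 0
  then show ?case
    by (auto intro!: minor_cong simp: append_units_def)
next
  case (Suc h)
  define I' where "I' = (\<lambda>k. if k < q + h then I k else I (Suc k))"
  have sm: "strict_mono_on {..<g + h} I'"
    using Suc.prems(1) by (auto simp: strict_mono_on_def I'_def)
  have "minor (g + Suc h) (append_units g F a) I = (-1) ^ ((q + h) + (g + h)) * minor (g + h) (append_units g F a) I'"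
    unfolding I'_def add_Suc_right
  proof (rule minor_last_unit_column)
    show "inj_on I {..g + h}"
      using strict_mono_on_imp_inj_on[OF Suc.prems(1)] by (simp add: lessThan_Suc_atMost)
    show "append_units g F a (g + h) = unit_at (I (q + h))"
      using Suc.prems(3)[of h] by (simp add: append_units_def)
  qed (use Suc.prems in auto)
  also have "minor (g + h) (append_units g F a) I' =
      (-1) ^ (h * (g - q)) * minor g F (\<lambda>k. if k < q then I' k else I' (k + h))"
    by (rule Suc.IH[OF sm]) (use Suc.prems in \<open>auto simp: I'_def\<close>)
  also have "minor g F (\<lambda>k. if k < q then I' k else I' (k + h)) = minor g F (\<lambda>k. if k < q then I k else I (k + Suc h))"
    by (rule minor_cong) (auto simp: I'_def)
  also have "(- 1 :: 'a) ^ ((q + h) + (g + h)) = (-1) ^ (g - q)"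
    using Suc.prems(2) by (auto simp: minus_one_power_iff)
  finally show ?case
    by (simp add: power_add)
qed

text \<open>No third row fits between two rows with neighbouring values, so rows that hit an
  interval of values occupy an interval of positions.\<close>

lemma strict_mono_on_consecutive:
  fixes I :: "nat \<Rightarrow> int"
  assumes sm: "strict_mono_on {..<m} I" and att: "\<And>j. j < h \<Longrightarrow> \<exists>i<m. I i = a + int j" and "0 < h"
  obtains q where "q + h \<le> m" "\<And>j. j < h \<Longrightarrow> I (q + j) = a + int j"
proof -
  obtain q where q: "q < m" "I q = a"
    using att[of 0] \<open>0 < h\<close> by auto
  have less_iff: "I i < I k \<longleftrightarrow> i < k" if "i < m" "k < m" for i k
    using sm that by (simp add: strict_mono_on_less)
  have "q + j < m \<and> I (q + j) = a + int j" if "j < h" for j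
    using that
  proof (induction j)
    case (Suc j)
    obtain i where i: "i < m" "I i = a + int (Suc j)"
      using att[OF Suc.prems] by auto
    have IH: "q + j < m" "I (q + j) = a + int j"
      using Suc by auto
    have "q + j < i"
      using less_iff[of "q + j" i] i IH by simp
    moreover have "\<not> Suc (q + j) < i"
    proof
      assume *: "Suc (q + j) < i"
      then have "I (q + j) < I (Suc (q + j))" "I (Suc (q + j)) < I i"
        using i(1) by (simp_all add: less_iff)
      then show False
        using i(2) IH(2) by simp
    qed
    ultimately have "i = q + Suc j" by simp
    with i show ?case by auto
  qed (use q in auto)
  note * = this
  show thesis
    by (rule that[of q]) (use *[of "h - 1"] * \<open>0 < h\<close> in auto)
qed

text \<open>Only minors that hit all \<open>h\<close> unit rows survive, and they carry the sign
  \<open>(-1) ^ (h * (g - q))\<close>. For odd \<open>h\<close> the bound \<open>U\<close> leaves no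
  room for rows beyond the unit rows, which means \<open>q = g\<close>.\<close>

lemma totally_nonneg_append_units:
  assumes tn: "totally_nonneg U g F" and "even h \<or> U \<le> a + int h"
  shows "totally_nonneg U (g + h) (append_units g F a)"
  unfolding totally_nonneg_def
proof (intro allI impI, elim conjE)
  fix I :: "nat \<Rightarrow> int"
  assume sm: "strict_mono_on {..<g + h} I" and U: "\<forall>k<g + h. I k < U"
  show "0 \<le> minor (g + h) (append_units g F a) I"
  proof (cases "\<forall>j<h. \<exists>i<g + h. I i = a + int j")
    case False
    then obtain j where "j < h" "\<And>i. i < g + h \<Longrightarrow> I i \<noteq> a + int j"
      by auto
    then show ?thesis
      using minor_unit_column_missing[of "g + j" "g + h" I "a + int j" "append_units g F a"]
      by (simp add: append_units_def fun_eq_iff)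
  next
    case True
    have "\<exists>q\<le>g. (\<forall>j<h. I (q + j) = a + int j)"
    proof (cases "h = 0")
      case False
      then show ?thesis
        using strict_mono_on_consecutive[OF sm, of h a] True by (metis add_le_cancel_right not_gr_zero)
    qed auto
    then obtain q where q: "q \<le> g" "\<And>j. j < h \<Longrightarrow> I (q + j) = a + int j"
      by blast
    have "even (h * (g - q))"
    proof (cases "even h")
      case False
      then have h: "U \<le> a + int h" "h > 0"
        using assms(2) by (auto intro: Nat.gr0I)
      have "q = g"
      proof (rule ccontr)
        assume "q \<noteq> g"
        then have "I (q + (h - 1)) < I (q + h)" "I (q + h) < U"
          using q(1) h(2) sm U by (auto simp: strict_mono_on_def)
        then show False
          using q(2)[of "h - 1"] h by simp
      qed
      then show ?thesis by simp
    qed simp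
    then have "minor (g + h) (append_units g F a) I = minor g F (\<lambda>k. if k < q then I k else I (k + h))"
      by (simp add: minor_append_units[OF sm q])
    moreover have "0 \<le> minor g F (\<lambda>k. if k < q then I k else I (k + h))"
      using tn sm U unfolding totally_nonneg_def strict_mono_on_def by auto
    ultimately show ?thesis by simp
  qed
qed

section \<open>Minors of powers of \<open>1 + t\<close>\<close>

lemma totally_nonneg_units: "totally_nonneg U g (\<lambda>j. unit_at (p + int j))"
proof -
  have "0 \<le> minor g (\<lambda>j. unit_at (p + int j) :: int \<Rightarrow> int) I" if sm: "strict_mono_on {..<g} I" for I
  proof (cases "\<forall>j<g. \<exists>i<g. I i = p + int j")
    case False
    then obtain j where "j < g" "\<And>i. i < g \<Longrightarrow> I i \<noteq> p + int j"
      by auto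
    then show ?thesis
      using minor_unit_column_missing[of j g I "p + int j" "\<lambda>j. unit_at (p + int j) :: int \<Rightarrow> int"] by simp
  next
    case True
    have "\<exists>q\<le>0. \<forall>j<g. I (q + j) = p + int j"
    proof (cases "g = 0")
      case False
      then show ?thesis
        using strict_mono_on_consecutive[OF sm, of g p] True by (metis add_le_same_cancel2 not_gr_zero)
    qed auto
    then have "I j = p + int j" if "j < g" for j
      using that by auto
    then have "minor g (\<lambda>j. unit_at (p + int j)) I = det (1\<^sub>m g :: int mat)"
      unfolding minor_def by (intro arg_cong[of _ _ det] eq_matI) (auto simp: unit_at_def)
    then show ?thesis by simp
  qed
  then show ?thesis
    by (simp add: totally_nonneg_def)
qed

lemma totally_nonneg_shift_add_power:
  assumes "totally_nonneg U m F"
  shows "totally_nonneg U m (\<lambda>j. (shift_add ^^ N) (F j))"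
  using assms totally_nonneg_shift_add[of U m] by (induction N) simp_all

lemma minor_le_shift_add_power:
  assumes "totally_nonneg U m F" "strict_mono_on {..<m} I" "\<And>k. k < m \<Longrightarrow> I k < U"
  shows "minor m F I \<le> minor m (\<lambda>j. (shift_add ^^ N) (F j)) I"
proof (induction N)
  case (Suc N)
  show ?case
    using minor_le_shift_add[where \<delta> = "\<lambda>_. 0",
        OF totally_nonneg_shift_add_power[where N = N, OF assms(1)] assms(2,3)] Suc
    by simp
qed simp

text \<open>The entries are the binomial coefficients \<open>N choose (J i - p - j)\<close>, and the
  two bounds say that the diagonal is nonzero. Lowering the rows by at most one reduces
  \<open>N\<close> by one, and the minor can only grow on the way back.\<close>

lemma minor_binomial_pos:
  fixes p :: int
  assumes "strict_mono_on {..<g} J" "\<And>k. k < g \<Longrightarrow> p + int k \<le> J k"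
    "\<And>k. k < g \<Longrightarrow> J k \<le> p + int k + int N"
  shows "0 < minor g (\<lambda>j. (shift_add ^^ N) (unit_at (p + int j)) :: int \<Rightarrow> int) J"
  using assms
proof (induction N arbitrary: J)
  case 0
  then have "J j = p + int j" if "j < g" for j
    using that 0(2,3)[of j] by (intro antisym) auto
  then have "minor g (\<lambda>j. unit_at (p + int j)) J = det (1\<^sub>m g :: int mat)"
    unfolding minor_def by (intro arg_cong[of _ _ det] eq_matI) (auto simp: unit_at_def)
  then show ?case
    unfolding funpow_0 by simp
next
  case (Suc N)
  \<comment> \<open>Only rows at their lower bound \<open>p + k\<close> stay put. All others move
    down, which yields the upper bound for \<open>N\<close>.\<close>
  define \<delta> where "\<delta> k = (if J k = p + int k then 0 else 1 :: int)" for k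
  have "strict_mono_on {..<g} (\<lambda>k. J k - \<delta> k)"
  proof (rule strict_mono_onI)
    fix r s assume rs: "r \<in> {..<g}" "s \<in> {..<g}" "r < s"
    then have "J r < J s"
      using Suc.prems(1) by (auto simp: strict_mono_on_def)
    moreover have "p + int s \<le> J s"
      using Suc.prems(2) rs by auto
    ultimately show "J r - \<delta> r < J s - \<delta> s"
      using rs(3) by (auto simp: \<delta>_def)
  qed
  moreover have "p + int k \<le> J k - \<delta> k" "J k - \<delta> k \<le> p + int k + int N" if "k < g" for k
    using Suc.prems(2,3)[OF that] by (auto simp: \<delta>_def)
  ultimately have "0 < minor g (\<lambda>j. (shift_add ^^ N) (unit_at (p + int j)) :: int \<Rightarrow> int) (\<lambda>k. J k - \<delta> k)"
    by (rule Suc.IH)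
  also have "\<dots> \<le> minor g (\<lambda>j. shift_add ((shift_add ^^ N) (unit_at (p + int j)))) J"
  proof (rule minor_le_shift_add[where U = "p + int g + int (Suc N)"])
    fix k assume "k < g"
    then show "J k < p + int g + int (Suc N)"
      using Suc.prems(3)[of k] by simp
  qed (use Suc.prems(1) totally_nonneg_shift_add_power[OF totally_nonneg_units] in \<open>auto simp: \<delta>_def\<close>)
  finally show ?case by simp
qed

text \<open>After splitting off \<open>(1 + t) ^ c\<close> from all columns, the last
  \<open>h\<close> are unit columns at rows \<open>a\<close> to \<open>a + h - 1\<close>. Deleting
  these rows leaves a binomial minor with exponent \<open>a + b\<close>, and \<open>p <= lo\<close>
  and \<open>lo + h <= p + a + b\<close> are the bounds that make it positive. Multiplying back by
  \<open>(1 + t) ^ c\<close> cannot decrease the minor as long as total nonnegativity holds.\<close>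

lemma minor_punctured_nonzero:
  fixes a b c g h lo p :: nat
  assumes "p \<le> lo" "lo \<le> a" "a \<le> lo + g" "lo + g + h \<le> a + b + c" "lo + h \<le> p + a + b"
    and parity: "even h \<or> h = b + c \<or> c = 0"
  shows "minor (g + h) (\<lambda>j. if j < g then (shift_add ^^ (a + b + c)) (unit_at (int (p + j)))
      else (shift_add ^^ c) (unit_at (int (a + (j - g))))) (\<lambda>k. int (lo + k)) \<noteq> (0 :: int)"
proof -
  define F where "F = (\<lambda>j. (shift_add ^^ (a + b)) (unit_at (int p + int j)) :: int \<Rightarrow> int)"
  define G where "G = append_units g F (int a)"
  define I where "I = (\<lambda>k. int (lo + k))"
  define U where "U = int (a + b + c)"
  have sm: "strict_mono_on {..<m} I" for m
    by (auto simp: strict_mono_on_def I_def)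
  have IU: "I k < U" if "k < g + h" for k
    using that assms(4) by (simp add: I_def U_def)
  have "minor (g + h) G I = (-1) ^ (h * (g - (a - lo))) * minor g F (\<lambda>k. if k < a - lo then I k else I (k + h))"
    unfolding G_def by (rule minor_append_units[OF sm]) (use assms in \<open>auto simp: I_def\<close>)
  moreover have pos: "0 < minor g F (\<lambda>k. if k < a - lo then I k else I (k + h))"
    unfolding F_def
    by (rule minor_binomial_pos) (use assms in \<open>auto simp: I_def strict_mono_on_def\<close>)
  ultimately have nz: "minor (g + h) G I \<noteq> 0"
    by simp
  have tnF: "totally_nonneg U g F"
    unfolding F_def by (intro totally_nonneg_shift_add_power totally_nonneg_units)
  have "minor (g + h) (\<lambda>j. (shift_add ^^ c) (G j)) I \<noteq> 0"
  \<comment> \<open>For \<open>c = 0\<close> nothing is multiplied back, so the sign picked up from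
    the unit columns does not matter.\<close>
  proof (cases "c = 0")
    case False
    then have tn: "totally_nonneg U (g + h) G"
      unfolding G_def using parity by (intro totally_nonneg_append_units[OF tnF]) (auto simp: U_def)
    then have "0 \<le> minor (g + h) G I"
      using sm IU by (auto simp: totally_nonneg_def)
    with nz show ?thesis
      using minor_le_shift_add_power[OF tn sm IU, of c] by simp
  qed (use nz in simp)
  moreover have "(shift_add ^^ c) (G j) = (if j < g then (shift_add ^^ (a + b + c)) (unit_at (int (p + j)))
      else (shift_add ^^ c) (unit_at (int (a + (j - g)))))" for j
    by (simp add: G_def append_units_def F_def funpow_add add.commute[of "a + b" c] of_nat_diff add_diff_eq)
  ultimately show ?thesis
    unfolding I_def by (simp only:) simp
qed

section \<open>Linear systems\<close>

lemma mult_mat_vec_mat: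
  fixes C :: "nat \<Rightarrow> nat \<Rightarrow> 'a::comm_ring_1"
  shows "mat m m (\<lambda>(k, j). C k j) *\<^sub>v vec m x = vec m (\<lambda>k. \<Sum>j<m. C k j * x j)"
  by (intro eq_vecI) (auto simp: scalar_prod_def lessThan_atLeast0)

lemma vec_eq_0_iff: "vec m x = 0\<^sub>v m \<longleftrightarrow> (\<forall>j<m. x j = 0)"
  by (auto simp: vec_eq_iff)

lemma det_eq_0_iff_kernel:
  fixes C :: "nat \<Rightarrow> nat \<Rightarrow> 'a::field"
  shows "det (mat m m (\<lambda>(k, j). C k j)) = 0 \<longleftrightarrow>
    (\<exists>x. (\<exists>j<m. x j \<noteq> 0) \<and> (\<forall>k<m. (\<Sum>j<m. C k j * x j) = 0))"
proof -
  have "det (mat m m (\<lambda>(k, j). C k j)) = 0 \<longleftrightarrow>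
      (\<exists>v. v \<in> carrier_vec m \<and> v \<noteq> 0\<^sub>v m \<and> mat m m (\<lambda>(k, j). C k j) *\<^sub>v v = 0\<^sub>v m)"
    by (rule det_0_iff_vec_prod_zero) auto
  also have "\<dots> \<longleftrightarrow> (\<exists>x. vec m x \<noteq> 0\<^sub>v m \<and> mat m m (\<lambda>(k, j). C k j) *\<^sub>v vec m x = 0\<^sub>v m)"
  proof (intro iffI; elim exE)
    fix v :: "'a vec" assume v: "v \<in> carrier_vec m \<and> v \<noteq> 0\<^sub>v m \<and> mat m m (\<lambda>(k, j). C k j) *\<^sub>v v = 0\<^sub>v m"
    then have "v = vec m (vec_index v)"
      by auto
    with v show "\<exists>x. vec m x \<noteq> 0\<^sub>v m \<and> mat m m (\<lambda>(k, j). C k j) *\<^sub>v vec m x = 0\<^sub>v m"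
      by metis
  next
    fix x assume "vec m x \<noteq> 0\<^sub>v m \<and> mat m m (\<lambda>(k, j). C k j) *\<^sub>v vec m x = 0\<^sub>v m"
    then show "\<exists>v. v \<in> carrier_vec m \<and> v \<noteq> 0\<^sub>v m \<and> mat m m (\<lambda>(k, j). C k j) *\<^sub>v v = 0\<^sub>v m"
      by (intro exI[of _ "vec m x"]) simp
  qed
  finally show ?thesis
    by (auto simp: mult_mat_vec_mat vec_eq_0_iff)
qed

lemma det_eq_0_left_kernel:
  fixes C :: "nat \<Rightarrow> nat \<Rightarrow> 'a::field"
  assumes "det (mat m m (\<lambda>(k, j). C k j)) = 0"
  obtains w where "\<exists>k<m. w k \<noteq> 0" "\<And>j. j < m \<Longrightarrow> (\<Sum>k<m. C k j * w k) = 0"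
proof -
  have "det (mat m m (\<lambda>(j, k). C k j)) = det (transpose_mat (mat m m (\<lambda>(k, j). C k j)))"
    by (intro arg_cong[of _ _ det] eq_matI) auto
  also have "\<dots> = 0"
    by (subst det_transpose[of _ m]) (use assms in auto)
  finally show thesis
    unfolding det_eq_0_iff_kernel using that by blast
qed

lemma det_nonzero_solution:
  fixes C :: "nat \<Rightarrow> nat \<Rightarrow> 'a::field"
  assumes "det (mat m m (\<lambda>(k, j). C k j)) \<noteq> 0"
  obtains x where "\<And>k. k < m \<Longrightarrow> (\<Sum>j<m. C k j * x j) = y k"
proof -
  let ?A = "mat m m (\<lambda>(k, j). C k j)"
  have "?A \<in> Units (ring_mat TYPE('a) m m)"
    by (rule det_non_zero_imp_unit) (use assms in auto)
  then obtain B where B: "B \<in> carrier_mat m m" "?A * B = 1\<^sub>m m"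
    by (auto simp: Units_def ring_mat_def)
  define v where "v = B *\<^sub>v vec m y"
  have "?A *\<^sub>v v = (?A * B) *\<^sub>v vec m y"
    unfolding v_def by (rule assoc_mult_mat_vec[symmetric]) (use B in auto)
  then have "?A *\<^sub>v v = vec m y"
    by (simp add: B)
  moreover have "v = vec m (vec_index v)"
    using B by (auto simp: v_def)
  ultimately have "vec m (\<lambda>k. \<Sum>j<m. C k j * vec_index v j) = vec m y"
    by (metis mult_mat_vec_mat)
  then show thesis
    by (intro that[of "vec_index v"]) (auto simp: vec_eq_iff)
qed

section \<open>The four generators on a line\<close>

text \<open>Binary forms of degree \<open>E - 1\<close> after setting one variable to 1. Indexing by
  the dimension makes \<open>E = 0\<close> the zero space, with no special case for the zero
  polynomial.\<close>

definition polys_below :: "nat \<Rightarrow> 'a::zero poly set" where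
  "polys_below E = {p. \<forall>k\<ge>E. poly.coeff p k = 0}"

lemma polys_below_0 [simp]: "0 \<in> polys_below E"
  by (simp add: polys_below_def)

lemma polys_below_mono: "E \<le> E' \<Longrightarrow> p \<in> polys_below E \<Longrightarrow> p \<in> polys_below E'"
  by (auto simp: polys_below_def)

lemma polys_below_add: "p \<in> polys_below E \<Longrightarrow> q \<in> polys_below E \<Longrightarrow> p + q \<in> polys_below E"
  for p q :: "'a::comm_monoid_add poly"
  by (auto simp: polys_below_def)

lemma polys_below_diff: "p \<in> polys_below E \<Longrightarrow> q \<in> polys_below E \<Longrightarrow> p - q \<in> polys_below E"
  for p q :: "'a::ab_group_add poly"
  by (auto simp: polys_below_def)

lemma polys_below_iff_degree:
  "p \<in> polys_below E \<longleftrightarrow> p = 0 \<or> Polynomial.degree p < E"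
proof (cases "p = 0")
  case False
  then have "poly.coeff p (Polynomial.degree p) \<noteq> 0"
    by simp
  with False show ?thesis
    by (auto simp: polys_below_def not_le coeff_eq_0 intro: ccontr)
qed simp

abbreviation X0 :: "'a::comm_semiring_1 poly" where "X0 \<equiv> [:0, 1:]"
abbreviation X1 :: "'a::comm_semiring_1 poly" where "X1 \<equiv> [:1, 1:]"

lemma X0_power: "(X0 :: 'a::comm_semiring_1 poly) ^ n = monom 1 n"
  by (simp add: monom_altdef)

lemma coeff_mult_X0_power:
  "poly.coeff (p * X0 ^ n) i = (if i < n then 0 else poly.coeff p (i - n))"
  for p :: "'a::comm_semiring_1 poly"
  by (simp add: X0_power coeff_monom_mult mult.commute[of p])

text \<open>Extension by zero to negative indices turns multiplication by \<open>X1\<close> into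
  \<open>shift_add\<close> without exception, and later allows reflections of the index.\<close>

definition int_coeff :: "'a::zero poly \<Rightarrow> int \<Rightarrow> 'a" where
  "int_coeff p i = (if i < 0 then 0 else poly.coeff p (nat i))"

lemma int_coeff_mult_X1: "int_coeff (p * X1) = shift_add (int_coeff p)"
proof
  fix i :: int
  show "int_coeff (p * X1) i = shift_add (int_coeff p) i"
  proof (cases "i \<le> 0")
    case False
    then obtain n where "i = int (Suc n)"
      by (metis gr0_implies_Suc linorder_not_less of_nat_0_less_iff zero_less_imp_eq_int)
    moreover have "nat (1 + int n) = Suc n"
      by simp
    ultimately show ?thesis
      by (simp add: int_coeff_def shift_add_def mult.commute[of p] coeff_pCons)
  qed (cases "i = 0"; simp add: int_coeff_def shift_add_def mult.commute[of p] coeff_pCons)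
qed

lemma of_int_shift_add: "of_int (shift_add f i) = shift_add (\<lambda>i. of_int (f i)) i"
  by (simp add: shift_add_def)

lemma int_coeff_monom_mult_X1_power:
  "int_coeff (monom 1 v * X1 ^ N :: 'a::comm_ring_1 poly) =
    (\<lambda>i. of_int ((shift_add ^^ N) (unit_at (int v)) i))"
proof (induction N)
  case 0
  show ?case
    by (auto simp: int_coeff_def unit_at_def fun_eq_iff)
next
  case (Suc N)
  have "int_coeff (monom 1 v * X1 ^ Suc N :: 'a poly) = shift_add (int_coeff (monom 1 v * X1 ^ N))"
    by (simp only: int_coeff_mult_X1[symmetric] power_Suc2 mult.assoc)
  also have "\<dots> = (\<lambda>i. of_int ((shift_add ^^ Suc N) (unit_at (int v)) i))"
    unfolding Suc by (simp add: fun_eq_iff of_int_shift_add)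
  finally show ?case .
qed

section \<open>The square system of the last two generators\<close>

definition column_poly :: "nat \<Rightarrow> nat \<Rightarrow> nat \<Rightarrow> nat \<Rightarrow> nat \<Rightarrow> nat \<Rightarrow> 'a::comm_semiring_1 poly" where
  "column_poly a b c p g j =
    (if j < g then monom 1 (p + j) * X1 ^ (a + b + c) else monom 1 (j - g) * X0 ^ a * X1 ^ c)"

lemma sum_column_poly:
  fixes x :: "nat \<Rightarrow> 'a::comm_ring_1"
  shows "(\<Sum>j<g. monom (x j) (p + j)) * X1 ^ (a + b + c) + (\<Sum>j<h. monom (x (g + j)) j) * X0 ^ a * X1 ^ c =
    (\<Sum>j<g + h. smult (x j) (column_poly a b c p g j))"
proof -
  have "(\<Sum>j<g + h. smult (x j) (column_poly a b c p g j)) =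
      (\<Sum>j<g. smult (x j) (column_poly a b c p g j)) + (\<Sum>j<h. smult (x (g + j)) (column_poly a b c p g (g + j)))"
    by (induction h) simp_all
  also have "(\<Sum>j<g. smult (x j) (column_poly a b c p g j)) = (\<Sum>j<g. monom (x j) (p + j)) * X1 ^ (a + b + c)"
    unfolding sum_distrib_right
    by (intro sum.cong) (auto simp: column_poly_def smult_monom simp flip: mult_smult_left)
  also have "(\<Sum>j<h. smult (x (g + j)) (column_poly a b c p g (g + j))) = (\<Sum>j<h. monom (x (g + j)) j) * X0 ^ a * X1 ^ c"
    unfolding sum_distrib_right
    by (intro sum.cong) (auto simp: column_poly_def smult_monom simp flip: mult_smult_left)
  finally show ?thesis by simp
qed

lemma coeff_sum_column_poly:
  fixes x :: "nat \<Rightarrow> 'a::comm_ring_1"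
  shows "poly.coeff (\<Sum>j<m. smult (x j) (column_poly a b c p g j)) i =
    (\<Sum>j<m. poly.coeff (column_poly a b c p g j) i * x j)"
  by (simp add: coeff_sum mult.commute)

text \<open>All entries are integers, so a determinant that is nonzero over the integers stays
  nonzero in characteristic zero.\<close>

lemma det_column_poly:
  assumes "p \<le> lo" "lo \<le> a" "a \<le> lo + g" "lo + g + h \<le> a + b + c" "lo + h \<le> p + a + b"
    and "even h \<or> h = b + c \<or> c = 0"
  shows "det (mat (g + h) (g + h) (\<lambda>(k, j). poly.coeff (column_poly a b c p g j) (lo + k) :: 'a::field_char_0)) \<noteq> 0"
proof -
  let ?F = "\<lambda>j. if j < g then (shift_add ^^ (a + b + c)) (unit_at (int (p + j)))
      else (shift_add ^^ c) (unit_at (int (a + (j - g)))) :: int \<Rightarrow> int"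
  have "int_coeff (column_poly a b c p g j :: 'a poly) = (\<lambda>i. of_int (?F j i))" for j
  proof -
    have "monom 1 (j - g) * X0 ^ a = (monom 1 (a + (j - g)) :: 'a poly)"
      by (simp add: X0_power mult_monom add.commute)
    then show ?thesis
      by (simp add: column_poly_def int_coeff_monom_mult_X1_power)
  qed
  moreover have "poly.coeff q i = int_coeff q (int i)" for q :: "'a poly" and i
    by (simp add: int_coeff_def)
  ultimately have eq: "mat (g + h) (g + h) (\<lambda>(k, j). poly.coeff (column_poly a b c p g j) (lo + k) :: 'a) =
      map_mat of_int (mat (g + h) (g + h) (\<lambda>(k, j). ?F j (int (lo + k))))"
    by (intro eq_matI) auto
  have "det (map_mat of_int (mat (g + h) (g + h) (\<lambda>(k, j). ?F j (int (lo + k)))) :: 'a mat) \<noteq> 0"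
    unfolding of_int_hom.hom_det of_int_eq_0_iff
    using minor_punctured_nonzero[OF assms] unfolding minor_def .
  then show ?thesis
    unfolding eq .
qed

lemma polys_below_sum_monom:
  fixes p :: "'a::comm_monoid_add poly"
  assumes "p \<in> polys_below h"
  shows "p = (\<Sum>j<h. monom (poly.coeff p j) j)"
proof (rule poly_eqI)
  fix i
  show "poly.coeff p i = poly.coeff (\<Sum>j<h. monom (poly.coeff p j) j) i"
    using assms by (auto simp: coeff_sum polys_below_def)
qed

lemma sum_monom_shift:
  fixes r :: "'a::comm_monoid_add poly"
  assumes "r \<in> polys_below (p + g)" "\<And>i. i < p \<Longrightarrow> poly.coeff r i = 0"
  shows "r = (\<Sum>j<g. monom (poly.coeff r (p + j)) (p + j))"
proof (rule poly_eqI)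
  fix i
  have "(\<Sum>j<g. if p + j = i then poly.coeff r (p + j) else 0) =
      (\<Sum>j<g. if p \<le> i \<and> j = i - p then poly.coeff r i else 0)"
    by (intro sum.cong) auto
  also have "\<dots> = poly.coeff r i"
    using assms by (cases "p \<le> i") (auto simp: polys_below_def)
  finally show "poly.coeff r i = poly.coeff (\<Sum>j<g. monom (poly.coeff r (p + j)) (p + j)) i"
    by (simp add: coeff_sum)
qed

text \<open>Rows below \<open>lo\<close> and from \<open>lo + g + h\<close> on are left open,
  because they are at the disposal of the generators \<open>1\<close> and \<open>X0 ^ d\<close>. The
  offset \<open>p\<close> drops the lowest coefficients of \<open>r\<close> from the
  unknowns.\<close>

lemma punctured_unique:
  fixes r s :: "'a::field_char_0 poly"
  assumes "p \<le> lo" "lo \<le> a" "a \<le> lo + g" "lo + g + h \<le> a + b + c" "lo + h \<le> p + a + b"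
    and "even h \<or> h = b + c \<or> c = 0"
    and r: "r \<in> polys_below (p + g)" "\<And>i. i < p \<Longrightarrow> poly.coeff r i = 0" and s: "s \<in> polys_below h"
    and zero: "\<And>i. lo \<le> i \<Longrightarrow> i < lo + g + h \<Longrightarrow>
      poly.coeff (r * X1 ^ (a + b + c) + s * X0 ^ a * X1 ^ c) i = 0"
  shows "r = 0 \<and> s = 0"
proof -
  define x where "x j = (if j < g then poly.coeff r (p + j) else poly.coeff s (j - g))" for j
  have "r = (\<Sum>j<g. monom (x j) (p + j))"
    by (subst sum_monom_shift[OF r]) (auto simp: x_def)
  moreover have "s = (\<Sum>j<h. monom (x (g + j)) j)"
    by (subst polys_below_sum_monom[OF s]) (auto simp: x_def)
  ultimately have "r * X1 ^ (a + b + c) + s * X0 ^ a * X1 ^ c =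
      (\<Sum>j<g + h. smult (x j) (column_poly a b c p g j))"
    by (simp only: sum_column_poly)
  then have "(\<Sum>j<g + h. poly.coeff (column_poly a b c p g j) (lo + k) * x j) = 0" if "k < g + h" for k
    using zero[of "lo + k"] that by (simp add: coeff_sum_column_poly)
  note ker = this
  have x0: "x j = 0" if "j < g + h" for j
  proof (rule ccontr)
    assume "x j \<noteq> 0"
    then have "det (mat (g + h) (g + h) (\<lambda>(k, j). poly.coeff (column_poly a b c p g j) (lo + k) :: 'a)) = 0"
      unfolding det_eq_0_iff_kernel using that ker by (intro exI[of _ x]) auto
    with det_column_poly[OF assms(1-6), where 'a = 'a] show False ..
  qed
  have "poly.coeff r (p + j) = 0" if "j < g" for j
    using x0[of j] that by (simp add: x_def)
  then have "r = 0"
    by (subst sum_monom_shift[OF r]) (auto intro!: sum.neutral)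
  moreover have "poly.coeff s j = 0" if "j < h" for j
    using x0[of "g + j"] that by (simp add: x_def)
  then have "s = 0"
    by (subst polys_below_sum_monom[OF s]) (auto intro!: sum.neutral)
  ultimately show ?thesis by simp
qed

lemma punctured_exists:
  fixes f :: "'a::field_char_0 poly"
  assumes "p \<le> lo" "lo \<le> a" "a \<le> lo + g" "lo + g + h \<le> a + b + c" "lo + h \<le> p + a + b"
    and "even h \<or> h = b + c \<or> c = 0"
  obtains r s where "r \<in> polys_below (p + g)" "s \<in> polys_below h"
    "\<And>i. lo \<le> i \<Longrightarrow> i < lo + g + h \<Longrightarrow>
      poly.coeff (r * X1 ^ (a + b + c) + s * X0 ^ a * X1 ^ c) i = poly.coeff f i"
proof -
  obtain x where x: "\<And>k. k < g + h \<Longrightarrow>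
      (\<Sum>j<g + h. poly.coeff (column_poly a b c p g j) (lo + k) * x j) = poly.coeff f (lo + k)"
    using det_nonzero_solution[OF det_column_poly[OF assms, where 'a = 'a],
        where y = "\<lambda>k. poly.coeff f (lo + k)"] by blast
  define r where "r = (\<Sum>j<g. monom (x j) (p + j))"
  define s where "s = (\<Sum>j<h. monom (x (g + j)) j)"
  show thesis
  proof
    show "r \<in> polys_below (p + g)" "s \<in> polys_below h"
      by (auto simp: r_def s_def polys_below_def coeff_sum intro!: sum.neutral)
    fix i assume "lo \<le> i" "i < lo + g + h"
    then show "poly.coeff (r * X1 ^ (a + b + c) + s * X0 ^ a * X1 ^ c) i = poly.coeff f i"
      unfolding r_def s_def sum_column_poly coeff_sum_column_poly
      using x[of "i - lo"] by simp
  qed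
qed

lemma polys_below_mult_X1_power:
  fixes p :: "'a::idom poly"
  assumes "p \<in> polys_below E"
  shows "p * X1 ^ n \<in> polys_below (E + n)"
proof (cases "p = 0")
  case False
  then have "Polynomial.degree (p * X1 ^ n) = Polynomial.degree p + n"
    by (simp add: degree_mult_eq degree_power_eq)
  with False assms show ?thesis
    by (simp add: polys_below_iff_degree)
qed simp

lemma polys_below_mult_X0_power:
  fixes p :: "'a::idom poly"
  assumes "p \<in> polys_below E"
  shows "p * X0 ^ n \<in> polys_below (E + n)"
proof (cases "p = 0")
  case False
  then have "Polynomial.degree (p * X0 ^ n) = Polynomial.degree p + n"
    by (simp add: degree_mult_eq degree_power_eq)
  with False assms show ?thesis
    by (simp add: polys_below_iff_degree)
qed simp

lemma poly_cutoff_plus_shift: "p = poly_cutoff n p + poly_shift n p * X0 ^ n"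
  for p :: "'a::comm_ring_1 poly"
  by (rule poly_eqI) (auto simp: coeff_poly_cutoff coeff_poly_shift coeff_mult_X0_power)

text \<open>The image of the combination \<open>P x\<^sup>d + Q y\<^sup>d + R z\<^sup>d + S x\<^sup>a y\<^sup>b z\<^sup>c\<close>
  under \<open>x \<mapsto> t\<close>, \<open>y \<mapsto> 1\<close>, \<open>z \<mapsto> 1 + t\<close>.\<close>

definition gen_comb :: "nat \<Rightarrow> nat \<Rightarrow> nat \<Rightarrow> 'a::comm_ring_1 poly \<Rightarrow> 'a poly \<Rightarrow> 'a poly \<Rightarrow> 'a poly \<Rightarrow> 'a poly" where
  "gen_comb a b c p q r s =
    p * X0 ^ (a + b + c) + q + r * X1 ^ (a + b + c) + s * X0 ^ a * X1 ^ c"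

text \<open>The relation \<open>x\<^sup>b\<^sup>+\<^sup>c \<cdot> x\<^sup>a y\<^sup>b z\<^sup>c = y\<^sup>b z\<^sup>c \<cdot> x\<^sup>d\<close> holds before reduction modulo the linear
  form, hence the divisibility in place of \<open>s = 0\<close>.\<close>

definition gens_independent :: "'a::comm_ring_1 itself \<Rightarrow> nat \<Rightarrow> nat \<Rightarrow> nat \<Rightarrow> nat \<Rightarrow> bool" where
  "gens_independent K a b c E \<longleftrightarrow>
    (\<forall>p\<in>polys_below E. \<forall>q\<in>polys_below E. \<forall>r\<in>polys_below E. \<forall>s\<in>polys_below E.
      gen_comb a b c p q r (s :: 'a poly) = 0 \<longrightarrow> q = 0 \<and> r = 0 \<and> X0 ^ (b + c) dvd s)"

definition gens_spanning :: "'a::comm_ring_1 itself \<Rightarrow> nat \<Rightarrow> nat \<Rightarrow> nat \<Rightarrow> nat \<Rightarrow> bool" where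
  "gens_spanning K a b c E \<longleftrightarrow>
    (\<forall>f\<in>polys_below (a + b + c + E). \<exists>p\<in>polys_below E. \<exists>q\<in>polys_below E. \<exists>r\<in>polys_below E.
      \<exists>s\<in>polys_below E. (f :: 'a poly) = gen_comb a b c p q r s)"

text \<open>Since \<open>X0 ^ (b + c) * X0 ^ a = X0 ^ d\<close>, the part of \<open>s\<close>
  divisible by \<open>X0 ^ (b + c)\<close> can be moved into the coefficient of
  \<open>X0 ^ d\<close>. Only the cutoff of \<open>s\<close> reaches the rows below
  \<open>d\<close>, where the square system applies.\<close>

lemma gen_comb_zero_cases:
  fixes p q r s :: "'a::field_char_0 poly"
  assumes par: "o' \<le> lo" "lo \<le> a" "a \<le> lo + g" "lo + g + h \<le> a + b + c" "lo + h \<le> o' + a + b"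
      "even h \<or> h = b + c \<or> c = 0"
    and q: "q \<in> polys_below lo" and s: "poly_cutoff (b + c) s \<in> polys_below h"
    and r: "r \<in> polys_below (o' + g)" "\<And>i. i < o' \<Longrightarrow> poly.coeff r i = 0"
    and zero: "gen_comb a b c p q r s = 0"
  shows "q = 0 \<and> r = 0 \<and> X0 ^ (b + c) dvd s"
proof -
  define d where "d = a + b + c"
  define s1 where "s1 = poly_cutoff (b + c) s"
  define s2 where "s2 = poly_shift (b + c) s"
  have s_eq: "s = s1 + s2 * X0 ^ (b + c)"
    unfolding s1_def s2_def by (rule poly_cutoff_plus_shift)
  have zero': "(p + s2 * X1 ^ c) * X0 ^ d + q + (r * X1 ^ (a + b + c) + s1 * X0 ^ a * X1 ^ c) = 0"
    using zero unfolding s_eq by (simp add: gen_comb_def d_def power_add algebra_simps)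
  have low: "poly.coeff q i + poly.coeff (r * X1 ^ (a + b + c) + s1 * X0 ^ a * X1 ^ c) i = 0" if "i < d" for i
    using arg_cong[OF zero', of "\<lambda>f. poly.coeff f i"] that by (simp add: coeff_mult_X0_power)
  have "r = 0 \<and> s1 = 0"
  proof (rule punctured_unique[OF par r])
    show "s1 \<in> polys_below h"
      using s by (simp add: s1_def)
    fix i assume i: "lo \<le> i" "i < lo + g + h"
    then have "poly.coeff q i = 0" "i < d"
      using q par by (auto simp: polys_below_def d_def)
    then show "poly.coeff (r * X1 ^ (a + b + c) + s1 * X0 ^ a * X1 ^ c) i = 0"
      using low[of i] by simp
  qed
  then have "r = 0" "s1 = 0"
    by simp_all
  have "poly.coeff q i = 0" for i
    using low[of i] q par by (cases "i < d") (auto simp: \<open>r = 0\<close> \<open>s1 = 0\<close> polys_below_def d_def)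
  then have "q = 0"
    by (simp add: poly_eq_iff)
  moreover have "X0 ^ (b + c) dvd s"
    using s_eq \<open>s1 = 0\<close> by simp
  ultimately show ?thesis
    using \<open>r = 0\<close> by simp
qed

text \<open>The numbers \<open>lo\<close>, \<open>g\<close> and \<open>h\<close> may exceed what
  \<open>E\<close> requires: independence of a larger set of columns is inherited by a smaller one.
  This freedom serves to make \<open>h\<close> even and the system square.\<close>

lemma gens_independentI:
  assumes "lo \<le> a" "a \<le> lo + g" "lo + g + h \<le> a + b + c" "lo + h \<le> a + b"
    and "even h \<or> h = b + c \<or> c = 0" and "E \<le> g" "min (b + c) E \<le> h" "E \<le> lo"
  shows "gens_independent TYPE('a::field_char_0) a b c E"
  unfolding gens_independent_def
proof (intro ballI impI)
  fix p q r s :: "'a poly"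
  assume *: "p \<in> polys_below E" "q \<in> polys_below E" "r \<in> polys_below E" "s \<in> polys_below E"
    "gen_comb a b c p q r s = 0"
  show "q = 0 \<and> r = 0 \<and> X0 ^ (b + c) dvd s"
  proof (rule gen_comb_zero_cases[of 0 lo a g h])
    show "poly_cutoff (b + c) s \<in> polys_below h"
      using *(4) assms by (auto simp: polys_below_def coeff_poly_cutoff)
  qed (use assms * polys_below_mono[of E] in auto)
qed

text \<open>Dually, fewer columns than \<open>E\<close> permits are enough. They solve the rows from
  \<open>E\<close> to \<open>d - 1\<close>, and all other rows are absorbed by the generators
  \<open>1\<close> and \<open>X0 ^ d\<close>.\<close>

lemma gens_spanningI:
  assumes "o' \<le> E" "E \<le> a" "a \<le> E + g" "E + g + h = a + b + c" "E + h \<le> o' + a + b"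
    and "even h \<or> h = b + c \<or> c = 0" and "o' + g \<le> E" "h \<le> E"
  shows "gens_spanning TYPE('a::field_char_0) a b c E"
  unfolding gens_spanning_def
proof (intro ballI)
  fix f :: "'a poly" assume f: "f \<in> polys_below (a + b + c + E)"
  define d where "d = a + b + c"
  obtain r s where rs: "r \<in> polys_below (o' + g)" "s \<in> polys_below h"
    and eq: "\<And>i. E \<le> i \<Longrightarrow> i < E + g + h \<Longrightarrow>
      poly.coeff (r * X1 ^ (a + b + c) + s * X0 ^ a * X1 ^ c) i = poly.coeff f i"
    using punctured_exists[of o' E a g h b c f] assms by auto
  have rsE: "r \<in> polys_below E" "s \<in> polys_below E"
    using rs assms polys_below_mono by blast+
  define m where "m = f - (r * X1 ^ (a + b + c) + s * X0 ^ a * X1 ^ c)"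
  have "s * X0 ^ a * X1 ^ c \<in> polys_below (d + E)"
    using polys_below_mult_X1_power[OF polys_below_mult_X0_power[OF rsE(2), of a], of c]
    by (rule polys_below_mono[rotated]) (simp add: d_def)
  moreover have "r * X1 ^ (a + b + c) \<in> polys_below (d + E)"
    using polys_below_mult_X1_power[OF rsE(1), of "a + b + c"] by (simp add: d_def add.commute)
  ultimately have "m \<in> polys_below (d + E)"
    unfolding m_def using f by (intro polys_below_diff polys_below_add) (auto simp: d_def)
  moreover have "poly.coeff m i = 0" if "E \<le> i" "i < d" for i
    using eq[of i] that assms by (simp add: m_def d_def)
  moreover have "E \<le> d"
    using assms by (simp add: d_def)
  ultimately have "m = poly_shift d m * X0 ^ d + poly_cutoff E m"
    by (intro poly_eqI) (auto simp: coeff_mult_X0_power coeff_poly_shift coeff_poly_cutoff polys_below_def)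
  then have "f = gen_comb a b c (poly_shift d m) (poly_cutoff E m) r s"
    by (simp add: gen_comb_def m_def d_def algebra_simps)
  moreover have "poly_shift d m \<in> polys_below E" "poly_cutoff E m \<in> polys_below E"
    using \<open>m \<in> polys_below (d + E)\<close> by (auto simp: polys_below_def coeff_poly_shift coeff_poly_cutoff)
  ultimately show "\<exists>p\<in>polys_below E. \<exists>q\<in>polys_below E. \<exists>r\<in>polys_below E. \<exists>s\<in>polys_below E.
      f = gen_comb a b c p q r s"
    using rsE by blast
qed

section \<open>Relations under a derivation\<close>

lemma X0_mult_pderiv_X0_power: "X0 * pderiv (X0 ^ k) = (of_nat k * X0 ^ k :: 'a::field_char_0 poly)"
  unfolding X0_power pderiv_monom
  by (cases k) (simp_all add: monom_Suc of_nat_poly smult_monom)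

lemma X1_mult_pderiv_X1_power: "X1 * pderiv (X1 ^ k) = (of_nat k * X1 ^ k :: 'a::field_char_0 poly)"
proof (cases k)
  case (Suc j)
  have "pderiv (X1 :: 'a poly) = 1"
    by (simp add: pderiv_pCons)
  then have "X1 * pderiv (X1 ^ k) = X1 * (smult (of_nat k) (X1 ^ j) :: 'a poly)"
    unfolding Suc pderiv_power_Suc by (simp only: mult_1_right)
  also have "\<dots> = of_nat k * X1 ^ k"
    unfolding Suc of_nat_poly by (simp only: mult_smult_right mult_smult_left power_Suc smult_smult mult_1_left) simp
  finally show ?thesis .
qed simp

text \<open>If \<open>p\<close> vanishes to order \<open>k\<close> at 0, the coefficient of
  \<open>t ^ k\<close> on the left is \<open>k + w\<close> times that of \<open>p\<close>, and
  \<open>k + w\<close> is nonzero in characteristic zero.\<close>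

lemma ode_no_solution:
  fixes p :: "'a::field_char_0 poly"
  assumes "0 < w" and eq: "X0 * X1 * pderiv p + of_nat w * p + X0 * u * p = 0"
  shows "p = 0"
proof (rule ccontr)
  assume "p \<noteq> 0"
  define k where "k = order 0 p"
  from \<open>p \<noteq> 0\<close> obtain q where p: "p = X0 ^ k * q" and q0: "poly q 0 \<noteq> 0"
    using order_decomp[of p 0] by (auto simp: k_def poly_eq_0_iff_dvd)
  have "X0 * X1 * pderiv p = X1 * ((X0 * pderiv (X0 ^ k)) * q + X0 ^ k * (X0 * pderiv q))"
    unfolding p pderiv_mult by (simp only: algebra_simps)
  also have "\<dots> = X0 ^ k * (X1 * (of_nat k * q + X0 * pderiv q))"
    unfolding X0_mult_pderiv_X0_power by (simp only: algebra_simps)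
  finally have "X0 ^ k * (X1 * (of_nat k * q + X0 * pderiv q) + of_nat w * q + X0 * u * q) = 0"
    using eq unfolding p by (simp only: algebra_simps)
  moreover have "(X0 :: 'a poly) ^ k \<noteq> 0"
    by simp
  ultimately have "X1 * (of_nat k * q + X0 * pderiv q) + of_nat w * q + X0 * u * q = 0"
    by (metis mult_eq_0_iff)
  from arg_cong[OF this, of "\<lambda>f. poly f 0"] have "(of_nat k + of_nat w) * poly q 0 = 0"
    by (simp add: algebra_simps)
  then show False
    using q0 \<open>0 < w\<close> by (simp flip: of_nat_add)
qed

text \<open>The derivation \<open>t (1 + t) d/dt\<close> vanishes at the roots 0 and -1 of the
  generators, so it multiplies each generator by a polynomial of degree at most one. Hence it turns
  a relation into a relation whose degree is higher by at most one.\<close>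

lemma gen_comb_derivation:
  fixes p q r s :: "'a::field_char_0 poly" and a b c :: nat
  defines "D \<equiv> \<lambda>f. X0 * X1 * pderiv f" and "d \<equiv> a + b + c"
  shows "gen_comb a b c (D p + of_nat d * X1 * p) (D q) (D r + of_nat d * X0 * r)
      (D s + (of_nat a * X1 + of_nat c * X0) * s) = D (gen_comb a b c p q r s)"
proof -
  have D_mult: "D (f * g) = D f * g + f * D g" for f g
    by (simp only: D_def pderiv_mult algebra_simps)
  have D_add: "D (f + g) = D f + D g" for f g
    by (simp only: D_def pderiv_add algebra_simps)
  have D_X0: "D (X0 ^ k) = of_nat k * X1 * X0 ^ k" for k
    using arg_cong[OF X0_mult_pderiv_X0_power[of k], of "\<lambda>f. X1 * f"]
    by (simp only: D_def ac_simps)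
  have D_X1: "D (X1 ^ k) = of_nat k * X0 * X1 ^ k" for k
    using arg_cong[OF X1_mult_pderiv_X1_power[of k], of "\<lambda>f. X0 * f"]
    by (simp only: D_def ac_simps)
  show ?thesis
    unfolding gen_comb_def D_add D_mult D_X0 D_X1 d_def by (simp only: algebra_simps)
qed

lemma gen_comb_diff_mult:
  "gen_comb a b c (p - m * p') (q - m * q') (r - m * r') (s - m * s') =
    gen_comb a b c p q r s - m * gen_comb a b c p' q' r' s'"
  by (simp only: gen_comb_def algebra_simps)

text \<open>An elementary instance of the Grauert--Muelich argument: the relations of degree at most \<open>n\<close>
  are determined by the two extreme coefficients of \<open>r\<close>. A relation \<open>\<sigma>\<close> of smaller degree is
  therefore mapped to a multiple \<open>\<beta> t \<sigma>\<close> by the derivation \<open>t (1 + t) d/dt\<close>, and no nonzero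
  \<open>\<sigma>\<close> satisfies these differential equations.\<close>

lemma gens_independent_3n1_odd:
  assumes n: "odd n" "a + b + c = 3 * n + 1" and "b \<le> a" "c \<le> b" "a \<le> 2 * n"
  shows "gens_independent TYPE('a::field_char_0) a b c n"
  unfolding gens_independent_def
proof (intro ballI impI)
  define d where "d = a + b + c"
  have "n \<ge> 1"
    using n by (cases n) auto
  have uniq: "p = 0 \<and> q = 0 \<and> r = 0 \<and> s = 0"
    if below: "p \<in> polys_below (n + 1)" "q \<in> polys_below (n + 1)" "r \<in> polys_below (n + 1)" "s \<in> polys_below (n + 1)"
      and zero: "gen_comb a b c p q r s = 0" and r: "poly.coeff r 0 = 0" "poly.coeff r n = 0"
    for p q r s :: "'a poly"
  proof -
    have "r \<in> polys_below (1 + (n - 1))"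
      using below(3) r(2) \<open>n \<ge> 1\<close> by (auto simp: polys_below_def) (metis Suc_leI le_neq_implies_less)
    \<comment> \<open>Without its two extreme coefficients \<open>r\<close> has \<open>n - 1\<close>
      unknowns starting at offset 1, which leaves the even number \<open>n + 1\<close> of columns
      for \<open>s\<close>.\<close>
    then have *: "q = 0 \<and> r = 0 \<and> X0 ^ (b + c) dvd s"
      using below r zero assms
      by (intro gen_comb_zero_cases[of 1 "n + 1" a "n - 1" "n + 1" b c]) (auto simp: polys_below_def coeff_poly_cutoff)
    then obtain s' where s': "s = s' * X0 ^ (b + c)"
      by (auto simp: dvd_def mult.commute)
    \<comment> \<open>From \<open>a <= 2 * n\<close> follows \<open>b + c > n\<close>, so a nonzero
      multiple of \<open>X0 ^ (b + c)\<close> exceeds the degree bound on \<open>s\<close>.\<close>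
    have "s = 0"
    proof (rule ccontr)
      assume "s \<noteq> 0"
      then have "Polynomial.degree s = Polynomial.degree s' + (b + c)"
        unfolding s' by (subst degree_mult_eq) (auto simp: degree_power_eq)
      moreover have "Polynomial.degree s < n + 1"
        using below(4) \<open>s \<noteq> 0\<close> by (simp add: polys_below_iff_degree)
      ultimately show False
        using assms by simp
    qed
    with * zero show ?thesis
      by (simp add: gen_comb_def)
  qed
  fix p q r s :: "'a poly"
  assume \<sigma>: "p \<in> polys_below n" "q \<in> polys_below n" "r \<in> polys_below n" "s \<in> polys_below n"
    and zero: "gen_comb a b c p q r s = 0"
  define D :: "'a poly \<Rightarrow> 'a poly" where "D = (\<lambda>f. X0 * X1 * pderiv f)"
  have D_below: "D f \<in> polys_below (n + 1)" if "f \<in> polys_below n" for f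
  proof -
    have "pderiv f \<in> polys_below (n - 1)"
      using that by (auto simp: polys_below_def coeff_pderiv)
    from polys_below_mult_X1_power[OF polys_below_mult_X0_power[OF this, of 1], of 1]
    show ?thesis
      using \<open>n \<ge> 1\<close> by (simp only: D_def power_one_right ac_simps) simp
  qed
  have X0_below: "X0 * f \<in> polys_below (n + 1)" if "f \<in> polys_below n" for f :: "'a poly"
    using polys_below_mult_X0_power[OF that, of 1] by (simp only: power_one_right ac_simps)
  have X1_below: "X1 * f \<in> polys_below (n + 1)" if "f \<in> polys_below n" for f :: "'a poly"
    using polys_below_mult_X1_power[OF that, of 1] by (simp only: power_one_right ac_simps)
  have const_below: "[:k:] * f \<in> polys_below N" if "f \<in> polys_below N" for k N and f :: "'a poly"
    using that by (simp add: polys_below_def)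
  have \<sigma>_below: "p \<in> polys_below (n + 1)" "q \<in> polys_below (n + 1)" "r \<in> polys_below (n + 1)" "s \<in> polys_below (n + 1)"
    using \<sigma> polys_below_mono[of n "n + 1"] by auto
  have "p = 0 \<and> q = 0 \<and> r = 0 \<and> s = 0"
  proof (cases "poly.coeff r 0 = 0 \<or> poly.coeff r (n - 1) = 0")
    case True
    then show ?thesis
    proof
      assume "poly.coeff r 0 = 0"
      then show ?thesis
        using \<sigma>(3) by (intro uniq[OF \<sigma>_below zero]) (auto simp: polys_below_def)
    next
      assume *: "poly.coeff r (n - 1) = 0"
      \<comment> \<open>Multiplying the relation by \<open>t\<close> makes the constant term of
        \<open>r\<close> zero and moves the vanishing coefficient at \<open>n - 1\<close> to
        position \<open>n\<close>.\<close>
      have "gen_comb a b c (X0 * p) (X0 * q) (X0 * r) (X0 * s) = X0 * gen_comb a b c p q r s"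
        by (simp only: gen_comb_def algebra_simps)
      then have "X0 * p = 0 \<and> X0 * q = 0 \<and> X0 * r = 0 \<and> X0 * s = 0"
        using * \<open>n \<ge> 1\<close> zero
        by (intro uniq X0_below \<sigma>) (auto simp: coeff_pCons split: nat.splits)
      then show ?thesis by simp
    qed
  next
    case False
    define p' where "p' = D p + of_nat d * X1 * p"
    define r' where "r' = D r + of_nat d * X0 * r"
    define s' where "s' = D s + (of_nat a * X1 + of_nat c * X0) * s"
    \<comment> \<open>Chosen to cancel the coefficient of \<open>t ^ n\<close> in \<open>r'\<close>.
      The constant term of \<open>r'\<close> is zero anyway, because both of its summands are
      multiples of \<open>t\<close>.\<close>
    define \<beta> where "\<beta> = poly.coeff r' n / poly.coeff r (n - 1)"
    define m :: "'a poly" where "m = [:\<beta>:] * X0"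
    have below': "p' \<in> polys_below (n + 1)" "D q \<in> polys_below (n + 1)" "r' \<in> polys_below (n + 1)" "s' \<in> polys_below (n + 1)"
      unfolding p'_def r'_def s'_def of_nat_poly distrib_right mult.assoc
      by (intro polys_below_add D_below const_below X0_below X1_below \<sigma>)+
    have m_below: "m * f \<in> polys_below (n + 1)" if "f \<in> polys_below n" for f
      unfolding m_def mult.assoc by (intro const_below X0_below that)
    have "gen_comb a b c p' (D q) r' s' = D 0"
      unfolding p'_def r'_def s'_def D_def d_def gen_comb_derivation zero ..
    then have "gen_comb a b c p' (D q) r' s' = 0"
      by (simp add: D_def)
    then have zero': "gen_comb a b c (p' - m * p) (D q - m * q) (r' - m * r) (s' - m * s) = 0"
      by (simp only: gen_comb_diff_mult zero) simp
    have "poly.coeff (m * r) (Suc k) = \<beta> * poly.coeff r k" for k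
      by (simp add: m_def)
    from this[of "n - 1"] have "poly.coeff (r' - m * r) n = 0"
      using False \<open>n \<ge> 1\<close> by (simp add: \<beta>_def)
    moreover have "poly.coeff (r' - m * r) 0 = 0"
      by (simp add: r'_def m_def D_def coeff_mult_0)
    ultimately have *: "p' - m * p = 0 \<and> D q - m * q = 0 \<and> r' - m * r = 0 \<and> s' - m * s = 0"
      by (intro uniq[OF _ _ _ _ zero'] polys_below_diff below' m_below \<sigma>)
    have X1_eq: "(X1 :: 'a poly) = 1 + X0"
      by (simp add: one_pCons)
    have "X0 * X1 * pderiv p + of_nat d * p + X0 * (of_nat d - [:\<beta>:]) * p = p' - m * p"
      by (simp only: p'_def m_def D_def X1_eq algebra_simps mult_1_left mult_1_right)
    also have "\<dots> = 0"
      using * by blast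
    finally have "p = 0"
      by (rule ode_no_solution[rotated]) (use n in \<open>simp add: d_def\<close>)
    have "X0 * X1 * pderiv s + of_nat a * s + X0 * (of_nat a + of_nat c - [:\<beta>:]) * s = s' - m * s"
      by (simp only: s'_def m_def D_def X1_eq algebra_simps mult_1_left mult_1_right)
    also have "\<dots> = 0"
      using * by blast
    finally have "s = 0"
      by (rule ode_no_solution[rotated]) (use assms in simp)
    have "q + r * X1 ^ d = 0"
      using zero unfolding gen_comb_def \<open>p = 0\<close> \<open>s = 0\<close> d_def by (simp only: mult_zero_left add_0_left add_0_right)
    then have q: "q = - r * X1 ^ d"
      by (simp add: eq_neg_iff_add_eq_0)
    have "r \<noteq> 0"
      using False by auto
    then have "Polynomial.degree q = Polynomial.degree r + d" "q \<noteq> 0"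
      unfolding q by (auto simp: degree_mult_eq degree_power_eq)
    with \<sigma>(2) n(2) show ?thesis
      by (simp add: polys_below_iff_degree d_def)
  qed
  then show "q = 0 \<and> r = 0 \<and> X0 ^ (b + c) dvd s"
    by simp
qed

text \<open>The inequality \<open>E' \<le> E + 1\<close> leaves no degree between injectivity and
  surjectivity. For \<open>2 * (b + c) <= a\<close> one takes \<open>h = b + c\<close>, and the
  count of rows becomes \<open>2 * E = a\<close> up to parity instead of
  \<open>3 * E = d\<close>.\<close>

lemma gens_independent_and_spanning:
  fixes a b c :: nat
  assumes ord: "b \<le> a" "c \<le> b"
    and cond: "c = 0 \<or> \<not> (\<exists>k. a + b + c = 6 * k + 3 \<and> a < 4 * k + 2)"
  obtains E E' where "gens_independent TYPE('a::field_char_0) a b c E"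
    "gens_spanning TYPE('a) a b c E'" "E' \<le> E + 1"
proof -
  define n where "n = (a + b + c) div 3"
  consider (big_even) E where "2 * (b + c) \<le> a" "a = 2 * E"
    | (big_odd) E where "2 * (b + c) \<le> a" "a = 2 * E + 1"
    | (0) "a < 2 * (b + c)" "a + b + c = 3 * n"
    | (1) "a < 2 * (b + c)" "a + b + c = 3 * n + 1"
    | (2) "a < 2 * (b + c)" "a + b + c = 3 * n + 2"
  proof -
    have "a + b + c = 3 * n \<or> a + b + c = 3 * n + 1 \<or> a + b + c = 3 * n + 2"
      unfolding n_def by presburger
    moreover have "(\<exists>E. a = 2 * E) \<or> (\<exists>E. a = 2 * E + 1)"
      by presburger
    ultimately show ?thesis
      using that by (cases "2 * (b + c) \<le> a") auto
  qed
  then show thesis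
  proof cases
    case big_even
    show ?thesis
    proof (rule that)
      show "gens_independent TYPE('a) a b c E"
        by (rule gens_independentI[of E a E "b + c"]) (use big_even in auto)
      show "gens_spanning TYPE('a) a b c E"
        by (rule gens_spanningI[of 0 E a E "b + c"]) (use big_even in auto)
    qed simp
  next
    case big_odd
    show ?thesis
    proof (rule that)
      show "gens_independent TYPE('a) a b c E"
        by (rule gens_independentI[of "E + 1" a E "b + c"]) (use big_odd in auto)
      show "gens_spanning TYPE('a) a b c (E + 1)"
        by (rule gens_spanningI[of 0 "E + 1" a E "b + c"]) (use big_odd in auto)
    qed simp
  next
    case 0
    \<comment> \<open>Here \<open>a < 2 * (b + c)\<close> amounts to \<open>a < 2 * n\<close>, so an
      odd \<open>n = 2 * k + 1\<close> is the excluded case unless \<open>c = 0\<close>.\<close>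
    have par: "even n \<or> n = b + c \<or> c = 0"
    proof (cases "even n")
      case False
      then obtain k where "n = 2 * k + 1"
        by (auto elim: oddE)
      then have "a + b + c = 6 * k + 3" "a < 4 * k + 2"
        using 0 by auto
      with cond show ?thesis by blast
    qed simp
    show ?thesis
    proof (rule that)
      show "gens_independent TYPE('a) a b c n"
        by (rule gens_independentI[of n a n n]) (use 0 par ord in auto)
      show "gens_spanning TYPE('a) a b c n"
        by (rule gens_spanningI[of 0 n a n n]) (use 0 par ord in auto)
    qed simp
  next
    case 1
    show ?thesis
    proof (cases "even n")
      case True
      show ?thesis
      proof (rule that)
        show "gens_independent TYPE('a) a b c n"
          by (rule gens_independentI[of "n + 1" a n n]) (use 1 True ord in auto)
        show "gens_spanning TYPE('a) a b c (n + 1)"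
          by (rule gens_spanningI[of 0 "n + 1" a n n]) (use 1 True ord in auto)
      qed simp
    next
      case False
      then have "n \<ge> 1"
        by (cases n) auto
      show ?thesis
      proof (rule that)
        show "gens_independent TYPE('a) a b c n"
          by (rule gens_independent_3n1_odd) (use 1 False ord in auto)
        \<comment> \<open>The even choice is \<open>h = n + 1\<close>. The offset 1 secures the
          bound \<open>lo + h <= o' + a + b\<close>, which reads
          \<open>2 * n + 2 <= 1 + a + b\<close>.\<close>
        show "gens_spanning TYPE('a) a b c (n + 1)"
          by (rule gens_spanningI[of 1 "n + 1" a "n - 1" "n + 1"]) (use 1 False ord \<open>n \<ge> 1\<close> in auto)
      qed simp
    qed
  next
    \<comment> \<open>Of the numbers \<open>n\<close> and \<open>n + 1\<close>, the even one is
      taken as \<open>h\<close> and the other one as \<open>g\<close>.\<close>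
    case 2
    show ?thesis
    proof (cases "even n")
      case True
      show ?thesis
      proof (rule that)
        show "gens_independent TYPE('a) a b c n"
          by (rule gens_independentI[of "n + 1" a "n + 1" n]) (use 2 True ord in auto)
        show "gens_spanning TYPE('a) a b c (n + 1)"
          by (rule gens_spanningI[of 0 "n + 1" a "n + 1" n]) (use 2 True ord in auto)
      qed simp
    next
      case False
      show ?thesis
      proof (rule that)
        show "gens_independent TYPE('a) a b c n"
          by (rule gens_independentI[of "n + 1" a n "n + 1"]) (use 2 False ord in auto)
        show "gens_spanning TYPE('a) a b c (n + 1)"
          by (rule gens_spanningI[of 0 "n + 1" a n "n + 1"]) (use 2 False ord in auto)
      qed simp
    qed
  qed
qed

section \<open>Ternary forms modulo a linear form\<close>

lemma UNIV_var: "UNIV = {VX, VY, VZ}"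
  using var.exhaust by auto

text \<open>The order on the variables only serves to make the polynomial ring an instance of class \<open>idom\<close>.\<close>

instantiation var :: linorder
begin

definition less_eq_var :: "var \<Rightarrow> var \<Rightarrow> bool" where
  "v \<le> w \<longleftrightarrow> v = VX \<or> w = VZ \<or> v = w"

definition less_var :: "var \<Rightarrow> var \<Rightarrow> bool" where
  "v < w \<longleftrightarrow> v \<le> w \<and> v \<noteq> (w :: var)"

instance
  by standard (auto simp: less_eq_var_def less_var_def, (metis var.exhaust)+)

end

lemma distinct_vars:
  assumes "distinct [v1, v2, v3 :: var]"
  shows "UNIV = {v1, v2, v3}"
  using assms by (cases v1; cases v2; cases v3) (auto simp: UNIV_var)

lemma monomial_degree_eq: "monomial_degree m = (\<Sum>v\<in>UNIV. Poly_Mapping.lookup m v)"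
  by (simp add: monomial_degree_def UNIV_var)

lemma monomial_degree_add [simp]: "monomial_degree (m + m') = monomial_degree m + monomial_degree m'"
  by (simp add: monomial_degree_def lookup_add)

lemma monomial_degree_single [simp]: "monomial_degree (Poly_Mapping.single v k) = k"
  by (cases v) (simp_all add: monomial_degree_def lookup_single)

lemma monomial_degree_distinct:
  "distinct [v1, v2, v3] \<Longrightarrow> monomial_degree m =
    Poly_Mapping.lookup m v1 + Poly_Mapping.lookup m v2 + Poly_Mapping.lookup m v3"
  by (subst monomial_degree_eq, subst distinct_vars) auto

definition const_poly :: "'k::comm_ring_1 \<Rightarrow> 'k poly3" where
  "const_poly c = Poly_Mapping.single 0 c"

lemma const_poly_simps [simp]:
  "const_poly 0 = 0" "const_poly 1 = 1" "const_poly (c + c') = const_poly c + const_poly c'"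
  "const_poly (c * c') = const_poly c * const_poly c'" "const_poly (- c) = - const_poly c"
  by (simp_all add: const_poly_def single_add mult_single single_uminus)

lemma const_poly_power: "const_poly (c ^ k) = const_poly c ^ k"
  by (induction k) simp_all

lemma const_poly_mult_single: "const_poly c * Poly_Mapping.single m c' = Poly_Mapping.single m (c * c')"
  by (simp add: const_poly_def mult_single)

lemma var_poly_power: "var_poly v ^ k = Poly_Mapping.single (Poly_Mapping.single v k) 1"
  unfolding var_poly_def by (induction k) (simp_all add: mult_single flip: single_add)

text \<open>Forms \<open>P\<close> with \<open>deg P + k = i\<close>; only \<open>0\<close> remains when \<open>i < k\<close>.\<close>

definition coforms :: "nat \<Rightarrow> nat \<Rightarrow> 'k::comm_ring_1 poly3 set" where
  "coforms k i = {f. \<forall>m\<in>Poly_Mapping.keys f. monomial_degree m + k = i}"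

lemma forms_eq_coforms: "forms i = coforms 0 i"
  by (simp add: forms_def coforms_def)

lemma coforms_eq_forms: "coforms k (i + k) = forms i"
  by (simp add: forms_def coforms_def)

lemma coforms_eq_0: "i < k \<Longrightarrow> coforms k i = {0}"
  unfolding coforms_def by (auto simp: poly_mapping_eq_iff fun_eq_iff in_keys_iff)

lemma coforms_0 [simp]: "0 \<in> coforms k i"
  by (simp add: coforms_def)

lemma coforms_add: "f \<in> coforms k i \<Longrightarrow> g \<in> coforms k i \<Longrightarrow> f + g \<in> coforms k i"
  using keys_add[of f g] by (auto simp: coforms_def)

lemma coforms_uminus: "f \<in> coforms k i \<Longrightarrow> - f \<in> coforms k i"
  by (simp add: coforms_def in_keys_iff)

lemma coforms_diff: "f \<in> coforms k i \<Longrightarrow> g \<in> coforms k i \<Longrightarrow> f - g \<in> coforms k i"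
  using coforms_add[of f k i "- g"] coforms_uminus[of g] by simp

lemma coforms_sum: "(\<And>x. x \<in> A \<Longrightarrow> f x \<in> coforms k i) \<Longrightarrow> sum f A \<in> coforms k i"
  by (induction A rule: infinite_finite_induct) (auto intro: coforms_add)

lemma coforms_mult:
  assumes "f \<in> coforms k i" "g \<in> coforms k' i'"
  shows "f * g \<in> coforms (k + k') (i + i')"
  using assms keys_mult[of f g] unfolding coforms_def by fastforce

lemma coforms_single: "monomial_degree m + k = i \<Longrightarrow> Poly_Mapping.single m c \<in> coforms k i"
  by (simp add: coforms_def)

lemma const_poly_coforms: "const_poly c \<in> coforms 0 0"
  by (simp add: const_poly_def coforms_def monomial_degree_def)

lemma var_poly_power_coforms: "var_poly v ^ k \<in> coforms 0 k"
  by (simp add: var_poly_power coforms_def)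

lemma const_mult_coforms: "f \<in> coforms k i \<Longrightarrow> const_poly c * f \<in> coforms k i"
  using coforms_mult[OF const_poly_coforms] by fastforce

lemma form_mult_coforms: "f \<in> forms j \<Longrightarrow> g \<in> coforms j i \<Longrightarrow> f * g \<in> forms i"
  using keys_mult[of f g] unfolding coforms_def forms_def by fastforce

lemma sum_single_keys: "(\<Sum>m\<in>Poly_Mapping.keys f. Poly_Mapping.single m (Poly_Mapping.lookup f m)) = f"
  for f :: "'a \<Rightarrow>\<^sub>0 'b::comm_monoid_add"
  by (rule poly_mapping_eqI) (simp add: lookup_sum lookup_single when_def in_keys_iff)

lemma keys_induct [consumes 1, case_names zero add single]:
  fixes f :: "'a \<Rightarrow>\<^sub>0 'b::comm_monoid_add"
  assumes "Poly_Mapping.keys f \<subseteq> A" and zero: "P 0" and add: "\<And>f g. P f \<Longrightarrow> P g \<Longrightarrow> P (f + g)"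
    and single: "\<And>m c. m \<in> A \<Longrightarrow> P (Poly_Mapping.single m c)"
  shows "P f"
proof -
  have "P (\<Sum>m\<in>B. Poly_Mapping.single m (Poly_Mapping.lookup f m))" if "B \<subseteq> A" for B
    using that by (induction B rule: infinite_finite_induct) (auto intro: assms)
  from this[OF assms(1)] show ?thesis
    by (simp only: sum_single_keys)
qed

lemmas poly_mapping_induct = keys_induct[OF subset_UNIV, consumes 0, case_names zero add single]

lemma monomial_split:
  assumes "\<And>v. Poly_Mapping.lookup m v \<le> Poly_Mapping.lookup n v"
  shows "m + (n - m) = (n :: monomial)"
  using assms by (intro poly_mapping_eqI) (simp add: lookup_add lookup_minus)

section \<open>Substitution of polynomials in \<open>t\<close> for the variables\<close>

definition mono_eval :: "(var \<Rightarrow> 'k::comm_ring_1 poly) \<Rightarrow> monomial \<Rightarrow> 'k poly" where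
  "mono_eval \<theta> m = (\<Prod>v\<in>UNIV. \<theta> v ^ Poly_Mapping.lookup m v)"

definition eval3 :: "(var \<Rightarrow> 'k::comm_ring_1 poly) \<Rightarrow> 'k poly3 \<Rightarrow> 'k poly" where
  "eval3 \<theta> f = (\<Sum>m\<in>Poly_Mapping.keys f. [:Poly_Mapping.lookup f m:] * mono_eval \<theta> m)"

lemma eval3_0 [simp]: "eval3 \<theta> 0 = 0"
  by (simp add: eval3_def)

lemma eval3_add [simp]: "eval3 \<theta> (f + g) = eval3 \<theta> f + eval3 \<theta> g"
  unfolding eval3_def
  by (rule setsum_keys_plus_distrib) (simp_all only: pCons_0_0 mult_zero_left add_pCons[symmetric] distrib_right[symmetric] add_0_left add_pCons)

lemma eval3_single: "eval3 \<theta> (Poly_Mapping.single m c) = [:c:] * mono_eval \<theta> m"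
  by (simp add: eval3_def)

lemma mono_eval_add: "mono_eval \<theta> (m + m') = mono_eval \<theta> m * mono_eval \<theta> m'"
  by (simp add: mono_eval_def lookup_add power_add prod.distrib)

lemma mono_eval_single: "mono_eval \<theta> (Poly_Mapping.single v k) = \<theta> v ^ k"
  by (cases v) (simp_all add: mono_eval_def UNIV_var lookup_single)

lemma eval3_mult [simp]: "eval3 \<theta> (f * g) = eval3 \<theta> f * eval3 \<theta> g"
proof (induction f rule: poly_mapping_induct)
  case (single m c)
  show ?case
  proof (induction g rule: poly_mapping_induct)
    case (single m' c')
    have "[:c * c':] = [:c:] * [:c':]"
      by simp
    then show ?case
      by (simp only: mult_single eval3_single mono_eval_add ac_simps)
  qed (simp_all add: distrib_left)
qed (simp_all add: distrib_right)

lemma eval3_uminus [simp]: "eval3 \<theta> (- f) = - eval3 \<theta> f"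
  using eval3_add[of \<theta> f "- f"] by (simp add: eq_neg_iff_add_eq_0 add.commute)

lemma eval3_diff [simp]: "eval3 \<theta> (f - g) = eval3 \<theta> f - eval3 \<theta> g"
  using eval3_add[of \<theta> f "- g"] by simp

lemma eval3_sum: "eval3 \<theta> (sum f A) = (\<Sum>x\<in>A. eval3 \<theta> (f x))"
  by (induction A rule: infinite_finite_induct) simp_all

lemma eval3_const [simp]: "eval3 \<theta> (const_poly c) = [:c:]"
  by (simp add: const_poly_def eval3_single mono_eval_def)

lemma eval3_var [simp]: "eval3 \<theta> (var_poly v) = \<theta> v"
  by (simp add: var_poly_def eval3_single mono_eval_single)

lemma eval3_1 [simp]: "eval3 \<theta> 1 = 1"
  using eval3_const[of \<theta> 1] by (simp add: one_pCons)

lemma eval3_power [simp]: "eval3 \<theta> (f ^ k) = eval3 \<theta> f ^ k"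
  by (induction k) simp_all

section \<open>Linear forms and division by them\<close>

definition lin_form :: "(var \<Rightarrow> 'k::comm_ring_1) \<Rightarrow> 'k poly3" where
  "lin_form \<alpha> = (\<Sum>v\<in>UNIV. const_poly (\<alpha> v) * var_poly v)"

lemma lin_form_distinct:
  assumes "distinct [v1, v2, v3]"
  shows "lin_form \<alpha> = const_poly (\<alpha> v1) * var_poly v1 + const_poly (\<alpha> v2) * var_poly v2 + const_poly (\<alpha> v3) * var_poly v3"
  unfolding lin_form_def distinct_vars[OF assms] using assms by (simp add: add.assoc)

lemma lin_form_forms: "lin_form \<alpha> \<in> forms 1"
  unfolding lin_form_def forms_eq_coforms
  by (intro coforms_sum const_mult_coforms) (metis power_one_right var_poly_power_coforms)

lemma form_1_eq_lin_form:
  assumes "f \<in> forms 1"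
  shows "\<exists>\<alpha>. f = lin_form \<alpha>"
proof -
  have "Poly_Mapping.keys f \<subseteq> {m. monomial_degree m = 1}"
    using assms by (auto simp: forms_def)
  then show ?thesis
  proof (induction f rule: keys_induct)
    case zero
    show ?case
      by (intro exI[of _ "\<lambda>_. 0"]) (simp add: lin_form_def)
  next
    case (add f g)
    then obtain \<alpha> \<beta> where "f = lin_form \<alpha>" "g = lin_form \<beta>" by auto
    then show ?case
      by (intro exI[of _ "\<lambda>v. \<alpha> v + \<beta> v"]) (simp add: lin_form_def sum.distrib distrib_right)
  next
    case (single m c)
    then have deg: "Poly_Mapping.lookup m VX + Poly_Mapping.lookup m VY + Poly_Mapping.lookup m VZ = 1"
      by (simp add: monomial_degree_def)
    then obtain v where v: "m = Poly_Mapping.single v 1"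
    proof -
      have "m = Poly_Mapping.single (if Poly_Mapping.lookup m VX = 1 then VX else if Poly_Mapping.lookup m VY = 1 then VY else VZ) 1"
      proof (rule poly_mapping_eqI)
        fix w
        show "Poly_Mapping.lookup m w = Poly_Mapping.lookup (Poly_Mapping.single (if Poly_Mapping.lookup m VX = 1 then VX else if Poly_Mapping.lookup m VY = 1 then VY else VZ) 1) w"
          using deg by (cases w) (auto simp: lookup_single when_def)
      qed
      then show thesis by (rule that)
    qed
    have "(\<Sum>w\<in>UNIV. const_poly (c when w = v) * var_poly w) = const_poly c * var_poly v"
      by (cases v) (simp_all add: UNIV_var)
    then show ?case
      by (intro exI[of _ "\<lambda>w. c when w = v"]) (simp add: lin_form_def v var_poly_def const_poly_mult_single)
  qed
qed

definition binary_form :: "var \<Rightarrow> var \<Rightarrow> nat \<Rightarrow> (nat \<Rightarrow> 'k::comm_ring_1) \<Rightarrow> 'k poly3" where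
  "binary_form v1 v2 i c = (\<Sum>u\<le>i. const_poly (c u) * (var_poly v1 ^ u * var_poly v2 ^ (i - u)))"

lemma binary_form_forms: "binary_form v1 v2 i c \<in> forms i"
  unfolding binary_form_def forms_eq_coforms
proof (intro coforms_sum const_mult_coforms)
  fix u assume "u \<in> {..i}"
  then show "var_poly v1 ^ u * var_poly v2 ^ (i - u) \<in> coforms 0 i"
    using coforms_mult[OF var_poly_power_coforms[of v1 u] var_poly_power_coforms[of v2 "i - u"]] by simp
qed

lemma binary_form_add: "binary_form v1 v2 i c + binary_form v1 v2 i c' = binary_form v1 v2 i (\<lambda>u. c u + c' u)"
  by (simp add: binary_form_def distrib_right sum.distrib)

lemma binary_form_const: "const_poly k * binary_form v1 v2 i c = binary_form v1 v2 i (\<lambda>u. k * c u)"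
  by (simp add: binary_form_def sum_distrib_left mult.assoc)

lemma binary_form_monom:
  "var_poly v1 ^ u * var_poly v2 ^ w = binary_form v1 v2 (u + w) (\<lambda>k. 1 when k = u)"
proof -
  have "binary_form v1 v2 (u + w) (\<lambda>k. 1 when k = u) =
      (\<Sum>k\<le>u + w. if k = u then var_poly v1 ^ u * var_poly v2 ^ w else 0)"
    unfolding binary_form_def by (intro sum.cong) (auto simp: when_def)
  also have "\<dots> = var_poly v1 ^ u * var_poly v2 ^ w"
    by simp
  finally show ?thesis ..
qed

lemma single_eq_prod_var:
  assumes "distinct [v1, v2, v3]"
  shows "Poly_Mapping.single m c = const_poly c * (var_poly v1 ^ Poly_Mapping.lookup m v1 *
    var_poly v2 ^ Poly_Mapping.lookup m v2 * var_poly v3 ^ Poly_Mapping.lookup m v3)"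
proof -
  have "m = Poly_Mapping.single v1 (Poly_Mapping.lookup m v1) + Poly_Mapping.single v2 (Poly_Mapping.lookup m v2)
      + Poly_Mapping.single v3 (Poly_Mapping.lookup m v3)"
  proof (rule poly_mapping_eqI)
    fix v
    have "v \<in> {v1, v2, v3}"
      using distinct_vars[OF assms] by blast
    then show "Poly_Mapping.lookup m v = Poly_Mapping.lookup (Poly_Mapping.single v1 (Poly_Mapping.lookup m v1) +
        Poly_Mapping.single v2 (Poly_Mapping.lookup m v2) + Poly_Mapping.single v3 (Poly_Mapping.lookup m v3)) v"
      using assms by (auto simp: lookup_add lookup_single)
  qed
  then show ?thesis
    by (simp add: var_poly_power mult_single const_poly_mult_single)
qed

text \<open>As \<open>\<alpha> v3\<close> is invertible, factors \<open>v3\<close> can be eliminated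
  one at a time. Taking the quotient in \<open>coforms 1 i\<close> makes it zero for
  \<open>i = 0\<close>.\<close>

lemma reduce_mod_lin_form:
  fixes \<alpha> :: "var \<Rightarrow> 'k::field"
  assumes dist: "distinct [v1, v2, v3]" and nz: "\<alpha> v3 \<noteq> 0" and "f \<in> forms i"
  shows "\<exists>h\<in>coforms 1 i. \<exists>c. f = lin_form \<alpha> * h + binary_form v1 v2 i c"
proof -
  define R where "R i f \<longleftrightarrow> (\<exists>h\<in>coforms 1 i. \<exists>c. f = lin_form \<alpha> * h + binary_form v1 v2 i c)" for i and f :: "'k poly3"
  have R_add: "R i (f + g)" if Rf: "R i f" and Rg: "R i g" for f g i
  proof -
    obtain h c where hc: "h \<in> coforms 1 i" "f = lin_form \<alpha> * h + binary_form v1 v2 i c"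
      using Rf by (auto simp: R_def)
    obtain h' c' where hc': "h' \<in> coforms 1 i" "g = lin_form \<alpha> * h' + binary_form v1 v2 i c'"
      using Rg by (auto simp: R_def)
    have "f + g = lin_form \<alpha> * (h + h') + (binary_form v1 v2 i c + binary_form v1 v2 i c')"
      by (simp add: hc hc' algebra_simps)
    then show ?thesis
      unfolding R_def binary_form_add using coforms_add[OF hc(1) hc'(1)] by blast
  qed
  have R_const: "R i (const_poly k * f)" if Rf: "R i f" for f k i
  proof -
    obtain h c where hc: "h \<in> coforms 1 i" "f = lin_form \<alpha> * h + binary_form v1 v2 i c"
      using Rf by (auto simp: R_def)
    have "const_poly k * f = lin_form \<alpha> * (const_poly k * h) + const_poly k * binary_form v1 v2 i c"
      by (simp add: hc algebra_simps)
    then show ?thesis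
      unfolding R_def binary_form_const using const_mult_coforms[OF hc(1)] by blast
  qed
  have R_mono: "R (u + v + w) (var_poly v1 ^ u * var_poly v2 ^ v * var_poly v3 ^ w)" for u v w
  proof (induction w arbitrary: u v)
    case 0
    show ?case
      unfolding R_def by (intro bexI[of _ 0] exI) (simp_all add: binary_form_monom)
  next
    case (Suc w)
    let ?M = "var_poly v1 ^ u * var_poly v2 ^ v * var_poly v3 ^ w :: 'k poly3"
    define k where "k = inverse (\<alpha> v3)"
    have "k * \<alpha> v3 = 1"
      using nz by (simp add: k_def)
    then have "const_poly k * const_poly (\<alpha> v3) = 1"
      by (simp flip: const_poly_simps(4))
    then have "var_poly v3 = const_poly k * (const_poly (\<alpha> v3) * var_poly v3)"
      by (simp flip: mult.assoc)
    also have "const_poly (\<alpha> v3) * var_poly v3 =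
        lin_form \<alpha> - const_poly (\<alpha> v1) * var_poly v1 - const_poly (\<alpha> v2) * var_poly v2"
      by (simp add: lin_form_distinct[OF dist])
    finally have v3: "var_poly v3 = const_poly k * (lin_form \<alpha> - const_poly (\<alpha> v1) * var_poly v1 - const_poly (\<alpha> v2) * var_poly v2)" .
    have "var_poly v1 ^ u * var_poly v2 ^ v * var_poly v3 ^ Suc w = ?M * var_poly v3"
      by (simp add: ac_simps)
    also have "\<dots> = lin_form \<alpha> * (const_poly k * ?M) +
        (const_poly (- (k * \<alpha> v1)) * (var_poly v1 ^ Suc u * var_poly v2 ^ v * var_poly v3 ^ w) +
         const_poly (- (k * \<alpha> v2)) * (var_poly v1 ^ u * var_poly v2 ^ Suc v * var_poly v3 ^ w))"
      by (subst v3) (simp add: algebra_simps)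
    finally have eq: "var_poly v1 ^ u * var_poly v2 ^ v * var_poly v3 ^ Suc w = \<dots>" .
    have "?M \<in> coforms 0 (u + v + w)"
      using coforms_mult[OF coforms_mult[OF var_poly_power_coforms[of v1 u] var_poly_power_coforms[of v2 v]]
        var_poly_power_coforms[of v3 w]] by simp
    then have "const_poly k * ?M \<in> coforms 1 (u + v + Suc w)"
      using const_mult_coforms[of ?M 0 "u + v + w" k] by (simp add: coforms_def)
    moreover have "binary_form v1 v2 (u + v + Suc w) (\<lambda>_. 0) = (0 :: 'k poly3)"
      by (simp add: binary_form_def)
    ultimately have "R (u + v + Suc w) (lin_form \<alpha> * (const_poly k * ?M))"
      unfolding R_def by (intro bexI[of _ "const_poly k * ?M"] exI[of _ "\<lambda>_. 0"]) simp_all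
    moreover have "R (u + v + Suc w) (const_poly (- (k * \<alpha> v1)) * (var_poly v1 ^ Suc u * var_poly v2 ^ v * var_poly v3 ^ w))"
      using R_const[OF Suc.IH[of "Suc u" v]] by (simp only: add_Suc add_Suc_right)
    moreover have "R (u + v + Suc w) (const_poly (- (k * \<alpha> v2)) * (var_poly v1 ^ u * var_poly v2 ^ Suc v * var_poly v3 ^ w))"
      using R_const[OF Suc.IH[of u "Suc v"]] by (simp only: add_Suc add_Suc_right)
    ultimately show ?case
      unfolding eq by (intro R_add)
  qed
  have "Poly_Mapping.keys f \<subseteq> {m. monomial_degree m = i}"
    using \<open>f \<in> forms i\<close> by (auto simp: forms_def)
  then have "R i f"
  proof (induction f rule: keys_induct)
    case zero
    show ?case
      unfolding R_def by (intro bexI[of _ 0] exI[of _ "\<lambda>_. 0"]) (simp_all add: binary_form_def)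
  next
    case (single m c)
    then have "i = Poly_Mapping.lookup m v1 + Poly_Mapping.lookup m v2 + Poly_Mapping.lookup m v3"
      using monomial_degree_distinct[OF dist] by simp
    then show ?case
      unfolding single_eq_prod_var[OF dist, of m c] by (auto intro: R_const R_mono)
  qed (rule R_add)
  then show ?thesis
    by (simp add: R_def)
qed

text \<open>A parametrisation of the line on which \<open>lin_form \<alpha>\<close> vanishes: its
  three terms become \<open>t\<close>, \<open>1\<close> and \<open>-(1 + t)\<close>. The scaling
  yields the same four generators for every \<open>\<alpha>\<close> with nonzero values, up to
  nonzero constants.\<close>

definition line_param :: "var \<Rightarrow> var \<Rightarrow> (var \<Rightarrow> 'k::field) \<Rightarrow> var \<Rightarrow> 'k poly" where
  "line_param v1 v2 \<alpha> v =
    (if v = v1 then [:0, inverse (\<alpha> v):] else if v = v2 then [:inverse (\<alpha> v):]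
     else [:- inverse (\<alpha> v), - inverse (\<alpha> v):])"

lemma eval3_line_lin_form:
  assumes "distinct [v1, v2, v3]" "\<And>v. \<alpha> v \<noteq> 0"
  shows "eval3 (line_param v1 v2 \<alpha>) (lin_form \<alpha>) = 0"
  using assms by (auto simp: lin_form_distinct[OF assms(1)] line_param_def)

lemma eval3_line_binary_form:
  assumes "v1 \<noteq> v2"
  shows "eval3 (line_param v1 v2 \<alpha>) (binary_form v1 v2 i c) =
    (\<Sum>u\<le>i. monom (c u * inverse (\<alpha> v1) ^ u * inverse (\<alpha> v2) ^ (i - u)) u)"
proof -
  have "eval3 (line_param v1 v2 \<alpha>) (const_poly (c u) * (var_poly v1 ^ u * var_poly v2 ^ (i - u))) =
      monom (c u * inverse (\<alpha> v1) ^ u * inverse (\<alpha> v2) ^ (i - u)) u" for u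
  proof -
    have "([:0, x:] :: 'a poly) ^ u = monom (x ^ u) u" for x
    proof -
      have "[:0, x:] = monom x 1"
        by (simp add: monom_Suc monom_0)
      then show ?thesis
        by (simp only: monom_power mult_1)
    qed
    moreover have "([:x:] :: 'a poly) ^ k = [:x ^ k:]" for x k
      by (induction k) (simp_all add: one_pCons mult.commute)
    ultimately show ?thesis
      using assms by (simp add: line_param_def smult_monom ac_simps)
  qed
  then show ?thesis
    by (simp only: binary_form_def eval3_sum)
qed

lemma eval3_line_polys_below:
  assumes "distinct [v1, v2, v3]" "\<And>v. \<alpha> v \<noteq> 0" "f \<in> forms i"
  shows "eval3 (line_param v1 v2 \<alpha>) f \<in> polys_below (i + 1)"
proof -
  obtain h c where "f = lin_form \<alpha> * h + binary_form v1 v2 i c"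
    using reduce_mod_lin_form[OF assms(1) _ assms(3), of \<alpha>] assms(2) by blast
  then show ?thesis
    using assms(1)
    by (auto simp: eval3_line_lin_form[OF assms(1,2)] eval3_line_binary_form polys_below_def coeff_sum)
qed

text \<open>On the remainder in \<open>v1\<close> and \<open>v2\<close> the substitution merely
  rescales coefficients, so a form that vanishes on the line has remainder zero.\<close>

lemma eval3_line_eq_0:
  fixes f :: "'k::field poly3"
  assumes "distinct [v1, v2, v3]" "\<And>v. \<alpha> v \<noteq> 0" "f \<in> forms i" "eval3 (line_param v1 v2 \<alpha>) f = 0"
  shows "\<exists>h\<in>coforms 1 i. f = lin_form \<alpha> * h"
proof -
  obtain h c where h: "h \<in> coforms 1 i" and f: "f = lin_form \<alpha> * h + binary_form v1 v2 i c"
    using reduce_mod_lin_form[OF assms(1) _ assms(3), of \<alpha>] assms(2) by blast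
  have zero: "(\<Sum>u\<le>i. monom (c u * inverse (\<alpha> v1) ^ u * inverse (\<alpha> v2) ^ (i - u)) u) = 0"
    using assms(1,4) by (simp add: f eval3_line_lin_form[OF assms(1,2)] eval3_line_binary_form)
  have "c u = 0" if "u \<le> i" for u
  proof -
    have "poly.coeff (\<Sum>u\<le>i. monom (c u * inverse (\<alpha> v1) ^ u * inverse (\<alpha> v2) ^ (i - u)) u) u =
        c u * inverse (\<alpha> v1) ^ u * inverse (\<alpha> v2) ^ (i - u)"
      using that by (simp add: coeff_sum)
    with zero assms(2) show ?thesis
      by simp
  qed
  then have "binary_form v1 v2 i c = 0"
    by (simp add: binary_form_def)
  with h f show ?thesis by auto
qed

lemma eval3_line_surj:
  fixes p :: "'k::field poly"
  assumes "distinct [v1, v2, v3]" "\<And>v. \<alpha> v \<noteq> 0" "p \<in> polys_below (i + 1)"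
  shows "\<exists>f\<in>forms i. eval3 (line_param v1 v2 \<alpha>) f = p"
proof
  define c where "c u = poly.coeff p u * \<alpha> v1 ^ u * \<alpha> v2 ^ (i - u)" for u
  have "c u * inverse (\<alpha> v1) ^ u * inverse (\<alpha> v2) ^ (i - u) = poly.coeff p u" for u
    using assms(2) by (simp add: c_def field_simps)
  then have "eval3 (line_param v1 v2 \<alpha>) (binary_form v1 v2 i c) = (\<Sum>u<Suc i. monom (poly.coeff p u) u)"
    using assms(1) by (simp add: eval3_line_binary_form lessThan_Suc_atMost)
  also have "\<dots> = p"
    using polys_below_sum_monom[of p "Suc i"] assms(3) by simp
  finally show "eval3 (line_param v1 v2 \<alpha>) (binary_form v1 v2 i c) = p" .
qed (rule binary_form_forms)

section \<open>The monomial ideal and the Lefschetz property\<close>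

definition total_exp :: "(var \<Rightarrow> nat) \<Rightarrow> nat" where
  "total_exp e = (\<Sum>v\<in>UNIV. e v)"

definition in_gens :: "(var \<Rightarrow> nat) \<Rightarrow> monomial \<Rightarrow> bool" where
  "in_gens e m \<longleftrightarrow> (\<exists>v. total_exp e \<le> Poly_Mapping.lookup m v) \<or> (\<forall>v. e v \<le> Poly_Mapping.lookup m v)"

text \<open>Membership is decided monomial by monomial, so a single monomial suffices to show that a
  form lies outside. Exponents are a function on the variables so that later arguments can order the
  variables freely.\<close>

definition monomial_ideal :: "(var \<Rightarrow> nat) \<Rightarrow> 'k::comm_ring_1 poly3 set" where
  "monomial_ideal e = {f. \<forall>m\<in>Poly_Mapping.keys f. in_gens e m}"

definition exp_monomial :: "(var \<Rightarrow> nat) \<Rightarrow> monomial" where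
  "exp_monomial e = (\<Sum>v\<in>UNIV. Poly_Mapping.single v (e v))"

definition mixed_gen :: "(var \<Rightarrow> nat) \<Rightarrow> 'k::comm_ring_1 poly3" where
  "mixed_gen e = Poly_Mapping.single (exp_monomial e) 1"

lemma lookup_exp_monomial [simp]: "Poly_Mapping.lookup (exp_monomial e) v = e v"
  by (cases v) (simp_all add: exp_monomial_def UNIV_var lookup_add lookup_single)

lemma monomial_degree_exp_monomial [simp]: "monomial_degree (exp_monomial e) = total_exp e"
  by (simp add: monomial_degree_eq total_exp_def)

lemma total_exp_distinct: "distinct [v1, v2, v3] \<Longrightarrow> total_exp e = e v1 + e v2 + e v3"
  unfolding total_exp_def by (subst distinct_vars) auto

lemma mixed_gen_forms: "mixed_gen e \<in> forms (total_exp e)"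
  by (simp add: mixed_gen_def forms_eq_coforms coforms_single)

lemma mixed_gen_eq_prod:
  "distinct [v1, v2, v3] \<Longrightarrow> mixed_gen e = var_poly v1 ^ e v1 * var_poly v2 ^ e v2 * var_poly v3 ^ e v3"
  by (simp add: mixed_gen_def single_eq_prod_var)

lemma in_gens_add: "in_gens e m \<Longrightarrow> in_gens e (m + m')"
  unfolding in_gens_def lookup_add by (meson trans_le_add1)

lemma monomial_ideal_0 [simp]: "0 \<in> monomial_ideal e"
  by (simp add: monomial_ideal_def)

lemma monomial_ideal_add: "f \<in> monomial_ideal e \<Longrightarrow> g \<in> monomial_ideal e \<Longrightarrow> f + g \<in> monomial_ideal e"
  using keys_add[of f g] by (auto simp: monomial_ideal_def)

lemma monomial_ideal_uminus: "f \<in> monomial_ideal e \<Longrightarrow> - f \<in> monomial_ideal e"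
  by (simp add: monomial_ideal_def in_keys_iff)

lemma monomial_ideal_mult: "f \<in> monomial_ideal e \<Longrightarrow> f * g \<in> monomial_ideal e"
  using keys_mult[of f g] in_gens_add unfolding monomial_ideal_def by blast

lemma monomial_ideal_sum: "(\<And>x. x \<in> A \<Longrightarrow> f x \<in> monomial_ideal e) \<Longrightarrow> sum f A \<in> monomial_ideal e"
  by (induction A rule: infinite_finite_induct) (auto intro: monomial_ideal_add)

lemma var_power_monomial_ideal: "var_poly v ^ total_exp e \<in> monomial_ideal e"
  by (auto simp: var_poly_power monomial_ideal_def in_gens_def lookup_single intro!: exI[of _ v])

lemma mixed_gen_monomial_ideal: "mixed_gen e \<in> monomial_ideal e"
  by (auto simp: mixed_gen_def monomial_ideal_def in_gens_def)

definition ideal_comb :: "(var \<Rightarrow> nat) \<Rightarrow> (var \<Rightarrow> 'k::comm_ring_1 poly3) \<Rightarrow> 'k poly3 \<Rightarrow> 'k poly3" where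
  "ideal_comb e P S = (\<Sum>v\<in>UNIV. var_poly v ^ total_exp e * P v) + mixed_gen e * S"

lemma ideal_comb_monomial_ideal: "ideal_comb e P S \<in> monomial_ideal e"
  unfolding ideal_comb_def
  by (intro monomial_ideal_add monomial_ideal_sum monomial_ideal_mult var_power_monomial_ideal mixed_gen_monomial_ideal)

lemma ideal_comb_forms:
  assumes "\<And>v. P v \<in> coforms (total_exp e) i" "S \<in> coforms (total_exp e) i"
  shows "ideal_comb e P S \<in> forms i"
proof -
  have "var_poly v ^ total_exp e * P v \<in> coforms 0 i" for v
    using form_mult_coforms[OF _ assms(1)[of v], of "var_poly v ^ total_exp e"]
    by (simp add: forms_eq_coforms var_poly_power_coforms)
  moreover have "mixed_gen e * S \<in> coforms 0 i"
    using form_mult_coforms[OF mixed_gen_forms assms(2)] by (simp add: forms_eq_coforms)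
  ultimately show ?thesis
    unfolding forms_eq_coforms ideal_comb_def by (intro coforms_add coforms_sum)
qed

text \<open>Splitting \<open>f\<close> into monomials and dividing each by one generator keeps the
  coefficients homogeneous of the complementary degree.\<close>

lemma monomial_ideal_decomp:
  assumes "f \<in> monomial_ideal e" "f \<in> forms i"
  obtains P S where "f = ideal_comb e P S" "\<And>v. P v \<in> coforms (total_exp e) i" "S \<in> coforms (total_exp e) i"
proof -
  have "Poly_Mapping.keys f \<subseteq> {m. in_gens e m \<and> monomial_degree m = i}"
    using assms by (auto simp: monomial_ideal_def forms_def)
  then have "\<exists>P S. f = ideal_comb e P S \<and> (\<forall>v. P v \<in> coforms (total_exp e) i) \<and> S \<in> coforms (total_exp e) i"
  proof (induction f rule: keys_induct)
    case zero
    show ?case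
      by (intro exI[of _ "\<lambda>_. 0"] exI[of _ 0]) (simp add: ideal_comb_def)
  next
    case (add f g)
    then obtain P S P' S' where *: "f = ideal_comb e P S" "\<And>v. P v \<in> coforms (total_exp e) i" "S \<in> coforms (total_exp e) i"
      "g = ideal_comb e P' S'" "\<And>v. P' v \<in> coforms (total_exp e) i" "S' \<in> coforms (total_exp e) i"
      by blast
    then have "f + g = ideal_comb e (\<lambda>v. P v + P' v) (S + S')"
      by (simp add: ideal_comb_def distrib_left sum.distrib)
    with * show ?case
      by (blast intro: coforms_add)
  next
    case (single m c)
    then have deg: "monomial_degree m = i" and "in_gens e m"
      by simp_all
    then consider (pow) v where "total_exp e \<le> Poly_Mapping.lookup m v" | (mix) "\<forall>v. e v \<le> Poly_Mapping.lookup m v"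
      by (auto simp: in_gens_def)
    then show ?case
    proof cases
      case pow
      define m' where "m' = m - Poly_Mapping.single v (total_exp e)"
      have m: "Poly_Mapping.single v (total_exp e) + m' = m"
        unfolding m'_def by (rule monomial_split) (use pow in \<open>auto simp: lookup_single when_def\<close>)
      have "(\<Sum>w\<in>UNIV. var_poly w ^ total_exp e * (Poly_Mapping.single m' c when w = v)) =
          var_poly v ^ total_exp e * Poly_Mapping.single m' c"
        by (cases v) (simp_all add: UNIV_var)
      then have "Poly_Mapping.single m c = ideal_comb e (\<lambda>w. Poly_Mapping.single m' c when w = v) 0"
        by (simp add: ideal_comb_def var_poly_power mult_single m)
      moreover have "Poly_Mapping.single m' c \<in> coforms (total_exp e) i"
        using deg by (intro coforms_single) (simp flip: m)
      then have "(Poly_Mapping.single m' c when w = v) \<in> coforms (total_exp e) i" for w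
        by (simp add: when_def)
      ultimately show ?thesis
        using coforms_0 by blast
    next
      case mix
      define m' where "m' = m - exp_monomial e"
      have m: "exp_monomial e + m' = m"
        unfolding m'_def by (rule monomial_split) (use mix in simp)
      have "Poly_Mapping.single m c = ideal_comb e (\<lambda>_. 0) (Poly_Mapping.single m' c)"
        by (simp add: ideal_comb_def mixed_gen_def mult_single m)
      moreover have "Poly_Mapping.single m' c \<in> coforms (total_exp e) i"
        using deg by (intro coforms_single) (simp flip: m)
      ultimately show ?thesis
        using coforms_0 by blast
    qed
  qed
  then show thesis
    using that by blast
qed

section \<open>The quotient ring in terms of forms\<close>

lemma type_algebra_simps [simp]:
  "carrier ring_of_type_algebra = UNIV"
  "x \<otimes>\<^bsub>ring_of_type_algebra\<^esub> y = x * y"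
  "x \<oplus>\<^bsub>ring_of_type_algebra\<^esub> y = x + y"
  "\<zero>\<^bsub>ring_of_type_algebra\<^esub> = 0"
  by (simp_all add: ring_of_type_algebra_def)

lemma type_algebra_minus [simp]:
  fixes x y :: "'a::comm_ring_1"
  shows "x \<ominus>\<^bsub>ring_of_type_algebra\<^esub> y = x - y"
proof -
  interpret ring "ring_of_type_algebra :: 'a ring"
    by (rule ring_from_type_algebra)
  have "y \<oplus>\<^bsub>ring_of_type_algebra\<^esub> (\<ominus>\<^bsub>ring_of_type_algebra\<^esub> y) = \<zero>\<^bsub>ring_of_type_algebra\<^esub>"
    by (rule r_neg) simp
  then have "\<ominus>\<^bsub>ring_of_type_algebra\<^esub> y = - y"
    by (simp add: add_eq_0_iff)
  then show ?thesis
    by (simp add: a_minus_def)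
qed

abbreviation exps :: "nat \<Rightarrow> nat \<Rightarrow> nat \<Rightarrow> var \<Rightarrow> nat" where
  "exps a b c \<equiv> case_var a b c"

lemma total_exp_exps [simp]: "total_exp (exps a b c) = a + b + c"
  by (simp add: total_exp_def UNIV_var)

lemma ideal_monomial_ideal: "ideal (monomial_ideal e :: 'k::comm_ring_1 poly3 set) ring_of_type_algebra"
proof (rule idealI[OF ring_from_type_algebra])
  interpret ring "ring_of_type_algebra :: 'k poly3 ring"
    by (rule ring_from_type_algebra)
  show "subgroup (monomial_ideal e) (add_monoid (ring_of_type_algebra :: 'k poly3 ring))"
  proof (rule add.subgroupI)
    show "(monomial_ideal e :: 'k poly3 set) \<noteq> {}"
      using monomial_ideal_0[of e] by blast
  next
    fix x :: "'k poly3" assume "x \<in> monomial_ideal e"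
    moreover have "\<ominus>\<^bsub>ring_of_type_algebra\<^esub> x = - x"
      using minus_equality[of "- x" x] by simp
    ultimately show "\<ominus>\<^bsub>ring_of_type_algebra\<^esub> x \<in> monomial_ideal e"
      by (simp add: monomial_ideal_uminus)
  qed (auto intro: monomial_ideal_add)
qed (auto intro: monomial_ideal_mult simp: mult.commute)

lemma R_ideal_eq: "R_ideal a b c = (monomial_ideal (exps a b c) :: 'k::comm_ring_1 poly3 set)"
proof
  let ?e = "exps a b c"
  let ?R = "ring_of_type_algebra :: 'k poly3 ring"
  interpret ring ?R
    by (rule ring_from_type_algebra)
  have mixed: "mixed_gen ?e = (var_poly VX ^ a * var_poly VY ^ b * var_poly VZ ^ c :: 'k poly3)"
    by (simp add: mixed_gen_eq_prod[of VX VY VZ])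
  have vars: "var_poly v ^ (a + b + c) \<in> (monomial_ideal ?e :: 'k poly3 set)" for v
    using var_power_monomial_ideal[of v ?e] by simp
  have gens: "{var_poly VX ^ (a + b + c), var_poly VY ^ (a + b + c), var_poly VZ ^ (a + b + c),
      var_poly VX ^ a * var_poly VY ^ b * var_poly VZ ^ c} \<subseteq> (monomial_ideal ?e :: 'k poly3 set)"
    using mixed_gen_monomial_ideal[where 'a = 'k, of ?e] vars unfolding mixed by blast
  show "R_ideal a b c \<subseteq> (monomial_ideal ?e :: 'k poly3 set)"
    unfolding R_ideal_def Let_def by (rule genideal_minimal[OF ideal_monomial_ideal gens])
  interpret I: ideal "R_ideal a b c :: 'k poly3 set" ?R
    by (rule ideal_R_ideal)
  have gens_in: "var_poly VX ^ (a + b + c) \<in> (R_ideal a b c :: 'k poly3 set)" "var_poly VY ^ (a + b + c) \<in> (R_ideal a b c :: 'k poly3 set)"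
    "var_poly VZ ^ (a + b + c) \<in> (R_ideal a b c :: 'k poly3 set)" "mixed_gen ?e \<in> (R_ideal a b c :: 'k poly3 set)"
    using genideal_self[of "{var_poly VX ^ (a + b + c), var_poly VY ^ (a + b + c), var_poly VZ ^ (a + b + c),
      var_poly VX ^ a * var_poly VY ^ b * var_poly VZ ^ c}"]
    by (auto simp: R_ideal_def Let_def mixed)
  have var_in: "var_poly v ^ (a + b + c) \<in> (R_ideal a b c :: 'k poly3 set)" for v
    using gens_in by (cases v) auto
  have add: "f + g \<in> R_ideal a b c" if "f \<in> R_ideal a b c" "g \<in> R_ideal a b c" for f g :: "'k poly3"
    using I.a_closed[OF that] by simp
  have mult: "f * g \<in> R_ideal a b c" if "f \<in> R_ideal a b c" for f g :: "'k poly3"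
    using I.I_r_closed[OF that, of g] by simp
  show "(monomial_ideal ?e :: 'k poly3 set) \<subseteq> R_ideal a b c"
  proof
    fix f :: "'k poly3" assume "f \<in> monomial_ideal ?e"
    then have "Poly_Mapping.keys f \<subseteq> {m. in_gens ?e m}"
      by (auto simp: monomial_ideal_def)
    then show "f \<in> R_ideal a b c"
    proof (induction f rule: keys_induct)
      case zero
      show ?case
        using mult[OF var_in[of VX], of 0] by simp
    next
      case (single m c')
      then have "Poly_Mapping.single m c' \<in> monomial_ideal ?e" "Poly_Mapping.single m c' \<in> forms (monomial_degree m)"
        by (simp_all add: monomial_ideal_def forms_def)
      then obtain P S where "Poly_Mapping.single m c' = ideal_comb ?e P S"
        by (rule monomial_ideal_decomp)
      then show ?case
        by (simp add: ideal_comb_def UNIV_var add mult var_in gens_in)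
    qed (rule add)
  qed
qed

text \<open>Maximal rank from degree \<open>i\<close> to \<open>i + 1\<close>, expressed by
  representatives; the quotient ring can be dispensed with from here on.\<close>

definition lefschetz :: "(var \<Rightarrow> nat) \<Rightarrow> (var \<Rightarrow> 'k::comm_ring_1) \<Rightarrow> nat \<Rightarrow> bool" where
  "lefschetz e \<alpha> i \<longleftrightarrow>
    (\<forall>f\<in>forms i. lin_form \<alpha> * f \<in> monomial_ideal e \<longrightarrow> f \<in> monomial_ideal e) \<or>
    (\<forall>f\<in>forms (i + 1). \<exists>g\<in>forms i. f - lin_form \<alpha> * g \<in> monomial_ideal e)"

lemma has_WLP_iff_lefschetz:
  fixes K :: "'k::comm_ring_1 itself"
  shows "has_WLP (R_algebra K a b c) (R_piece K a b c) \<longleftrightarrow>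
    (\<exists>\<alpha> :: var \<Rightarrow> 'k. \<forall>i. lefschetz (exps a b c) \<alpha> i)"
proof -
  let ?R = "ring_of_type_algebra :: 'k poly3 ring"
  define I where "I = (monomial_ideal (exps a b c) :: 'k poly3 set)"
  have I: "R_ideal a b c = I"
    by (simp add: I_def R_ideal_eq)
  interpret ideal I ?R
    unfolding I_def by (rule ideal_monomial_ideal)
  define cl where "cl f = I +>\<^bsub>?R\<^esub> f" for f
  have piece: "R_piece K a b c i = cl ` forms i" for i
    by (simp add: R_piece_def I cl_def)
  have cl_eq: "cl f = cl g \<longleftrightarrow> f - g \<in> I" for f g
    using quotient_eq_iff_same_a_r_cos[OF is_ideal, of f g] by (simp add: cl_def)
  have cl_mult: "cl f \<otimes>\<^bsub>R_algebra K a b c\<^esub> cl g = cl (f * g)" for f g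
    using rcoset_mult_add[of f g] by (simp add: R_algebra_def FactRing_def I cl_def)
  have inj: "inj_on (\<lambda>u. cl l \<otimes>\<^bsub>R_algebra K a b c\<^esub> u) (cl ` forms i) \<longleftrightarrow>
      (\<forall>f\<in>forms i. l * f \<in> I \<longrightarrow> f \<in> I)" for l i
  proof
    assume inj: "inj_on (\<lambda>u. cl l \<otimes>\<^bsub>R_algebra K a b c\<^esub> u) (cl ` forms i)"
    show "\<forall>f\<in>forms i. l * f \<in> I \<longrightarrow> f \<in> I"
    proof (intro ballI impI)
      fix f assume f: "f \<in> forms i" "l * f \<in> I"
      have "(0 :: 'k poly3) \<in> forms i"
        by (simp add: forms_def)
      moreover have "cl l \<otimes>\<^bsub>R_algebra K a b c\<^esub> cl f = cl l \<otimes>\<^bsub>R_algebra K a b c\<^esub> cl 0"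
        using f(2) by (simp only: cl_mult cl_eq mult_zero_right diff_zero)
      ultimately have "cl f = cl 0"
        using inj_onD[OF inj, of "cl f" "cl 0"] imageI[OF f(1), of cl] by (simp only: imageI)
      then show "f \<in> I"
        by (simp add: cl_eq)
    qed
  next
    assume *: "\<forall>f\<in>forms i. l * f \<in> I \<longrightarrow> f \<in> I"
    have "cl f = cl g" if "f \<in> forms i" "g \<in> forms i" "cl (l * f) = cl (l * g)" for f g
    proof -
      have "f - g \<in> forms i"
        using that(1,2) coforms_diff unfolding forms_eq_coforms by blast
      moreover have "l * (f - g) \<in> I"
        using that(3) unfolding cl_eq right_diff_distrib .
      ultimately show ?thesis
        using * unfolding cl_eq by blast
    qed
    note eq = this
    show "inj_on (\<lambda>u. cl l \<otimes>\<^bsub>R_algebra K a b c\<^esub> u) (cl ` forms i)"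
    proof (rule inj_onI)
      fix x y assume x: "x \<in> cl ` forms i" and y: "y \<in> cl ` forms i"
        and xy: "cl l \<otimes>\<^bsub>R_algebra K a b c\<^esub> x = cl l \<otimes>\<^bsub>R_algebra K a b c\<^esub> y"
      from x obtain f where f: "f \<in> forms i" "x = cl f" ..
      from y obtain g where g: "g \<in> forms i" "y = cl g" ..
      show "x = y"
        using eq[OF f(1) g(1)] xy unfolding f(2) g(2) cl_mult .
    qed
  qed
  have surj: "(\<lambda>u. cl l \<otimes>\<^bsub>R_algebra K a b c\<^esub> u) ` (cl ` forms i) = cl ` forms (i + 1) \<longleftrightarrow>
      (\<forall>f\<in>forms (i + 1). \<exists>g\<in>forms i. f - l * g \<in> I)" if "l \<in> forms 1" for l i
  proof -
    have "l * g \<in> forms (i + 1)" if "g \<in> forms i" for g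
      using coforms_mult[of l 0 1 g 0 i] that \<open>l \<in> forms 1\<close> by (simp add: forms_eq_coforms add.commute)
    then have "(\<lambda>u. cl l \<otimes>\<^bsub>R_algebra K a b c\<^esub> u) ` (cl ` forms i) = cl ` forms (i + 1) \<longleftrightarrow>
        cl ` forms (i + 1) \<subseteq> (\<lambda>g. cl (l * g)) ` forms i"
      by (auto simp: image_image cl_mult)
    also have "\<dots> \<longleftrightarrow> (\<forall>f\<in>forms (i + 1). \<exists>g\<in>forms i. f - l * g \<in> I)"
      by (simp only: image_subset_iff image_iff cl_eq)
    finally show ?thesis .
  qed
  have "has_WLP (R_algebra K a b c) (R_piece K a b c) \<longleftrightarrow> (\<exists>l\<in>forms 1. \<forall>i.
      inj_on (\<lambda>u. cl l \<otimes>\<^bsub>R_algebra K a b c\<^esub> u) (cl ` forms i) \<or>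
      (\<lambda>u. cl l \<otimes>\<^bsub>R_algebra K a b c\<^esub> u) ` (cl ` forms i) = cl ` forms (i + 1))"
    unfolding has_WLP_def piece by blast
  also have "\<dots> \<longleftrightarrow> (\<exists>l\<in>forms 1. \<forall>i.
      (\<forall>f\<in>forms i. l * f \<in> I \<longrightarrow> f \<in> I) \<or> (\<forall>f\<in>forms (i + 1). \<exists>g\<in>forms i. f - l * g \<in> I))"
    by (intro bex_cong refl) (simp only: inj surj)
  also have "\<dots> \<longleftrightarrow> (\<exists>\<alpha> :: var \<Rightarrow> 'k. \<forall>i. lefschetz (exps a b c) \<alpha> i)"
    unfolding lefschetz_def I_def[symmetric] using form_1_eq_lin_form lin_form_forms by blast
  finally show ?thesis .
qed

section \<open>Passing between forms and polynomials in \<open>t\<close>\<close>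

lemma finite_UNIV_var [simp]: "finite (UNIV :: var set)"
  by (simp add: UNIV_var)

lemma lin_form_nonzero:
  assumes "\<alpha> v \<noteq> 0"
  shows "lin_form \<alpha> \<noteq> 0"
proof -
  have "Poly_Mapping.lookup (lin_form \<alpha>) (Poly_Mapping.single v 1) = \<alpha> v"
  proof -
    have "Poly_Mapping.single w (Suc 0) = Poly_Mapping.single v (Suc 0) \<longleftrightarrow> w = v" for w :: var
      by (metis lookup_single_eq lookup_single_not_eq nat.distinct(1))
    then show ?thesis
      by (simp add: lin_form_def lookup_sum var_poly_def const_poly_mult_single lookup_single when_def)
  qed
  with assms show ?thesis by auto
qed

lemma eval3_ideal_comb:
  fixes \<alpha> :: "var \<Rightarrow> 'k::field"
  assumes dist: "distinct [v1, v2, v3]" and nz: "\<And>v. \<alpha> v \<noteq> 0"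
  obtains k1 k2 k3 k4 where "k1 \<noteq> 0" "k2 \<noteq> 0" "k3 \<noteq> 0" "k4 \<noteq> 0"
    "\<And>P S. eval3 (line_param v1 v2 \<alpha>) (ideal_comb e P S) = gen_comb (e v1) (e v2) (e v3)
      (smult k1 (eval3 (line_param v1 v2 \<alpha>) (P v1))) (smult k2 (eval3 (line_param v1 v2 \<alpha>) (P v2)))
      (smult k3 (eval3 (line_param v1 v2 \<alpha>) (P v3))) (smult k4 (eval3 (line_param v1 v2 \<alpha>) S))"
proof -
  let ?\<theta> = "line_param v1 v2 \<alpha>"
  define x y z where "x = inverse (\<alpha> v1)" and "y = inverse (\<alpha> v2)" and "z = - inverse (\<alpha> v3)"
  define d where "d = e v1 + e v2 + e v3"
  have nz': "x \<noteq> 0" "y \<noteq> 0" "z \<noteq> 0"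
    using nz by (simp_all add: x_def y_def z_def)
  have \<theta>: "?\<theta> v1 = smult x X0" "?\<theta> v2 = smult y 1" "?\<theta> v3 = smult z X1"
    using dist by (auto simp: line_param_def x_def y_def z_def one_pCons)
  have "eval3 ?\<theta> (ideal_comb e P S) = gen_comb (e v1) (e v2) (e v3) (smult (x ^ d) (eval3 ?\<theta> (P v1)))
      (smult (y ^ d) (eval3 ?\<theta> (P v2))) (smult (z ^ d) (eval3 ?\<theta> (P v3)))
      (smult (x ^ e v1 * y ^ e v2 * z ^ e v3) (eval3 ?\<theta> S))" for P S
  proof -
    have sum3: "(\<Sum>v\<in>UNIV. g v) = g v1 + g v2 + g v3" for g :: "var \<Rightarrow> 'k poly3"
      unfolding distinct_vars[OF dist] using dist by (simp add: add.assoc)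
    show ?thesis
      unfolding ideal_comb_def sum3 mixed_gen_eq_prod[OF dist] eval3_add eval3_mult eval3_power eval3_var
        \<theta> total_exp_distinct[OF dist] d_def[symmetric] gen_comb_def smult_power power_one
      by (simp only: mult_smult_left mult_smult_right mult_1_left mult_1_right smult_smult ac_simps)
  qed
  then show thesis
    using nz' by (intro that[of "x ^ d" "y ^ d" "z ^ d" "x ^ e v1 * y ^ e v2 * z ^ e v3"]) simp_all
qed

text \<open>Write \<open>f\<close> as its constant term plus \<open>t * f'\<close>. The factor
  \<open>t\<close> goes into the coefficients for \<open>f'\<close>, and the constant is a multiple
  of the generator \<open>1\<close>.\<close>

lemma gens_spanning_Suc:
  assumes "gens_spanning TYPE('k::idom) a b c E"
  shows "gens_spanning TYPE('k) a b c (Suc E)"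
  unfolding gens_spanning_def
proof
  fix f :: "'k poly" assume f: "f \<in> polys_below (a + b + c + Suc E)"
  define f' where "f' = poly_shift 1 f"
  have "f' \<in> polys_below (a + b + c + E)"
    using f by (auto simp: f'_def polys_below_def coeff_poly_shift)
  then obtain p q r s where in_E: "p \<in> polys_below E" "q \<in> polys_below E" "r \<in> polys_below E" "s \<in> polys_below E"
    and eq: "f' = gen_comb a b c p q r s"
    using assms unfolding gens_spanning_def by blast
  have X0_in: "X0 * h \<in> polys_below (Suc E)" if "h \<in> polys_below E" for h :: "'k poly"
    using polys_below_mult_X0_power[OF that, of 1] by (simp only: power_one_right ac_simps) simp
  have "poly_cutoff 1 f \<in> polys_below (Suc E)"
    by (auto simp: polys_below_def coeff_poly_cutoff)
  then have q: "poly_cutoff 1 f + X0 * q \<in> polys_below (Suc E)"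
    by (intro polys_below_add X0_in in_E)
  have "f = poly_cutoff 1 f + f' * X0 ^ 1"
    unfolding f'_def by (rule poly_cutoff_plus_shift)
  also have "\<dots> = gen_comb a b c (X0 * p) (poly_cutoff 1 f + X0 * q) (X0 * r) (X0 * s)"
    unfolding eq gen_comb_def power_one_right by (simp only: algebra_simps)
  finally show "\<exists>p\<in>polys_below (Suc E). \<exists>q\<in>polys_below (Suc E). \<exists>r\<in>polys_below (Suc E). \<exists>s\<in>polys_below (Suc E).
      f = gen_comb a b c p q r s"
    using q X0_in in_E by blast
qed

lemma gens_spanning_mono:
  assumes "gens_spanning TYPE('k::idom) a b c E" "E \<le> E'"
  shows "gens_spanning TYPE('k) a b c E'"
  using assms(2,1) by (induction rule: dec_induct) (auto intro: gens_spanning_Suc)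

lemma smult_polys_below: "p \<in> polys_below E \<Longrightarrow> smult k p \<in> polys_below E"
  for p :: "'a::comm_semiring_0 poly"
  by (simp add: polys_below_def)

text \<open>Write the restriction of \<open>f\<close> to the line as a combination of the generators
  and lift its coefficients. What remains of \<open>f\<close> vanishes on the line, hence is a
  multiple of \<open>lin_form \<alpha>\<close>.\<close>

lemma spanning_imp_surjective:
  fixes \<alpha> :: "var \<Rightarrow> 'k::field"
  assumes span: "gens_spanning TYPE('k) (e VX) (e VY) (e VZ) (Suc j)" and nz: "\<And>v. \<alpha> v \<noteq> 0"
    and f: "f \<in> forms (total_exp e + j)"
  shows "\<exists>g\<in>coforms 1 (total_exp e + j). f - lin_form \<alpha> * g \<in> monomial_ideal e"
proof -
  let ?\<theta> = "line_param VX VY \<alpha>"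
  have dist: "distinct [VX, VY, VZ]"
    by simp
  obtain k1 k2 k3 k4 :: 'k where k: "k1 \<noteq> 0" "k2 \<noteq> 0" "k3 \<noteq> 0" "k4 \<noteq> 0"
    and comb: "\<And>P S. eval3 ?\<theta> (ideal_comb e P S) = gen_comb (e VX) (e VY) (e VZ)
      (smult k1 (eval3 ?\<theta> (P VX))) (smult k2 (eval3 ?\<theta> (P VY)))
      (smult k3 (eval3 ?\<theta> (P VZ))) (smult k4 (eval3 ?\<theta> S))"
    by (rule eval3_ideal_comb[where \<alpha> = \<alpha> and e = e, OF dist nz]) (rule that)
  have "eval3 ?\<theta> f \<in> polys_below (e VX + e VY + e VZ + Suc j)"
    using eval3_line_polys_below[where \<alpha> = \<alpha>, OF dist nz f] total_exp_distinct[OF dist, of e] by simp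
  then obtain p q r s where "p \<in> polys_below (Suc j)" "q \<in> polys_below (Suc j)"
    "r \<in> polys_below (Suc j)" "s \<in> polys_below (Suc j)"
    and eq: "eval3 ?\<theta> f = gen_comb (e VX) (e VY) (e VZ) p q r s"
    using span unfolding gens_spanning_def by blast
  then have "smult (inverse k1) p \<in> polys_below (j + 1)" "smult (inverse k2) q \<in> polys_below (j + 1)"
    "smult (inverse k3) r \<in> polys_below (j + 1)" "smult (inverse k4) s \<in> polys_below (j + 1)"
    by (simp_all add: smult_polys_below)
  note lift = this[THEN eval3_line_surj[where \<alpha> = \<alpha>, OF dist nz]]
  obtain P1 where P1: "P1 \<in> forms j" "eval3 ?\<theta> P1 = smult (inverse k1) p"
    using lift(1) by blast
  obtain P2 where P2: "P2 \<in> forms j" "eval3 ?\<theta> P2 = smult (inverse k2) q"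
    using lift(2) by blast
  obtain P3 where P3: "P3 \<in> forms j" "eval3 ?\<theta> P3 = smult (inverse k3) r"
    using lift(3) by blast
  obtain S where S: "S \<in> forms j" "eval3 ?\<theta> S = smult (inverse k4) s"
    using lift(4) by blast
  define P where "P = case_var P1 P2 P3"
  have "coforms (total_exp e) (total_exp e + j) = (forms j :: 'k poly3 set)"
    using coforms_eq_forms[of "total_exp e" j] by (simp add: add.commute)
  moreover have "P v \<in> forms j" for v
    using P1 P2 P3 by (cases v) (simp_all add: P_def)
  ultimately have "ideal_comb e P S \<in> forms (total_exp e + j)"
    using S(1) by (intro ideal_comb_forms) simp_all
  then have "f - ideal_comb e P S \<in> forms (total_exp e + j)"
    using f coforms_diff unfolding forms_eq_coforms by blast
  moreover have "eval3 ?\<theta> (f - ideal_comb e P S) = 0"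
    using k by (simp add: comb eq P_def P1 P2 P3 S)
  ultimately obtain h where "h \<in> coforms 1 (total_exp e + j)" "f - ideal_comb e P S = lin_form \<alpha> * h"
    using eval3_line_eq_0[where \<alpha> = \<alpha>, OF dist nz] by blast
  moreover from this(2) have "f - lin_form \<alpha> * h = ideal_comb e P S"
    by (simp add: algebra_simps)
  ultimately show ?thesis
    using ideal_comb_monomial_ideal by metis
qed

text \<open>A representation of \<open>lin_form \<alpha> * f\<close> by the generators restricts to
  a relation on the line. By independence its coefficients, suitably rearranged, are all multiples
  of \<open>lin_form \<alpha>\<close>, and this factor cancels.\<close>

lemma independent_imp_injective:
  fixes \<alpha> :: "var \<Rightarrow> 'k::field"
  assumes ind: "gens_independent TYPE('k) (e VX) (e VY) (e VZ) E" and nz: "\<And>v. \<alpha> v \<noteq> 0"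
    and "i < total_exp e + E" and f: "lin_form \<alpha> * f \<in> forms i" "lin_form \<alpha> * f \<in> monomial_ideal e"
  shows "f \<in> monomial_ideal e"
proof -
  let ?\<theta> = "line_param VX VY \<alpha>"
  let ?L = "lin_form \<alpha>"
  define d where "d = total_exp e"
  have dist: "distinct [VX, VY, VZ]"
    by simp
  have d_eq: "d = e VX + e VY + e VZ"
    by (simp add: d_def total_exp_distinct[OF dist])
  have L: "?L \<noteq> 0"
    using lin_form_nonzero[of \<alpha> VX] nz by auto
  obtain P S where PS: "?L * f = ideal_comb e P S" "\<And>v. P v \<in> coforms d i" "S \<in> coforms d i"
    using monomial_ideal_decomp[OF f(2,1)] unfolding d_def by metis
  show ?thesis
  proof (cases "i < d")
    case True
    then have "ideal_comb e P S = 0"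
      using PS(2,3) by (simp add: coforms_eq_0 ideal_comb_def)
    with PS(1) L show ?thesis by simp
  next
    case False
    then obtain j where i: "i = j + d" and j: "j < E"
      using \<open>i < total_exp e + E\<close> by (metis add.commute d_def le_add_diff_inverse2 nat_add_left_cancel_less not_less)
    have P: "P v \<in> forms j" for v
      using PS(2) unfolding i coforms_eq_forms .
    have S: "S \<in> forms j"
      using PS(3) unfolding i coforms_eq_forms .
    have below: "eval3 ?\<theta> g \<in> polys_below E" if "g \<in> forms j" for g
      using polys_below_mono[OF _ eval3_line_polys_below[where \<alpha> = \<alpha>, OF dist nz that]] j by simp
    obtain k1 k2 k3 k4 :: 'k where k: "k1 \<noteq> 0" "k2 \<noteq> 0" "k3 \<noteq> 0" "k4 \<noteq> 0"
      and comb: "\<And>P S. eval3 ?\<theta> (ideal_comb e P S) = gen_comb (e VX) (e VY) (e VZ)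
        (smult k1 (eval3 ?\<theta> (P VX))) (smult k2 (eval3 ?\<theta> (P VY)))
        (smult k3 (eval3 ?\<theta> (P VZ))) (smult k4 (eval3 ?\<theta> S))"
      by (rule eval3_ideal_comb[where \<alpha> = \<alpha> and e = e, OF dist nz]) (rule that)
    have zero: "eval3 ?\<theta> (ideal_comb e P S) = 0"
      unfolding PS(1)[symmetric] by (simp add: eval3_line_lin_form[where \<alpha> = \<alpha>, OF dist nz])
    then have "smult k2 (eval3 ?\<theta> (P VY)) = 0 \<and> smult k3 (eval3 ?\<theta> (P VZ)) = 0 \<and>
        X0 ^ (e VY + e VZ) dvd smult k4 (eval3 ?\<theta> S)"
      using ind unfolding comb gens_independent_def by (blast intro: smult_polys_below below P S)
    then have PY: "eval3 ?\<theta> (P VY) = 0" and PZ: "eval3 ?\<theta> (P VZ) = 0" and "X0 ^ (e VY + e VZ) dvd eval3 ?\<theta> S"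
      using k by (simp_all add: dvd_smult_iff)
    then obtain s1 where s1: "eval3 ?\<theta> S = s1 * X0 ^ (e VY + e VZ)"
      by (auto simp: dvd_def mult.commute)
    text \<open>Replace \<open>S\<close> by a multiple of \<open>x\<^sup>b\<^sup>+\<^sup>c\<close>, because \<open>x\<^sup>b\<^sup>+\<^sup>c \<cdot> x\<^sup>a y\<^sup>b z\<^sup>c = y\<^sup>b z\<^sup>c \<cdot> x\<^sup>d\<close>.\<close>
    define s0 where "s0 = smult (inverse (\<alpha> VX) ^ (e VY + e VZ)) (1 :: 'k poly)"
    have X_pow: "eval3 ?\<theta> (var_poly VX ^ (e VY + e VZ)) = s0 * X0 ^ (e VY + e VZ)"
    proof -
      have "?\<theta> VX = smult (inverse (\<alpha> VX)) X0"
        by (simp add: line_param_def)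
      then show ?thesis
        by (simp only: eval3_power eval3_var s0_def smult_power mult_smult_left mult_1_left)
    qed
    \<comment> \<open>If \<open>j < b + c\<close>, the degree of \<open>S\<close> forces
      \<open>s1 = 0\<close> and the witness is 0; \<open>coforms\<close> covers this case as
      well.\<close>
    obtain S1 where S1: "S1 \<in> coforms (e VY + e VZ) j" "s0 * eval3 ?\<theta> S1 = s1"
    proof (cases "s1 = 0")
      case False
      then have "Polynomial.degree (eval3 ?\<theta> S) = Polynomial.degree s1 + (e VY + e VZ)"
        unfolding s1 by (auto simp: degree_mult_eq degree_power_eq)
      moreover have "Polynomial.degree (eval3 ?\<theta> S) < j + 1" if "eval3 ?\<theta> S \<noteq> 0"
        using eval3_line_polys_below[where \<alpha> = \<alpha>, OF dist nz S] that by (simp add: polys_below_iff_degree)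
      moreover have "eval3 ?\<theta> S \<noteq> 0"
        unfolding s1 using False by simp
      ultimately have *: "Polynomial.degree s1 < j - (e VY + e VZ) + 1" "e VY + e VZ \<le> j"
        by auto
      then have "smult (inverse (inverse (\<alpha> VX) ^ (e VY + e VZ))) s1 \<in> polys_below (j - (e VY + e VZ) + 1)"
        by (intro smult_polys_below) (simp add: polys_below_iff_degree)
      then obtain S1 where "S1 \<in> forms (j - (e VY + e VZ))"
        "eval3 ?\<theta> S1 = smult (inverse (inverse (\<alpha> VX) ^ (e VY + e VZ))) s1"
        using eval3_line_surj[where \<alpha> = \<alpha>, OF dist nz] by blast
      then show ?thesis
        using nz * coforms_eq_forms[where 'a = 'k, of "e VY + e VZ" "j - (e VY + e VZ)"]
        by (intro that[of S1]) (simp_all add: s0_def)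
    qed (use that[of 0] in simp)
    have "var_poly VX ^ (e VY + e VZ) * S1 \<in> forms j"
      by (rule form_mult_coforms[OF _ S1(1)]) (simp add: forms_eq_coforms var_poly_power_coforms)
    then have "S - var_poly VX ^ (e VY + e VZ) * S1 \<in> forms j"
      using S coforms_diff unfolding forms_eq_coforms by blast
    moreover have "eval3 ?\<theta> (S - var_poly VX ^ (e VY + e VZ) * S1) = 0"
      unfolding eval3_diff eval3_mult X_pow s1 S1(2)[symmetric] by (simp only: ac_simps diff_self)
    ultimately obtain h where h: "S - var_poly VX ^ (e VY + e VZ) * S1 = ?L * h"
      using eval3_line_eq_0[where \<alpha> = \<alpha>, OF dist nz] by blast
    let ?yz = "var_poly VY ^ e VY * var_poly VZ ^ e VZ :: 'k poly3"
    have mixed: "mixed_gen e * var_poly VX ^ (e VY + e VZ) = var_poly VX ^ d * ?yz"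
      by (simp add: mixed_gen_eq_prod[OF dist] d_eq power_add ac_simps)
    have "?yz \<in> forms (e VY + e VZ)"
      using coforms_mult[OF var_poly_power_coforms[of VY "e VY"] var_poly_power_coforms[of VZ "e VZ"]] by (simp add: forms_eq_coforms)
    then have "?yz * S1 \<in> forms j"
      using S1(1) by (rule form_mult_coforms)
    then have "P VX + ?yz * S1 \<in> forms j"
      using P coforms_add unfolding forms_eq_coforms by blast
    moreover have "eval3 ?\<theta> (P VX + ?yz * S1) = 0"
    proof -
      have "ideal_comb e P S = var_poly VX ^ d * (P VX + ?yz * S1) + var_poly VY ^ d * P VY + var_poly VZ ^ d * P VZ
          + mixed_gen e * (S - var_poly VX ^ (e VY + e VZ) * S1)"
        unfolding right_diff_distrib mult.assoc[symmetric] mixed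
        by (simp add: ideal_comb_def UNIV_var d_def algebra_simps)
      then have "eval3 ?\<theta> (var_poly VX ^ d) * eval3 ?\<theta> (P VX + ?yz * S1) = 0"
        using zero PY PZ h by (simp only: eval3_add eval3_mult eval3_line_lin_form[where \<alpha> = \<alpha>, OF dist nz] mult_zero_left mult_zero_right add_0_right)
      moreover have "eval3 ?\<theta> (var_poly VX ^ d) \<noteq> 0"
        using nz by (simp add: line_param_def)
      ultimately show ?thesis
        by (metis mult_eq_0_iff)
    qed
    ultimately obtain h1 where h1: "P VX + ?yz * S1 = ?L * h1"
      using eval3_line_eq_0[where \<alpha> = \<alpha>, OF dist nz] by blast
    obtain h2 h3 where h23: "P VY = ?L * h2" "P VZ = ?L * h3"
      using eval3_line_eq_0[where \<alpha> = \<alpha>, OF dist nz P PY] eval3_line_eq_0[where \<alpha> = \<alpha>, OF dist nz P PZ] by blast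
    have "?L * f = var_poly VX ^ d * (P VX + ?yz * S1) + var_poly VY ^ d * P VY + var_poly VZ ^ d * P VZ
          + mixed_gen e * (S - var_poly VX ^ (e VY + e VZ) * S1)"
      unfolding right_diff_distrib mult.assoc[symmetric] mixed PS(1)
      by (simp add: ideal_comb_def UNIV_var d_def algebra_simps)
    also have "\<dots> = ?L * ideal_comb e (case_var h1 h2 h3) h"
      unfolding h1 h23 h by (simp add: ideal_comb_def UNIV_var d_def algebra_simps)
    finally have "f = ideal_comb e (case_var h1 h2 h3) h"
      using L by simp
    then show ?thesis
      by (simp add: ideal_comb_monomial_ideal)
  qed
qed

text \<open>The form \<open>x + y + z\<close> works. Target degrees \<open>i + 1 < d + E\<close> are
  injective; otherwise \<open>i + 1 = d + j\<close> with \<open>j >= E\<close>, and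
  \<open>E' \<le> Suc j\<close> gives surjectivity.\<close>

lemma has_WLP_if_independent_spanning:
  fixes K :: "'k::field itself"
  assumes ind: "gens_independent TYPE('k) a b c E" and span: "gens_spanning TYPE('k) a b c E'"
    and "E' \<le> E + 1"
  shows "has_WLP (R_algebra K a b c) (R_piece K a b c)"
proof -
  define e where "e = exps a b c"
  define d where "d = total_exp e"
  have "lefschetz e (\<lambda>_. 1 :: 'k) i" for i
  proof (cases "i + 1 < d + E")
    case True
    have "f \<in> monomial_ideal e" if "f \<in> forms i" "lin_form (\<lambda>_. 1) * f \<in> monomial_ideal e" for f :: "'k poly3"
    proof (rule independent_imp_injective)
      show "gens_independent TYPE('k) (e VX) (e VY) (e VZ) E"
        using ind by (simp add: e_def)
      show "lin_form (\<lambda>_. 1) * f \<in> forms (i + 1)"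
        using coforms_mult[of "lin_form (\<lambda>_. 1)" 0 1 f 0 i] lin_form_forms[of "\<lambda>_. 1 :: 'k"] that(1) by (simp add: forms_eq_coforms)
    qed (use True that in \<open>simp_all add: d_def\<close>)
    then show ?thesis
      by (simp add: lefschetz_def)
  next
    case False
    show ?thesis
    proof (cases "d = 0")
      case True
      then have "f \<in> monomial_ideal e" for f :: "'k poly3"
        by (simp add: monomial_ideal_def in_gens_def d_def)
      then show ?thesis
        by (simp add: lefschetz_def)
    next
      case d: False
      have "E' \<noteq> 0"
      proof
        assume "E' = 0"
        have "\<exists>p\<in>polys_below 0. \<exists>q\<in>polys_below 0. \<exists>r\<in>polys_below 0. \<exists>s\<in>polys_below 0.
            1 = gen_comb a b c p q r (s :: 'k poly)"
          using span d unfolding gens_spanning_def \<open>E' = 0\<close>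
          by (elim ballE[of _ _ 1]) (auto simp: polys_below_iff_degree d_def e_def)
        moreover have "polys_below 0 = {0 :: 'k poly}"
          by (auto simp: polys_below_iff_degree)
        ultimately show False
          by (simp add: gen_comb_def)
      qed
      then obtain j where j: "i + 1 = d + j" "E' \<le> Suc j"
        using False \<open>E' \<le> E + 1\<close> d by (intro that[of "i + 1 - d"]) auto
      have span': "gens_spanning TYPE('k) (e VX) (e VY) (e VZ) (Suc j)"
        using gens_spanning_mono[OF span j(2)] by (simp add: e_def)
      have "\<exists>g\<in>forms i. f - lin_form (\<lambda>_. 1) * g \<in> monomial_ideal e" if "f \<in> forms (i + 1)" for f :: "'k poly3"
        using spanning_imp_surjective[OF span', of "\<lambda>_. 1" f] that coforms_eq_forms[where 'a = 'k, of 1 i]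
        unfolding d_def[symmetric] j(1)[symmetric] by simp
      then show ?thesis
        by (simp add: lefschetz_def)
    qed
  qed
  then show ?thesis
    unfolding has_WLP_iff_lefschetz e_def by blast
qed

section \<open>Failure of the Lefschetz property\<close>

text \<open>Exchanging the first two variables acts on the line as \<open>t |-> 1/t\<close>,
  followed by multiplication with \<open>t ^ N\<close>. Since the index runs over all integers,
  coefficients beyond \<open>N\<close> are zero.\<close>

definition palindromic :: "int \<Rightarrow> 'a::zero poly \<Rightarrow> bool" where
  "palindromic N f \<longleftrightarrow> (\<forall>i. int_coeff f i = int_coeff f (N - i))"

lemma palindromic_add: "palindromic N f \<Longrightarrow> palindromic N g \<Longrightarrow> palindromic N (f + g)"
  for f g :: "'a::comm_ring_1 poly"
  unfolding palindromic_def
proof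
  fix i
  assume "\<forall>i. int_coeff f i = int_coeff f (N - i)" "\<forall>i. int_coeff g i = int_coeff g (N - i)"
  moreover have "int_coeff (f + g) i = int_coeff f i + int_coeff g i" for i
    by (simp add: int_coeff_def)
  ultimately show "int_coeff (f + g) i = int_coeff (f + g) (N - i)"
    by metis
qed

lemma palindromic_smult: "palindromic N f \<Longrightarrow> palindromic N (smult k f)"
  for f :: "'a::comm_ring_1 poly"
proof -
  have "int_coeff (smult k f) i = k * int_coeff f i" for i
    by (simp add: int_coeff_def)
  then show "palindromic N f \<Longrightarrow> palindromic N (smult k f)"
    unfolding palindromic_def by metis
qed

lemma palindromic_sum: "(\<And>x. x \<in> A \<Longrightarrow> palindromic N (f x)) \<Longrightarrow> palindromic N (sum f A)"
  for f :: "'b \<Rightarrow> 'a::comm_ring_1 poly"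
proof (induction A rule: infinite_finite_induct)
  case (insert x A)
  then show ?case
    by (simp add: palindromic_add)
qed (simp_all add: palindromic_def int_coeff_def)

lemma palindromic_mult_X1_power: "palindromic N f \<Longrightarrow> palindromic (N + int k) (f * X1 ^ k)"
  for f :: "'a::comm_ring_1 poly"
proof (induction k)
  case (Suc k)
  have "palindromic (M + 1) (g * X1)" if "palindromic M g" for M and g :: "'a poly"
    unfolding palindromic_def int_coeff_mult_X1 shift_add_def
  proof
    fix i
    have "int_coeff g i = int_coeff g (M - i)" "int_coeff g (i - 1) = int_coeff g (M - (i - 1))"
      using that by (simp_all only: palindromic_def)
    moreover have "M + 1 - i = M - (i - 1)" "M + 1 - i - 1 = M - i"
      by simp_all
    ultimately show "int_coeff g i + int_coeff g (i - 1) = int_coeff g (M + 1 - i) + int_coeff g (M + 1 - i - 1)"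
      by (simp only: add.commute)
  qed
  from this[OF Suc.IH[OF Suc.prems]] have "palindromic (N + int k + 1) (f * X1 ^ k * X1)" .
  moreover have "f * X1 ^ k * X1 = f * X1 ^ Suc k"
    by (simp only: power_Suc2 mult.assoc)
  moreover have "N + int k + 1 = N + int (Suc k)"
    by simp
  ultimately show ?case
    by (simp only:)
qed simp

lemma palindromic_mult_X0_power: "palindromic N f \<Longrightarrow> palindromic (N + 2 * int k) (f * X0 ^ k)"
  for f :: "'a::comm_ring_1 poly"
proof -
  assume pal: "palindromic N f"
  have *: "int_coeff (f * X0 ^ k) i = int_coeff f (i - int k)" for i
    by (auto simp: int_coeff_def coeff_mult_X0_power nat_less_iff nat_diff_distrib)
  show "palindromic (N + 2 * int k) (f * X0 ^ k)"
    unfolding palindromic_def *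
  proof
    fix i
    have "int_coeff f (i - int k) = int_coeff f (N - (i - int k))"
      using pal by (simp only: palindromic_def)
    then show "int_coeff f (i - int k) = int_coeff f (N + 2 * int k - i - int k)"
      by (simp add: algebra_simps)
  qed
qed

lemma palindromic_X0_powers: "palindromic (int (i + j)) (X0 ^ i + X0 ^ j :: 'a::comm_ring_1 poly)"
  unfolding palindromic_def int_coeff_def X0_power by (auto simp: nat_eq_iff)

lemma palindromic_eq_0:
  assumes "palindromic N f" "\<And>k. 2 * int k \<le> N \<Longrightarrow> poly.coeff f k = 0"
  shows "f = 0"
proof (rule poly_eqI)
  fix k
  show "poly.coeff f k = poly.coeff 0 k"
  proof (cases "2 * int k \<le> N")
    case False
    have "poly.coeff f k = int_coeff f (N - int k)"
      using assms(1) unfolding palindromic_def by (metis int_coeff_def nat_int of_nat_less_0_iff)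
    also have "\<dots> = 0"
      using assms(2)[of "nat (N - int k)"] False by (auto simp: int_coeff_def)
    finally show ?thesis by simp
  qed (simp add: assms(2))
qed

text \<open>A zero row completes the system to a square one with determinant zero.\<close>

lemma underdetermined_kernel:
  fixes C :: "nat \<Rightarrow> nat \<Rightarrow> 'a::field"
  obtains x where "\<exists>j\<le>m. x j \<noteq> 0" "\<And>k. k < m \<Longrightarrow> (\<Sum>j\<le>m. C k j * x j) = 0"
proof -
  define C' where "C' k j = (if k < m then C k j else 0)" for k j
  have "det (mat (Suc m) (Suc m) (\<lambda>(k, j). C' k j)) = 0"
    by (subst laplace_expansion_row[of _ "Suc m" m]) (auto simp: C'_def)
  then obtain x where x: "\<exists>j<Suc m. x j \<noteq> 0" "\<forall>k<Suc m. (\<Sum>j<Suc m. C' k j * x j) = 0"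
    unfolding det_eq_0_iff_kernel by blast
  have "(\<Sum>j\<le>m. C k j * x j) = 0" if "k < m" for k
  proof -
    have "(\<Sum>j<Suc m. C' k j * x j) = 0"
      using x(2) that less_SucI by blast
    then show ?thesis
      using that by (simp add: C'_def lessThan_Suc_atMost del: sum.lessThan_Suc)
  qed
  then show thesis
    using that x(1) by (metis less_Suc_eq_le)
qed

lemma sum_lessThan_add: "(\<Sum>j<m + n. f j) = (\<Sum>j<m. f j) + (\<Sum>j<n. f (m + j))"
  for f :: "nat \<Rightarrow> 'a::comm_monoid_add"
  by (induction n) (simp_all add: add.assoc)

text \<open>With \<open>q\<close> the reversal of \<open>p\<close> and with \<open>r\<close> and \<open>s\<close> palindromic, the combination is palindromic,
  so \<open>2 n + 1\<close> unknowns meet only \<open>2 n\<close> equations.\<close>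

lemma symmetric_relation:
  assumes "odd n" "b + b + c = 3 * n"
  obtains p q r s :: "'a::field_char_0 poly" where
    "p \<in> polys_below n" "q \<in> polys_below n" "r \<in> polys_below n" "s \<in> polys_below n"
    "\<not> (p = 0 \<and> r = 0 \<and> s = 0)" "gen_comb b b c p q r s = 0"
proof -
  obtain h where n: "n = 2 * h + 1"
    using \<open>odd n\<close> by (rule oddE)
  define H where "H = h + 1"
  \<comment> \<open>For \<open>j \<le> h\<close> these form a basis of the palindromes with
    \<open>n = 2 * h + 1\<close> coefficients. Here \<open>\<rho> 0\<close> is
    \<open>2 * X0 ^ h\<close>, nonzero in characteristic zero.\<close>
  define \<rho> :: "nat \<Rightarrow> 'a poly" where "\<rho> j = X0 ^ (h - j) + X0 ^ (h + j)" for j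
  \<comment> \<open>A multiple of \<open>X0 ^ d\<close> is paired with its mirror image among the
    multiples of \<open>1\<close>; the other two generators are symmetric themselves, the mixed one
    because both its first exponents are \<open>b\<close>.\<close>
  define col :: "nat \<Rightarrow> 'a poly" where "col j =
    (if j < n then X0 ^ (3 * n + j) + X0 ^ (n - 1 - j)
     else if j < n + H then \<rho> (j - n) * X1 ^ (3 * n)
     else \<rho> (j - (n + H)) * X0 ^ b * X1 ^ c)" for j
  obtain x where x_nz: "\<exists>j\<le>2 * n. x j \<noteq> 0"
    and x: "\<And>k. k < 2 * n \<Longrightarrow> (\<Sum>j\<le>2 * n. poly.coeff (col j) k * x j) = 0"
    using underdetermined_kernel[of "2 * n" "\<lambda>k j. poly.coeff (col j) k"] by blast
  define p where "p = (\<Sum>j<n. smult (x j) (X0 ^ j))"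
  define q where "q = (\<Sum>j<n. smult (x j) (X0 ^ (n - 1 - j)))"
  define r where "r = (\<Sum>j<H. smult (x (n + j)) (\<rho> j))"
  define s where "s = (\<Sum>j<H. smult (x (n + H + j)) (\<rho> j))"
  have "palindromic (4 * int n - 1) (col j)" if "j \<le> 2 * n" for j
  proof -
    have \<rho>: "palindromic (2 * int h) (\<rho> i)" if "i \<le> h" for i
      using palindromic_X0_powers[of "h - i" "h + i", where 'a = 'a] that by (simp add: \<rho>_def)
    consider "j < n" | "n \<le> j" "j < n + H" | "n + H \<le> j"
      by linarith
    then show ?thesis
    proof cases
      case 1
      then show ?thesis
        using palindromic_X0_powers[of "3 * n + j" "n - 1 - j", where 'a = 'a]
        by (simp add: col_def of_nat_diff)
    next
      case 2
      then have "palindromic (2 * int h + int (3 * n)) (\<rho> (j - n) * X1 ^ (3 * n))"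
        by (intro palindromic_mult_X1_power \<rho>) (simp add: H_def)
      moreover have "2 * int h + int (3 * n) = 4 * int n - 1"
        by (simp add: n)
      ultimately show ?thesis
        using 2 by (simp add: col_def)
    next
      case 3
      then have "palindromic (2 * int h + 2 * int b + int c) (\<rho> (j - (n + H)) * X0 ^ b * X1 ^ c)"
        using that n H_def by (intro palindromic_mult_X1_power palindromic_mult_X0_power \<rho>) simp
      moreover have "2 * int h + 2 * int b + int c = 4 * int n - 1"
        using assms(2) n by linarith
      ultimately show ?thesis
        using 3 by (simp add: col_def)
    qed
  qed
  then have "palindromic (4 * int n - 1) (\<Sum>j\<le>2 * n. smult (x j) (col j))"
    by (intro palindromic_sum palindromic_smult) simp
  \<comment> \<open>The weight \<open>4 * n - 1\<close> is odd, so the \<open>4 * n\<close> rows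
    pair off and the equations for \<open>k < 2 * n\<close> suffice.\<close>
  then have zero: "(\<Sum>j\<le>2 * n. smult (x j) (col j)) = 0"
  proof (rule palindromic_eq_0)
    fix k assume "2 * int k \<le> 4 * int n - 1"
    then show "poly.coeff (\<Sum>j\<le>2 * n. smult (x j) (col j)) k = 0"
      using x[of k] by (simp add: coeff_sum mult.commute)
  qed
  have "2 * n + 1 = n + H + H"
    by (simp add: n H_def)
  then have "(\<Sum>j\<le>2 * n. smult (x j) (col j)) = (\<Sum>j<n + H + H. smult (x j) (col j))"
    by (metis Suc_eq_plus1 lessThan_Suc_atMost)
  also have "\<dots> = p * X0 ^ (3 * n) + q + r * X1 ^ (3 * n) + s * X0 ^ b * X1 ^ c"
    unfolding sum_lessThan_add
  proof (intro arg_cong2[of _ _ _ _ "(+)"])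
    have "(\<Sum>j<n. smult (x j) (col j)) = (\<Sum>j<n. smult (x j) (X0 ^ j) * X0 ^ (3 * n) + smult (x j) (X0 ^ (n - 1 - j)))"
      by (intro sum.cong) (auto simp: col_def smult_add_right power_add mult.commute)
    then show "(\<Sum>j<n. smult (x j) (col j)) = p * X0 ^ (3 * n) + q"
      by (simp add: p_def q_def sum.distrib sum_distrib_right)
  qed (simp_all add: col_def r_def s_def sum_distrib_right del: sum.lessThan_Suc)
  also have "\<dots> = gen_comb b b c p q r s"
    unfolding gen_comb_def assms(2) ..
  finally have rel: "gen_comb b b c p q r s = 0"
    using zero by simp
  have coeff_p: "poly.coeff p j = x j" if "j < n" for j
  proof -
    have "poly.coeff p j = (\<Sum>i<n. if i = j then x j else 0)"
      unfolding p_def coeff_sum by (intro sum.cong) (auto simp: X0_power)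
    then show ?thesis
      using that by simp
  qed
  have coeff_\<rho>: "poly.coeff (\<Sum>i<H. smult (y i) (\<rho> i)) (h + j) = (if j = 0 then 2 else 1) * y j"
    if "j \<le> h" for j and y :: "nat \<Rightarrow> 'a"
  proof -
    have "poly.coeff (\<Sum>i<H. smult (y i) (\<rho> i)) (h + j) =
        (\<Sum>i<H. if i = j then (if j = 0 then 2 else 1) * y j else 0)"
      unfolding coeff_sum by (intro sum.cong) (auto simp: \<rho>_def X0_power H_def)
    then show ?thesis
      using that by (simp add: H_def)
  qed
  have "\<not> (p = 0 \<and> r = 0 \<and> s = 0)"
  proof
    assume *: "p = 0 \<and> r = 0 \<and> s = 0"
    obtain j where j: "j \<le> 2 * n" "x j \<noteq> 0"
      using x_nz by blast
    consider "j < n" | i where "i \<le> h" "j = n + i" | i where "i \<le> h" "j = n + H + i"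
      using j(1) n H_def that(1) that(2)[of "j - n"] that(3)[of "j - (n + H)"] by linarith
    then show False
    proof cases
      case 1
      then show False
        using coeff_p[of j] * j by simp
    next
      case 2
      then show False
        using coeff_\<rho>[OF 2(1), of "\<lambda>i. x (n + i)"] * j by (auto simp: r_def[symmetric] split: if_splits)
    next
      case 3
      then show False
        using coeff_\<rho>[OF 3(1), of "\<lambda>i. x (n + H + i)"] * j by (auto simp: s_def[symmetric] split: if_splits)
    qed
  qed
  moreover have X0_below: "X0 ^ j \<in> (polys_below n :: 'a poly set)" if "j < n" for j
    using that by (auto simp: polys_below_def X0_power)
  moreover have sum_below: "sum f A \<in> polys_below n" if "\<And>j. j \<in> A \<Longrightarrow> f j \<in> polys_below n" for f :: "nat \<Rightarrow> 'a poly" and A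
    using that by (auto simp: polys_below_def coeff_sum intro: sum.neutral)
  have "p \<in> polys_below n" "q \<in> polys_below n"
    unfolding p_def q_def by (intro sum_below smult_polys_below X0_below; simp)+
  moreover have "r \<in> polys_below n" "s \<in> polys_below n"
    unfolding r_def s_def \<rho>_def by (intro sum_below smult_polys_below polys_below_add X0_below; simp add: n H_def)+
  ultimately show thesis
    using rel that by blast
qed

text \<open>The full system is square of size \<open>4 * n\<close>. A relation makes it singular,
  and a vector in the left kernel is a functional that kills all combinations but not every
  monomial.\<close>

lemma relation_imp_not_spanning:
  fixes p q r s :: "'a::field poly"
  assumes d: "a + b + c = 3 * n"
    and below: "p \<in> polys_below n" "q \<in> polys_below n" "r \<in> polys_below n" "s \<in> polys_below n"
    and nz: "\<not> (p = 0 \<and> q = 0 \<and> r = 0 \<and> s = 0)" and rel: "gen_comb a b c p q r s = 0"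
  shows "\<not> gens_spanning TYPE('a) a b c n"
proof
  assume span: "gens_spanning TYPE('a) a b c n"
  define col :: "nat \<Rightarrow> 'a poly" where "col j =
    (if j < n then X0 ^ j * X0 ^ (3 * n) else if j < n + n then X0 ^ (j - n)
     else if j < n + n + n then X0 ^ (j - (n + n)) * X1 ^ (3 * n)
     else X0 ^ (j - (n + n + n)) * X0 ^ a * X1 ^ c)" for j
  define coefs :: "'a poly \<Rightarrow> 'a poly \<Rightarrow> 'a poly \<Rightarrow> 'a poly \<Rightarrow> nat \<Rightarrow> 'a" where "coefs p q r s j =
    (if j < n then poly.coeff p j else if j < n + n then poly.coeff q (j - n)
     else if j < n + n + n then poly.coeff r (j - (n + n))
     else poly.coeff s (j - (n + n + n)))" for p q r s j
  let ?N = "n + n + n + n"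
  have comb: "(\<Sum>j<?N. smult (coefs p q r s j) (col j)) = gen_comb a b c p q r s"
    if "p \<in> polys_below n" "q \<in> polys_below n" "r \<in> polys_below n" "s \<in> polys_below n" for p q r s
  proof -
    have expand: "f = (\<Sum>j<n. smult (poly.coeff f j) (X0 ^ j))" if "f \<in> polys_below n" for f :: "'a poly"
      using polys_below_sum_monom[OF that] by (simp add: X0_power smult_monom)
    have "(\<Sum>j<?N. smult (coefs p q r s j) (col j)) =
        (\<Sum>j<n. smult (poly.coeff p j) (X0 ^ j)) * X0 ^ (3 * n) + (\<Sum>j<n. smult (poly.coeff q j) (X0 ^ j)) +
        (\<Sum>j<n. smult (poly.coeff r j) (X0 ^ j)) * X1 ^ (3 * n) + (\<Sum>j<n. smult (poly.coeff s j) (X0 ^ j)) * X0 ^ a * X1 ^ c"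
      unfolding sum_lessThan_add sum_distrib_right
      by (intro arg_cong2[of _ _ _ _ "(+)"] sum.cong refl) (simp_all add: coefs_def col_def)
    then show ?thesis
      using that[THEN expand] by (simp add: gen_comb_def d)
  qed
  have "\<exists>j<?N. coefs p q r s j \<noteq> 0"
  proof (rule ccontr)
    assume "\<not> ?thesis"
    then have zero: "coefs p q r s j = 0" if "j < ?N" for j
      using that by blast
    have "poly.coeff p j = 0" "poly.coeff q j = 0" "poly.coeff r j = 0" "poly.coeff s j = 0" if "j < n" for j
      using zero[of j] zero[of "n + j"] zero[of "n + n + j"] zero[of "n + n + n + j"] that by (simp_all add: coefs_def)
    moreover have "f = 0" if "f \<in> polys_below n" "\<And>j. j < n \<Longrightarrow> poly.coeff f j = 0" for f :: "'a poly"
      using polys_below_sum_monom[OF that(1)] that(2) by simp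
    ultimately have "p = 0" "q = 0" "r = 0" "s = 0"
      using below by blast+
    with nz show False by simp
  qed
  moreover have "(\<Sum>j<?N. poly.coeff (col j) k * coefs p q r s j) = 0" for k
    using arg_cong[OF comb[OF below], of "\<lambda>f. poly.coeff f k"] rel by (simp add: coeff_sum mult.commute)
  ultimately have "det (mat ?N ?N (\<lambda>(k, j). poly.coeff (col j) k)) = 0"
    unfolding det_eq_0_iff_kernel by blast
  then obtain w where "\<exists>k<?N. w k \<noteq> 0"
    and w: "\<And>j. j < ?N \<Longrightarrow> (\<Sum>k<?N. poly.coeff (col j) k * w k) = 0"
    by (rule det_eq_0_left_kernel) blast
  then obtain k0 where k0: "k0 < ?N" "w k0 \<noteq> 0"
    by blast
  have "monom 1 k0 \<in> (polys_below (a + b + c + n) :: 'a poly set)"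
    using k0(1) d by (auto simp: polys_below_def)
  then obtain p' q' r' s' :: "'a poly" where "p' \<in> polys_below n" "q' \<in> polys_below n" "r' \<in> polys_below n" "s' \<in> polys_below n"
    and "monom 1 k0 = gen_comb a b c p' q' r' s'"
    using bspec[OF span[unfolded gens_spanning_def]] by blast
  then have "monom 1 k0 = (\<Sum>j<?N. smult (coefs p' q' r' s' j) (col j))"
    by (simp only: comb)
  then have "(\<Sum>k<?N. poly.coeff (monom 1 k0) k * w k) = (\<Sum>k<?N. \<Sum>j<?N. coefs p' q' r' s' j * (poly.coeff (col j) k * w k))"
    by (simp only: coeff_sum coeff_smult sum_distrib_right mult.assoc)
  also have "\<dots> = (\<Sum>j<?N. coefs p' q' r' s' j * (\<Sum>k<?N. poly.coeff (col j) k * w k))"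
    by (subst sum.swap) (simp only: sum_distrib_left)
  also have "\<dots> = 0"
    using w by (intro sum.neutral) simp
  also have "(\<Sum>k<?N. poly.coeff (monom 1 k0) k * w k) = (\<Sum>k<?N. if k = k0 then w k0 else 0)"
    by (intro sum.cong) auto
  finally show False
    using k0 by simp
qed

section \<open>Elements that refute maximal rank\<close>

lemma not_lefschetzI:
  assumes "f \<in> forms i" "lin_form \<alpha> * f \<in> monomial_ideal e" "f \<notin> monomial_ideal e"
    and "f' \<in> forms (i + 1)" "\<And>g. g \<in> forms i \<Longrightarrow> f' - lin_form \<alpha> * g \<notin> monomial_ideal e"
  shows "\<not> lefschetz e \<alpha> i"
  unfolding lefschetz_def using assms by blast

lemma ideal_comb_diff_mult:
  "ideal_comb e P S - l * ideal_comb e P' S' = ideal_comb e (\<lambda>v. P v - l * P' v) (S - l * S')"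
  by (simp add: ideal_comb_def UNIV_var algebra_simps)

text \<open>Two pure powers have common multiples only from degree \<open>2 * d\<close> on, the
  power of \<open>v\<close> and the mixed generator only from \<open>2 * d - e v\<close> on. Degree
  \<open>i\<close> lies below both, so nothing can cancel.\<close>

lemma ideal_comb_eq_0:
  fixes S :: "'k::field poly3"
  assumes zero: "ideal_comb e P S = 0"
    and P: "\<And>v. P v \<in> coforms (total_exp e) i" and S: "S \<in> coforms (total_exp e) i"
    and i: "\<And>v. i + e v < 2 * total_exp e"
  shows "P v = 0" "S = 0"
proof -
  define d where "d = total_exp e"
  define F where "F v = var_poly v ^ d * P v" for v
  define G where "G = mixed_gen e * S"
  have F_keys: "d \<le> Poly_Mapping.lookup \<mu> v \<and> monomial_degree \<mu> = i" if "Poly_Mapping.lookup (F v) \<mu> \<noteq> 0" for \<mu> v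
  proof -
    have "\<mu> \<in> Poly_Mapping.keys (Poly_Mapping.single (Poly_Mapping.single v d) 1 * P v)"
      using that by (simp add: F_def var_poly_power in_keys_iff)
    then obtain m where "m \<in> Poly_Mapping.keys (P v)" "\<mu> = Poly_Mapping.single v d + m"
      using keys_mult by fastforce
    then show ?thesis
      using P[of v] by (auto simp: lookup_add coforms_def d_def)
  qed
  have G_keys: "e v \<le> Poly_Mapping.lookup \<mu> v" "monomial_degree \<mu> = i" if "Poly_Mapping.lookup G \<mu> \<noteq> 0" for \<mu> v
  proof -
    have "\<mu> \<in> Poly_Mapping.keys (Poly_Mapping.single (exp_monomial e) 1 * S)"
      using that by (simp add: G_def mixed_gen_def in_keys_iff)
    then obtain m where "m \<in> Poly_Mapping.keys S" "\<mu> = exp_monomial e + m"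
      using keys_mult by fastforce
    then show "e v \<le> Poly_Mapping.lookup \<mu> v" "monomial_degree \<mu> = i"
      using S by (auto simp: lookup_add coforms_def)
  qed
  have FG: "(\<Sum>v\<in>UNIV. F v) + G = 0"
    using zero by (simp add: ideal_comb_def F_def G_def d_def)
  have "Poly_Mapping.lookup (F v) \<mu> = 0" for v \<mu>
  proof (rule ccontr)
    assume nz: "Poly_Mapping.lookup (F v) \<mu> \<noteq> 0"
    from F_keys[OF this] have \<mu>: "d \<le> Poly_Mapping.lookup \<mu> v" "monomial_degree \<mu> = i"
      by simp_all
    have "Poly_Mapping.lookup (F w) \<mu> = 0" if "w \<noteq> v" for w
    proof (rule ccontr)
      assume "Poly_Mapping.lookup (F w) \<mu> \<noteq> 0"
      then have "d \<le> Poly_Mapping.lookup \<mu> w"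
        using F_keys by blast
      moreover have "(\<Sum>u\<in>{v, w}. Poly_Mapping.lookup \<mu> u) \<le> monomial_degree \<mu>"
        unfolding monomial_degree_eq by (intro sum_mono2) auto
      ultimately show False
        using that \<mu> i[of v] by (simp add: d_def)
    qed
    moreover have "Poly_Mapping.lookup G \<mu> = 0"
    proof (rule ccontr)
      assume "Poly_Mapping.lookup G \<mu> \<noteq> 0"
      then have "(\<Sum>w\<in>UNIV - {v}. e w) \<le> (\<Sum>w\<in>UNIV - {v}. Poly_Mapping.lookup \<mu> w)"
        by (intro sum_mono G_keys)
      moreover have "monomial_degree \<mu> = Poly_Mapping.lookup \<mu> v + (\<Sum>w\<in>UNIV - {v}. Poly_Mapping.lookup \<mu> w)"
        unfolding monomial_degree_eq by (rule sum.remove) simp_all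
      moreover have "total_exp e = e v + (\<Sum>w\<in>UNIV - {v}. e w)"
        unfolding total_exp_def by (rule sum.remove) simp_all
      ultimately show False
        using \<mu> i[of v] by (simp add: d_def)
    qed
    moreover have "Poly_Mapping.lookup ((\<Sum>v\<in>UNIV. F v) + G) \<mu> =
        Poly_Mapping.lookup (F v) \<mu> + (\<Sum>w\<in>UNIV - {v}. Poly_Mapping.lookup (F w) \<mu>) + Poly_Mapping.lookup G \<mu>"
      unfolding lookup_add lookup_sum by (subst sum.remove[of UNIV v]) simp_all
    ultimately show False
      using nz FG by simp
  qed
  then have F: "F v = 0" for v
    by (intro poly_mapping_eqI) simp
  then have "G = 0"
    using FG by simp
  have "Poly_Mapping.lookup (var_poly v ^ d) (Poly_Mapping.single v d) = (1 :: 'k)"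
    "Poly_Mapping.lookup (mixed_gen e) (exp_monomial e) = (1 :: 'k)"
    by (simp_all add: var_poly_power mixed_gen_def)
  then have "var_poly v ^ d \<noteq> (0 :: 'k poly3)" "mixed_gen e \<noteq> (0 :: 'k poly3)"
    by (metis lookup_zero zero_neq_one)+
  then show "P v = 0" "S = 0"
    using F[of v] \<open>G = 0\<close> by (auto simp: F_def G_def)
qed

lemma degree_le_imp_polys_below: "Polynomial.degree p \<le> i \<Longrightarrow> p \<in> polys_below (i + 1)"
  by (auto simp: polys_below_iff_degree)

lemma eval3_polys_below:
  fixes f :: "'k::field poly3"
  assumes "\<And>v. Polynomial.degree (\<theta> v) \<le> 1" "f \<in> forms i"
  shows "eval3 \<theta> f \<in> polys_below (i + 1)"
proof -
  have "Poly_Mapping.keys f \<subseteq> {m. monomial_degree m = i}"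
    using assms(2) by (auto simp: forms_def)
  then show ?thesis
  proof (induction f rule: keys_induct)
    case (single m c)
    have "Polynomial.degree (mono_eval \<theta> m) \<le> (\<Sum>v\<in>UNIV. Polynomial.degree (\<theta> v ^ Poly_Mapping.lookup m v))"
      unfolding mono_eval_def using degree_prod_sum_le[of UNIV "\<lambda>v. \<theta> v ^ Poly_Mapping.lookup m v"]
      by (simp add: comp_def)
    also have "\<dots> \<le> monomial_degree m"
      unfolding monomial_degree_eq
    proof (rule sum_mono)
      fix v
      have "Polynomial.degree (\<theta> v ^ Poly_Mapping.lookup m v) \<le> Polynomial.degree (\<theta> v) * Poly_Mapping.lookup m v"
        by (rule degree_power_le)
      also have "\<dots> \<le> 1 * Poly_Mapping.lookup m v"
        by (intro mult_right_mono assms) simp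
      finally show "Polynomial.degree (\<theta> v ^ Poly_Mapping.lookup m v) \<le> Poly_Mapping.lookup m v"
        by simp
    qed
    finally show ?case
      using single by (intro degree_le_imp_polys_below) (simp add: eval3_single)
  qed (simp_all add: polys_below_add)
qed

text \<open>As \<open>u\<close> does not occur, the mixed generator could divide only if
  \<open>e u = 0\<close>. Then \<open>e v + e w = 3 * n\<close>, which contradicts
  \<open>e v < 2 * n\<close> and \<open>e w \<le> n\<close>.\<close>

lemma not_in_gens:
  assumes "distinct [v, w, u]" "total_exp e = 3 * n" "e v < 2 * n" "k < 3 * n" "l \<le> n"
  shows "\<not> in_gens e (Poly_Mapping.single v k + Poly_Mapping.single w l)"
proof
  assume "in_gens e (Poly_Mapping.single v k + Poly_Mapping.single w l)"
  then consider x where "3 * n \<le> Poly_Mapping.lookup (Poly_Mapping.single v k + Poly_Mapping.single w l) x"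
    | "\<And>x. e x \<le> Poly_Mapping.lookup (Poly_Mapping.single v k + Poly_Mapping.single w l) x"
    unfolding in_gens_def assms(2) by blast
  then show False
  proof cases
    case 1
    then show False
      using assms by (auto simp: lookup_add lookup_single when_def split: if_splits)
  next
    case 2
    have "e w \<le> l"
      using 2[of w] assms(1) by (simp add: lookup_add lookup_single)
    moreover have "e u = 0"
      using 2[of u] assms(1) by (simp add: lookup_add lookup_single)
    ultimately show False
      using assms total_exp_distinct[OF assms(1), of e] by simp
  qed
qed

section \<open>Linear forms with a vanishing coefficient\<close>

lemma single_in_monomial_ideal_iff:
  "Poly_Mapping.single m (1 :: 'k::comm_ring_1) \<in> monomial_ideal e \<longleftrightarrow> in_gens e m"
  by (simp add: monomial_ideal_def)

text \<open>Multiplication by 0 has maximal rank only if its source or its target is zero. A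
  monomial outside the ideal is exhibited in each of the two degrees.\<close>

lemma not_lefschetz_zero:
  fixes \<alpha> :: "var \<Rightarrow> 'k::field"
  assumes \<alpha>: "\<And>v. \<alpha> v = 0" and e: "total_exp e = 3 * n" "\<And>v. e v < 2 * n" and "n \<ge> 1"
  shows "\<not> lefschetz e \<alpha> (4 * n - 2)"
proof (rule not_lefschetzI)
  let ?f = "\<lambda>l. Poly_Mapping.single (Poly_Mapping.single VX (3 * n - 1) + Poly_Mapping.single VY l) (1 :: 'k)"
  have L: "lin_form \<alpha> = 0"
    by (simp add: lin_form_def \<alpha>)
  have "\<not> in_gens e (Poly_Mapping.single VX (3 * n - 1) + Poly_Mapping.single VY l)" if "l \<le> n" for l
    by (rule not_in_gens[where u = VZ and n = n]) (use e \<open>n \<ge> 1\<close> that in auto)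
  then have "?f l \<notin> monomial_ideal e" if "l \<le> n" for l
    using that by (simp add: single_in_monomial_ideal_iff)
  then show "?f (n - 1) \<notin> monomial_ideal e" "\<And>g. g \<in> forms (4 * n - 2) \<Longrightarrow> ?f n - lin_form \<alpha> * g \<notin> monomial_ideal e"
    by (simp_all add: L)
  show "?f (n - 1) \<in> forms (4 * n - 2)" "?f n \<in> forms (4 * n - 2 + 1)"
    using \<open>n \<ge> 1\<close> by (simp_all add: forms_def)
  show "lin_form \<alpha> * ?f (n - 1) \<in> monomial_ideal e"
    by (simp add: L)
qed

lemma not_lefschetz_two_variables:
  fixes \<alpha> :: "var \<Rightarrow> 'k::field"
  assumes dist: "distinct [v1, v2, v3]" and \<alpha>: "\<alpha> v1 \<noteq> 0" "\<alpha> v3 = 0"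
    and e: "total_exp e = 3 * n" "\<And>v. e v < 2 * n" and "n \<ge> 1"
  shows "\<not> lefschetz e \<alpha> (4 * n - 2)"
proof (rule not_lefschetzI)
  define d where "d = 3 * n"
  define x where "x = const_poly (\<alpha> v1) * var_poly v1"
  define y where "y = - (const_poly (\<alpha> v2) * var_poly v2)"
  \<comment> \<open>The linear form divides \<open>x ^ d - y ^ d\<close>; \<open>f\<close> is the
    quotient, times a power of \<open>v3\<close> that raises the degree to \<open>4 * n - 2\<close>.
    Its monomial \<open>v1 ^ (d - 1) * v3 ^ (n - 1)\<close> lies outside the ideal.\<close>
  define f where "f = var_poly v3 ^ (n - 1) * (\<Sum>i<d. y ^ (d - Suc i) * x ^ i)"
  have L: "lin_form \<alpha> = x - y"
    by (simp add: lin_form_distinct[OF dist] \<alpha> x_def y_def)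
  have y_eq: "y = const_poly (- \<alpha> v2) * var_poly v2"
    by (simp add: y_def)
  have "x ^ d \<in> monomial_ideal e" "y ^ d \<in> monomial_ideal e"
    using var_power_monomial_ideal[where e = e and 'a = 'k] e(1)
    unfolding x_def y_eq power_mult_distrib d_def
    by (metis monomial_ideal_mult mult.commute)+
  then have "x ^ d - y ^ d \<in> monomial_ideal e"
    using monomial_ideal_add[of "x ^ d" e "- (y ^ d)"] monomial_ideal_uminus[of "y ^ d" e] by simp
  then have "(x ^ d - y ^ d) * var_poly v3 ^ (n - 1) \<in> monomial_ideal e"
    by (rule monomial_ideal_mult)
  also have "(x ^ d - y ^ d) * var_poly v3 ^ (n - 1) = lin_form \<alpha> * f"
    unfolding L f_def power_diff_sumr2 by (simp only: ac_simps)
  finally show "lin_form \<alpha> * f \<in> monomial_ideal e" .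
  define m where "m i = Poly_Mapping.single v2 (d - Suc i) + Poly_Mapping.single v1 i + Poly_Mapping.single v3 (n - 1)" for i
  have f_eq: "f = (\<Sum>i<d. Poly_Mapping.single (m i) ((- \<alpha> v2) ^ (d - Suc i) * \<alpha> v1 ^ i))"
    unfolding f_def sum_distrib_left
  proof (intro sum.cong refl)
    fix i
    have "var_poly v3 ^ (n - 1) * (y ^ (d - Suc i) * x ^ i) =
        const_poly ((- \<alpha> v2) ^ (d - Suc i) * \<alpha> v1 ^ i) * (var_poly v2 ^ (d - Suc i) * var_poly v1 ^ i * var_poly v3 ^ (n - 1))"
      unfolding x_def y_eq power_mult_distrib const_poly_power[symmetric] const_poly_simps(4) by (simp only: ac_simps)
    then show "var_poly v3 ^ (n - 1) * (y ^ (d - Suc i) * x ^ i) =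
        Poly_Mapping.single (m i) ((- \<alpha> v2) ^ (d - Suc i) * \<alpha> v1 ^ i)"
      by (simp add: var_poly_power mult_single const_poly_mult_single m_def del: const_poly_simps)
  qed
  show "f \<in> forms (4 * n - 2)"
    unfolding f_eq forms_eq_coforms
    by (intro coforms_sum coforms_single) (use \<open>n \<ge> 1\<close> in \<open>auto simp: m_def d_def\<close>)
  have m_last: "m (d - 1) = Poly_Mapping.single v1 (3 * n - 1) + Poly_Mapping.single v3 (n - 1)"
    using \<open>n \<ge> 1\<close> by (simp add: m_def d_def)
  have "m i = m (d - 1) \<longleftrightarrow> i = d - 1" for i
  proof
    assume "m i = m (d - 1)"
    then have "Poly_Mapping.lookup (m i) v1 = Poly_Mapping.lookup (m (d - 1)) v1"
      by simp
    then show "i = d - 1"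
      using dist by (auto simp: m_def lookup_add lookup_single)
  qed simp
  then have "Poly_Mapping.lookup f (m (d - 1)) = (\<Sum>i<d. if i = d - 1 then \<alpha> v1 ^ (d - 1) else 0)"
    unfolding f_eq lookup_sum lookup_single by (intro sum.cong) (auto simp: when_def)
  also have "\<dots> = \<alpha> v1 ^ (d - 1)"
    using \<open>n \<ge> 1\<close> by (simp add: d_def)
  finally have "m (d - 1) \<in> Poly_Mapping.keys f"
    using \<alpha> by (simp add: in_keys_iff)
  moreover have "\<not> in_gens e (m (d - 1))"
    unfolding m_last by (rule not_in_gens[where u = v2 and n = n]) (use dist e \<open>n \<ge> 1\<close> in auto)
  ultimately show "f \<notin> monomial_ideal e"
    by (auto simp: monomial_ideal_def)
next
  define d where "d = 3 * n"
  define f' :: "'k poly3" where "f' = var_poly v3 ^ (d - 1) * var_poly v2 ^ n"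
  show f'_forms: "f' \<in> forms (4 * n - 2 + 1)"
  proof -
    have "d - 1 + n = 4 * n - 2 + 1"
      using \<open>n \<ge> 1\<close> by (simp add: d_def)
    moreover have "f' \<in> coforms (0 + 0) (d - 1 + n)"
      unfolding f'_def by (intro coforms_mult var_poly_power_coforms)
    ultimately show ?thesis
      by (simp only: forms_eq_coforms add_0_right)
  qed
  fix g :: "'k poly3" assume g: "g \<in> forms (4 * n - 2)"
  show "f' - lin_form \<alpha> * g \<notin> monomial_ideal e"
  proof
    assume in_ideal: "f' - lin_form \<alpha> * g \<in> monomial_ideal e"
    \<comment> \<open>The line now passes through the coordinate point of \<open>v3\<close>, and
      \<open>\<theta>\<close> parametrises it with \<open>v3\<close> set to 1. The image of the
      ideal consists of \<open>P v3\<close>, of degree below \<open>n\<close>, and multiples of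
      powers beyond \<open>t ^ n\<close>, because \<open>e v1 + e v2 > n\<close>. So it misses
      \<open>X0 ^ n\<close>, the image of \<open>f'\<close>.\<close>
    define \<kappa> where "\<kappa> = - \<alpha> v2 / \<alpha> v1"
    define \<theta> where "\<theta> v = (if v = v1 then smult \<kappa> X0 else if v = v2 then X0 else 1)" for v
    have \<theta>: "\<theta> v1 = smult \<kappa> X0" "\<theta> v2 = X0" "\<theta> v3 = 1"
      using dist by (auto simp: \<theta>_def)
    have "lin_form \<alpha> * g \<in> forms (1 + (4 * n - 2))"
      using coforms_mult[of "lin_form \<alpha>" 0 1 g 0 "4 * n - 2"] lin_form_forms[of \<alpha>] g by (simp add: forms_eq_coforms)
    then have form: "f' - lin_form \<alpha> * g \<in> forms (4 * n - 2 + 1)"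
      using f'_forms coforms_diff unfolding forms_eq_coforms add.commute[of 1] by blast
    obtain P S where eq: "f' - lin_form \<alpha> * g = ideal_comb e P S"
      and P: "\<And>v. P v \<in> coforms (total_exp e) (4 * n - 2 + 1)"
      by (rule monomial_ideal_decomp[OF in_ideal form]) (rule that)
    have "4 * n - 2 + 1 = (n - 1) + total_exp e"
      using e(1) \<open>n \<ge> 1\<close> by simp
    then have "P v3 \<in> forms (n - 1)"
      using P[of v3] by (simp only: coforms_eq_forms)
    then have "eval3 \<theta> (P v3) \<in> polys_below (n - 1 + 1)"
      by (rule eval3_polys_below[rotated]) (simp add: \<theta>_def)
    then have P3: "poly.coeff (eval3 \<theta> (P v3)) n = 0"
      using \<open>n \<ge> 1\<close> by (simp add: polys_below_def)
    have total: "total_exp e = e v1 + e v2 + e v3"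
      by (rule total_exp_distinct[OF dist])
    have sum3: "(\<Sum>v\<in>UNIV. h v) = h v1 + h v2 + h v3" for h :: "var \<Rightarrow> 'k poly3"
      unfolding distinct_vars[OF dist] using dist by (simp add: add.assoc)
    have "eval3 \<theta> (lin_form \<alpha>) = smult (\<alpha> v1 * \<kappa> + \<alpha> v2) X0"
      by (simp add: lin_form_distinct[OF dist] \<theta> \<alpha>)
    also have "\<alpha> v1 * \<kappa> + \<alpha> v2 = 0"
      using \<alpha> by (simp add: \<kappa>_def)
    finally have "eval3 \<theta> (f' - lin_form \<alpha> * g) = X0 ^ n"
      by (simp add: f'_def \<theta>)
    moreover have "eval3 \<theta> (ideal_comb e P S) = smult (\<kappa> ^ d) (eval3 \<theta> (P v1)) * X0 ^ d + eval3 \<theta> (P v2) * X0 ^ d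
        + eval3 \<theta> (P v3) + smult (\<kappa> ^ e v1) (eval3 \<theta> S) * X0 ^ (e v1 + e v2)"
      unfolding ideal_comb_def sum3 mixed_gen_eq_prod[OF dist] eval3_add eval3_mult eval3_power eval3_var
        \<theta> e(1) d_def[symmetric] smult_power power_one power_add
      by (simp only: mult_smult_left mult_smult_right mult_1_left mult_1_right ac_simps)
    ultimately have "X0 ^ n = smult (\<kappa> ^ d) (eval3 \<theta> (P v1)) * X0 ^ d + eval3 \<theta> (P v2) * X0 ^ d
        + eval3 \<theta> (P v3) + smult (\<kappa> ^ e v1) (eval3 \<theta> S) * X0 ^ (e v1 + e v2)"
      by (simp only: eq)
    from arg_cong[OF this, of "\<lambda>h. poly.coeff h n"]
    have "poly.coeff (X0 ^ n :: 'k poly) n = 0"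
      using P3 e(2)[of v3] e(1) total \<open>n \<ge> 1\<close>
      by (simp only: coeff_add coeff_mult_X0_power d_def) simp
    then show False
      by (simp add: X0_power)
  qed
qed

text \<open>The target degree \<open>4 * n - 1\<close> is \<open>d + (n - 1)\<close>, where the
  system on the line is square of size \<open>4 * n\<close>. The symmetric relation lifts to an
  element annihilated by the linear form, and singularity supplies an element that is
  missed.\<close>

lemma not_lefschetz_general:
  fixes \<alpha> :: "var \<Rightarrow> 'k::field_char_0"
  assumes dist: "distinct [v1, v2, v3]" and nz: "\<And>v. \<alpha> v \<noteq> 0"
    and e: "total_exp e = 3 * n" "\<And>v. e v < 2 * n" "e v1 = e v2" and "odd n"
  shows "\<not> lefschetz e \<alpha> (4 * n - 2)"
proof -
  let ?\<theta> = "line_param v1 v2 \<alpha>"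
  have "n \<ge> 1"
    using \<open>odd n\<close> by (cases n) auto
  have total: "e v1 + e v2 + e v3 = 3 * n"
    using total_exp_distinct[OF dist, of e] e(1) by simp
  then have total': "e v1 + e v1 + e v3 = 3 * n"
    using e(3) by simp
  have co: "coforms (total_exp e) (4 * n - 2 + 1) = (forms (n - 1) :: 'k poly3 set)"
  proof -
    have "4 * n - 2 + 1 = (n - 1) + total_exp e"
      using e(1) \<open>n \<ge> 1\<close> by simp
    then show ?thesis
      by (simp only: coforms_eq_forms)
  qed
  have below: "eval3 ?\<theta> f \<in> polys_below n" if "f \<in> forms (n - 1)" for f
    using eval3_line_polys_below[where \<alpha> = \<alpha>, OF dist nz that] \<open>n \<ge> 1\<close> by simp
  obtain k1 k2 k3 k4 :: 'k where k: "k1 \<noteq> 0" "k2 \<noteq> 0" "k3 \<noteq> 0" "k4 \<noteq> 0"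
    and comb: "\<And>P S. eval3 ?\<theta> (ideal_comb e P S) = gen_comb (e v1) (e v2) (e v3)
      (smult k1 (eval3 ?\<theta> (P v1))) (smult k2 (eval3 ?\<theta> (P v2)))
      (smult k3 (eval3 ?\<theta> (P v3))) (smult k4 (eval3 ?\<theta> S))"
    by (rule eval3_ideal_comb[where \<alpha> = \<alpha> and e = e, OF dist nz]) (rule that)
  obtain p q r s :: "'k poly" where rel_below: "p \<in> polys_below n" "q \<in> polys_below n" "r \<in> polys_below n" "s \<in> polys_below n"
    and rel_nz: "\<not> (p = 0 \<and> r = 0 \<and> s = 0)" and "gen_comb (e v1) (e v1) (e v3) p q r s = 0"
    by (rule symmetric_relation[OF \<open>odd n\<close> total']) (rule that)
  then have rel: "gen_comb (e v1) (e v2) (e v3) p q r s = 0"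
    using e(3) by simp
  have lift: "\<exists>f\<in>forms (n - 1). eval3 ?\<theta> f = g" if "g \<in> polys_below n" for g
    using eval3_line_surj[where \<alpha> = \<alpha> and p = g and i = "n - 1", OF dist nz] that \<open>n \<ge> 1\<close> by simp
  obtain P1 where P1: "P1 \<in> forms (n - 1)" "eval3 ?\<theta> P1 = smult (inverse k1) p"
    using lift[OF smult_polys_below[OF rel_below(1)]] by blast
  obtain P2 where P2: "P2 \<in> forms (n - 1)" "eval3 ?\<theta> P2 = smult (inverse k2) q"
    using lift[OF smult_polys_below[OF rel_below(2)]] by blast
  obtain P3 where P3: "P3 \<in> forms (n - 1)" "eval3 ?\<theta> P3 = smult (inverse k3) r"
    using lift[OF smult_polys_below[OF rel_below(3)]] by blast
  obtain S where S: "S \<in> forms (n - 1)" "eval3 ?\<theta> S = smult (inverse k4) s"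
    using lift[OF smult_polys_below[OF rel_below(4)]] by blast
  define P where "P v = (if v = v1 then P1 else if v = v2 then P2 else P3)" for v
  have P: "P v1 = P1" "P v2 = P2" "P v3 = P3"
    using dist by (auto simp: P_def)
  have P_forms: "P v \<in> coforms (total_exp e) (4 * n - 2 + 1)" for v
    unfolding co P_def using P1(1) P2(1) P3(1) by auto
  have S_forms: "S \<in> coforms (total_exp e) (4 * n - 2 + 1)"
    unfolding co by (rule S)
  have "eval3 ?\<theta> (ideal_comb e P S) = 0"
    unfolding comb P P1 P2 P3 S using k rel by simp
  then obtain f where f: "f \<in> coforms 1 (4 * n - 2 + 1)" and Lf: "ideal_comb e P S = lin_form \<alpha> * f"
    using eval3_line_eq_0[where \<alpha> = \<alpha>, OF dist nz ideal_comb_forms[where P = P, OF P_forms S_forms]] by blast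
  have f_forms: "f \<in> forms (4 * n - 2)"
    using f unfolding coforms_eq_forms .
  have f_notin: "f \<notin> monomial_ideal e"
  proof
    assume f_in: "f \<in> monomial_ideal e"
    obtain P' S' where f_eq: "f = ideal_comb e P' S'"
      and P': "\<And>v. P' v \<in> coforms (total_exp e) (4 * n - 2)" and S': "S' \<in> coforms (total_exp e) (4 * n - 2)"
      by (rule monomial_ideal_decomp[OF f_in f_forms]) (rule that)
    have mult: "lin_form \<alpha> * g \<in> coforms (total_exp e) (4 * n - 2 + 1)" if "g \<in> coforms (total_exp e) (4 * n - 2)" for g
      using coforms_mult[OF _ that, of "lin_form \<alpha>" 0 1] lin_form_forms[of \<alpha>] by (simp add: forms_eq_coforms)
    \<comment> \<open>Subtracting \<open>lin_form \<alpha>\<close> times a representation of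
      \<open>f\<close> leaves a relation in a degree without syzygies. So \<open>P\<close> and
      \<open>S\<close> would be multiples of \<open>lin_form \<alpha>\<close> and vanish on the
      line.\<close>
    have comb0: "ideal_comb e (\<lambda>v. P v - lin_form \<alpha> * P' v) (S - lin_form \<alpha> * S') = 0"
      using Lf unfolding f_eq ideal_comb_diff_mult[symmetric] by simp
    have P_diff: "P v - lin_form \<alpha> * P' v \<in> coforms (total_exp e) (4 * n - 2 + 1)" for v
      by (intro coforms_diff P_forms mult P')
    have S_diff: "S - lin_form \<alpha> * S' \<in> coforms (total_exp e) (4 * n - 2 + 1)"
      by (intro coforms_diff S_forms mult S')
    have bound: "4 * n - 2 + 1 + e v < 2 * total_exp e" for v
      using e(1) e(2)[of v] by simp
    note zero = ideal_comb_eq_0[where e = e, OF comb0 P_diff S_diff bound]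
    have L0: "eval3 ?\<theta> (lin_form \<alpha>) = 0"
      by (rule eval3_line_lin_form[where \<alpha> = \<alpha>, OF dist nz])
    have "eval3 ?\<theta> (P v) = 0" for v
      using arg_cong[OF zero(1)[of v], of "eval3 ?\<theta>"] by (simp add: L0)
    moreover have "eval3 ?\<theta> S = 0"
      using arg_cong[OF zero(2), of "eval3 ?\<theta>"] by (simp add: L0)
    ultimately have "p = 0" "r = 0" "s = 0"
      using P1(2) P3(2) S(2) k P by (metis inverse_nonzero_iff_nonzero smult_eq_0_iff)+
    with rel_nz show False by simp
  qed
  have "\<not> gens_spanning TYPE('k) (e v1) (e v2) (e v3) n"
    using relation_imp_not_spanning[OF total rel_below _ rel] rel_nz by blast
  then obtain F where F: "F \<in> polys_below (3 * n + n)" and F_not: "\<And>p q r s. p \<in> polys_below n \<Longrightarrow>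
      q \<in> polys_below n \<Longrightarrow> r \<in> polys_below n \<Longrightarrow> s \<in> polys_below n \<Longrightarrow> F \<noteq> gen_comb (e v1) (e v2) (e v3) p q r (s :: 'k poly)"
    unfolding gens_spanning_def total by blast
  have "F \<in> polys_below (4 * n - 2 + 1 + 1)"
  proof -
    have "3 * n + n = 4 * n - 2 + 1 + 1"
      using \<open>n \<ge> 1\<close> by simp
    with F show ?thesis
      by (simp only:)
  qed
  then obtain f' where f': "f' \<in> forms (4 * n - 2 + 1)" "eval3 ?\<theta> f' = F"
    using eval3_line_surj[where \<alpha> = \<alpha>, OF dist nz] by blast
  show ?thesis
  proof (rule not_lefschetzI[OF f_forms _ f_notin f'(1)])
    show "lin_form \<alpha> * f \<in> monomial_ideal e"
      unfolding Lf[symmetric] by (rule ideal_comb_monomial_ideal)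
    fix g :: "'k poly3" assume g: "g \<in> forms (4 * n - 2)"
    show "f' - lin_form \<alpha> * g \<notin> monomial_ideal e"
    proof
      assume in_ideal: "f' - lin_form \<alpha> * g \<in> monomial_ideal e"
      have "lin_form \<alpha> * g \<in> forms (4 * n - 2 + 1)"
        using coforms_mult[of "lin_form \<alpha>" 0 1 g 0 "4 * n - 2"] lin_form_forms[of \<alpha>] g by (simp add: forms_eq_coforms)
      then have form: "f' - lin_form \<alpha> * g \<in> forms (4 * n - 2 + 1)"
        using f'(1) coforms_diff unfolding forms_eq_coforms by blast
      obtain P' S' where eq: "f' - lin_form \<alpha> * g = ideal_comb e P' S'"
        and P': "\<And>v. P' v \<in> coforms (total_exp e) (4 * n - 2 + 1)" and S': "S' \<in> coforms (total_exp e) (4 * n - 2 + 1)"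
        by (rule monomial_ideal_decomp[OF in_ideal form]) (rule that)
      have "F = eval3 ?\<theta> (ideal_comb e P' S')"
        unfolding eq[symmetric] by (simp add: f'(2) eval3_line_lin_form[where \<alpha> = \<alpha>, OF dist nz])
      then have F_eq: "F = gen_comb (e v1) (e v2) (e v3)
          (smult k1 (eval3 ?\<theta> (P' v1))) (smult k2 (eval3 ?\<theta> (P' v2)))
          (smult k3 (eval3 ?\<theta> (P' v3))) (smult k4 (eval3 ?\<theta> S'))"
        unfolding comb .
      have P'_below: "smult k (eval3 ?\<theta> (P' v)) \<in> polys_below n" for k v
        using P'[of v] unfolding co by (intro smult_polys_below below)
      have S'_below: "smult k (eval3 ?\<theta> S') \<in> polys_below n" for k
        using S' unfolding co by (intro smult_polys_below below)
      show False
        using F_not[OF P'_below P'_below P'_below S'_below] F_eq ..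
    qed
  qed
qed

text \<open>Every linear form has to fail, in the same degree \<open>4 * n - 2\<close>. If all its
  coefficients are nonzero, the variables are ordered so that two with equal exponents come first;
  \<open>a = c\<close> reduces to \<open>a = b\<close> by monotonicity.\<close>

lemma not_has_WLP:
  fixes K :: "'k::field_char_0 itself"
  assumes "odd n" "a + b + c = 3 * n" "a < 2 * n" "b \<le> a" "c \<le> b" "a = b \<or> b = c \<or> a = c"
  shows "\<not> has_WLP (R_algebra K a b c) (R_piece K a b c)"
proof -
  define e where "e = exps a b c"
  have total: "total_exp e = 3 * n"
    using assms(2) by (simp add: e_def)
  have small: "e v < 2 * n" for v
    using assms by (cases v) (simp_all add: e_def)
  have "n \<ge> 1"
    using \<open>odd n\<close> by (cases n) auto
  have "\<not> lefschetz e \<alpha> (4 * n - 2)" for \<alpha> :: "var \<Rightarrow> 'k"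
  proof -
    consider "\<And>v. \<alpha> v \<noteq> 0" | "\<And>v. \<alpha> v = 0" | v1 v3 where "\<alpha> v1 \<noteq> 0" "\<alpha> v3 = 0"
      by blast
    then show ?thesis
    proof cases
      case 1
      have "a = b \<or> b = c"
        using assms by auto
      then show ?thesis
      proof
        assume "a = b"
        then show ?thesis
          by (intro not_lefschetz_general[of VX VY VZ]) (use 1 total small \<open>odd n\<close> in \<open>simp_all add: e_def\<close>)
      next
        assume "b = c"
        then show ?thesis
          by (intro not_lefschetz_general[of VY VZ VX]) (use 1 total small \<open>odd n\<close> in \<open>simp_all add: e_def\<close>)
      qed
    next
      case 2
      show ?thesis
        by (rule not_lefschetz_zero[OF 2 total small \<open>n \<ge> 1\<close>])
    next
      case 3
      then have "v1 \<noteq> v3" by auto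
      then obtain v2 where "distinct [v1, v2, v3]"
        by (cases v1; cases v3) (auto intro: that[of VX] that[of VY] that[of VZ])
      then show ?thesis
        using not_lefschetz_two_variables[OF _ 3 total small \<open>n \<ge> 1\<close>] by blast
    qed
  qed
  then show ?thesis
    unfolding has_WLP_iff_lefschetz e_def by blast
qed

theorem proposition1:
  fixes K :: "'k::field_char_0 itself"
  assumes "\<forall>a b c :: nat.
      (\<exists>k::int. int (a + b + c) = 6 * k + 3 \<and> 4 * k + 2 > int a) \<and> a > b \<and> b > c \<and> c > 0
        \<longrightarrow> has_WLP (R_algebra K a b c) (R_piece K a b c)"
  shows "\<forall>a b c :: nat. a \<ge> b \<and> b \<ge> c \<longrightarrow>
      (\<not> has_WLP (R_algebra K a b c) (R_piece K a b c) \<longleftrightarrow>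
        (\<exists>k::int. int (a + b + c) = 6 * k + 3 \<and> int a < 4 * k + 2) \<and>
        (a = b \<or> b = c \<or> a = c))"
proof (intro allI impI)
  fix a b c :: nat assume ord: "a \<ge> b \<and> b \<ge> c"
  let ?W = "has_WLP (R_algebra K a b c) (R_piece K a b c)"
  let ?C = "\<exists>k::int. int (a + b + c) = 6 * k + 3 \<and> int a < 4 * k + 2"
  have C_iff: "?C \<longleftrightarrow> (\<exists>k. a + b + c = 6 * k + 3 \<and> a < 4 * k + 2)"
  proof
    assume ?C
    then obtain k :: int where k: "int (a + b + c) = 6 * k + 3" "int a < 4 * k + 2"
      by blast
    \<comment> \<open>Nonnegativity of \<open>6 * k + 3\<close> forces
      \<open>k >= 0\<close>.\<close>
    then have "a + b + c = 6 * nat k + 3" "a < 4 * nat k + 2"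
      by linarith+
    then show "\<exists>k. a + b + c = 6 * k + 3 \<and> a < 4 * k + 2"
      by blast
  next
    assume "\<exists>k. a + b + c = 6 * k + 3 \<and> a < 4 * k + 2"
    then obtain k where "a + b + c = 6 * k + 3" "a < 4 * k + 2"
      by blast
    then have "int (a + b + c) = 6 * int k + 3 \<and> int a < 4 * int k + 2"
      by linarith
    then show ?C
      by blast
  qed
  show "\<not> ?W \<longleftrightarrow> ?C \<and> (a = b \<or> b = c \<or> a = c)"
  proof
    assume "?C \<and> (a = b \<or> b = c \<or> a = c)"
    then obtain k where "a + b + c = 6 * k + 3" "a < 4 * k + 2" and "a = b \<or> b = c \<or> a = c"
      unfolding C_iff by blast
    then show "\<not> ?W"
      using ord by (intro not_has_WLP[of "2 * k + 1"]) auto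
  next
    assume not_W: "\<not> ?W"
    \<comment> \<open>The determinants settle \<open>c = 0\<close> and everything outside
      \<open>?C\<close> unconditionally; the assumption is called only for
      \<open>a > b > c > 0\<close>.\<close>
    have "c \<noteq> 0 \<and> ?C"
    proof (rule ccontr)
      assume "\<not> (c \<noteq> 0 \<and> ?C)"
      then have "c = 0 \<or> \<not> (\<exists>k. a + b + c = 6 * k + 3 \<and> a < 4 * k + 2)"
        unfolding C_iff by blast
      then obtain E E' where "gens_independent TYPE('k) a b c E" "gens_spanning TYPE('k) a b c E'" "E' \<le> E + 1"
        using gens_independent_and_spanning[of b a c] ord by blast
      then show False
        using has_WLP_if_independent_spanning not_W by blast
    qed
    moreover have "a = b \<or> b = c \<or> a = c"
    proof (rule ccontr)
      assume "\<not> ?thesis"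
      then have "a > b" "b > c" "c > 0"
        using ord calculation by auto
      then show False
        using assms calculation not_W by blast
    qed
    ultimately show "?C \<and> (a = b \<or> b = c \<or> a = c)"
      by blast
  qed
qed

end
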